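(* Let $A$ be a graded vector space. An $\mathcal{A}\mathsf{gd}_\infty$-algebra structure on $A$ is equivalent to a square-zero coderivation on the cofree $\mathcal{A}\mathsf{gd}^{¡}$-coalgebra $\mathcal{A}\mathsf{gd}^{¡}(A)$.
   Context: $\Bbbk$ is a field of characteristic zero; everything is $\Bbbk$-linear, and (co)operads are nonsymmetric (ns), graded, and zero in arity $0$. The degree of a homogeneous element or map $x$ is denoted $|x|$, and the usual Koszul signs appear when graded maps are evaluated on elements. An $\mathcal{A}\mathsf{gd}_\infty$-algebra structure on a graded vector space $A$ consists of collections of operations $m_n,h_n,\delta_n\colon A^{\otimes n}\to A$ ($n\ge1$) with $|m_n|=n-2$, $|h_n|=|\delta_n|=n-1$, such that for all $n\ge1$ (sums over $p,r\ge0$, $q\ge1$) $$\sum_{p+q+r=n}(-1)^{p+qr}m_{p+r+1}\circ_{p+1}m_q=0,$$ $$\sum_{p+q+r=n}(-1)^{p+qr}m_{p+r+1}\circ_{p+1}h_q+\sum_{p+q+r=n}(-1)^{p+q(r+1)}h_{p+r+1}\circ_{p+1}m_q=0,$$ $$\sum_{p+q+r=n,\; p\ge1}(-1)^{p+qr}m_{p+r+1}\circ_{p+1}h_q+\sum_{q+r=n}(-1)^{qr}m_{r+1}\circ_1\delta_q+\sum_{p+q+r=n}(-1)^{p+q(r+1)}\delta_{p+r+1}\circ_{p+1}m_q=0,$$ where, for $f$ of arity $k$, $f\circ_i g=f\circ(\mathrm{Id}^{\otimes i-1}\otimes g\otimes\mathrm{Id}^{\otimes k-i})$ inserts $g$ into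 the $i$-th input of $f$. $\mathcal{A}\mathsf{gd}$ is the ns operad encoding associative algebras equipped with a derivation $h$ and a generalized $h$-derivation $\delta$ (a linear map with $\delta(ab)=\delta(a)b+ah(b)$): it is the quadratic operad generated by unary operations $h,\delta$ and a binary operation $\mu$, all of degree $0$, with relations $\mu\circ_1\mu=\mu\circ_2\mu$, $h\circ_1\mu=\mu\circ_1h+\mu\circ_2h$, $\delta\circ_1\mu=\mu\circ_1\delta+\mu\circ_2h$. Its Koszul dual cooperad $\mathcal{A}\mathsf{gd}^{¡}$ is given by $\mathcal{A}\mathsf{gd}^{¡}(n)=\Bbbk\mu^c_n\oplus\Bbbk h^c_n\oplus\Bbbk\delta^c_n$ for $n\ge1$, with $|\mu^c_n|=n-1$, $|h^c_n|=|\delta^c_n|=n$, counit $\varepsilon(\mu^c_1)=\mathbf 1$, and infinitesimal decomposition (sums over $p,r\ge0$, $q\ge1$) $$\Delta_{(1)}(\mu^c_n)=\sum_{p+q+r=n}(-1)^{r(q-1)}\mu^c_{p+r+1}\boxtimes_{p+1}\mu^c_q,$$ $$\Delta_{(1)}(h^c_n)=\sum_{p+q+r=n}(-1)^{r(q-1)}\mu^c_{p+r+1}\boxtimes_{p+1}h^c_q+\sum_{p+q+r=n}(-1)^{(r+1)(q-1)}h^c_{p+r+1}\boxtimes_{p+1}\mu^c_q,$$ $$\Delta_{(1)}(\delta^c_n)=\sum_{p+q+r=n}(-1)^{(r+1)(q-1)}\delta^c_{p+r+1}\boxtimes_{p+1}\mu^c_q+\sum_{q+r=n}(-1)^{r(q-1)}\mu^c_{r+1}\boxtimes_1\delta^c_q+\sum_{p+q+r=n,\;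 p\ge1}(-1)^{r(q-1)}\mu^c_{p+r+1}\boxtimes_{p+1}h^c_q.$$ Here $\alpha\boxtimes_i\beta=\alpha\otimes(\mathbf 1^{\otimes i-1}\otimes\beta\otimes\mathbf 1^{\otimes k-i})$ for $\alpha$ of arity $k$, and $\Delta_{(1)}$ is obtained from the full decomposition map $\Delta$ by singling out one upper factor (in all ways) and applying $\varepsilon$ to the others. For a ns cooperad $\mathcal{C}$, the cofree $\mathcal{C}$-coalgebra on $A$ is $\mathcal{C}(A)=\bigoplus_n\mathcal{C}(n)\otimes A^{\otimes n}$ with structure map induced by $\Delta$. A coderivation on a $\mathcal{C}$-coalgebra $(C,\Delta_C)$, $\Delta_C\colon C\to\prod_n\mathcal{C}(n)\otimes C^{\otimes n}$, is a linear map $d_C\colon C\to C$ with $\Delta_C\circ d_C=\big(\sum_i\mathrm{Id}_{\mathcal{C}}\otimes(\mathrm{Id}_C^{\otimes i-1}\otimes d_C\otimes\mathrm{Id}_C^{\otimes n-i})\big)\circ\Delta_C$ (on the arity $n$ component of the target). Square-zero means that the composite of the coderivation with itself is $0$. *)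

theory Defs
  imports Complex_Main "HOL-Library.FuncSet" "HOL-Library.Function_Algebras"
begin

text \<open>
  Vector spaces over a field \<open>'k\<close> are subspaces \<open>V\<close> of a type \<open>'v\<close> on which
  \<open>s :: 'k \<Rightarrow> 'v \<Rightarrow> 'v\<close> is a vector space structure in the sense of \<^locale>\<open>vector_space\<close>;
  gradings are families \<open>G :: int \<Rightarrow> 'v set\<close> of subspaces. A linear map out of a tensor power
  \<open>V\<^sup>\<otimes>\<^sup>n\<close> is given by its multilinear function on lists of length \<open>n\<close>.
\<close>

section \<open>Graded vector spaces and Koszul signs\<close>

definition ksgn :: "int \<Rightarrow> 'v::ab_group_add \<Rightarrow> 'v" where
  "ksgn e x = (if even e then x else - x)"

definition linear_on ::
  "('k \<Rightarrow> 'v::ab_group_add \<Rightarrow> 'v) \<Rightarrow> ('k \<Rightarrow> 'w::ab_group_add \<Rightarrow> 'w) \<Rightarrow> 'v set \<Rightarrow> ('v \<Rightarrow> 'w) \<Rightarrow> bool"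
where
  "linear_on s t V f \<longleftrightarrow>
     (\<forall>x\<in>V. \<forall>y\<in>V. f (x + y) = f x + f y) \<and> (\<forall>c. \<forall>x\<in>V. f (s c x) = t c (f x))"

text \<open>Multilinearity in every arity at least one; values on the empty list are unconstrained.\<close>

definition multilinear_on ::
  "('k \<Rightarrow> 'v::ab_group_add \<Rightarrow> 'v) \<Rightarrow> ('k \<Rightarrow> 'w::ab_group_add \<Rightarrow> 'w) \<Rightarrow> 'v set \<Rightarrow> ('v list \<Rightarrow> 'w) \<Rightarrow> bool"
where
  "multilinear_on s t V f \<longleftrightarrow>
     (\<forall>xs ys. set xs \<subseteq> V \<longrightarrow> set ys \<subseteq> V \<longrightarrow> linear_on s t V (\<lambda>x. f (xs @ x # ys)))"

definition is_decomposition :: "(int \<Rightarrow> 'v::ab_group_add set) \<Rightarrow> 'v \<Rightarrow> (int \<Rightarrow> 'v) \<Rightarrow> bool" where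
  "is_decomposition G x f \<longleftrightarrow>
     (\<forall>i. f i \<in> G i) \<and> finite {i. f i \<noteq> 0} \<and> (\<Sum>i | f i \<noteq> 0. f i) = x"

definition graded_space ::
  "('k::field \<Rightarrow> 'v::ab_group_add \<Rightarrow> 'v) \<Rightarrow> 'v set \<Rightarrow> (int \<Rightarrow> 'v set) \<Rightarrow> bool"
where
  "graded_space s V G \<longleftrightarrow>
     vector_space s \<and> module.subspace s V \<and>
     (\<forall>i. module.subspace s (G i) \<and> G i \<subseteq> V) \<and>
     (\<forall>x\<in>V. \<exists>!f. is_decomposition G x f)"

definition hom_part :: "(int \<Rightarrow> 'v::ab_group_add set) \<Rightarrow> 'v \<Rightarrow> int \<Rightarrow> 'v" where
  "hom_part G x = (THE f. is_decomposition G x f)"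

text \<open>
  The linear extension of \<open>x \<mapsto> (-1)\<^bsup>e|x|\<^esup> x\<close> for homogeneous \<open>x\<close>. It expresses the Koszul sign for
  moving something of degree \<open>e\<close> past \<open>x\<close> without restricting to homogeneous \<open>x\<close>.
\<close>

definition koszul :: "(int \<Rightarrow> 'v::ab_group_add set) \<Rightarrow> int \<Rightarrow> 'v \<Rightarrow> 'v" where
  "koszul G e x = (\<Sum>i | hom_part G x i \<noteq> 0. ksgn (e * i) (hom_part G x i))"


section \<open>Homotopy associative algebras with derivation and generalized derivation\<close>

text \<open>
  The partial composite \<open>f \<circ>\<^bsub>p+1\<^esub> g\<close>, where \<open>g\<close> has arity \<open>q\<close> and degree \<open>e\<close>, evaluated on \<open>xs\<close>.
\<close>

definition pcomp ::
  "(int \<Rightarrow> 'a::ab_group_add set) \<Rightarrow> ('a list \<Rightarrow> 'a) \<Rightarrow> nat \<Rightarrow> ('a list \<Rightarrow> 'a) \<Rightarrow> int \<Rightarrow> nat \<Rightarrow> 'a list \<Rightarrow> 'a"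
where
  "pcomp G f p g e q xs =
     f (map (koszul G e) (take p xs) @ g (take q (drop p xs)) # drop (p + q) xs)"

definition splits :: "nat \<Rightarrow> (nat \<times> nat \<times> nat) set" where
  "splits n = {(p, q, r). p + q + r = n \<and> q \<ge> 1}"

text \<open>
  A family \<open>(f\<^sub>n)\<close>, \<open>n \<ge> 1\<close>, of operations \<open>A\<^sup>\<otimes>\<^sup>n \<rightarrow> A\<close> with \<open>f\<^sub>n\<close> of degree \<open>n + e\<close>. There is no
  operation of arity \<open>0\<close>: the value on the empty list carries no information and is set to \<open>0\<close>, so
  that distinct functions are distinct families.
\<close>

definition operations ::
  "('k \<Rightarrow> 'a::ab_group_add \<Rightarrow> 'a) \<Rightarrow> (int \<Rightarrow> 'a set) \<Rightarrow> int \<Rightarrow> ('a list \<Rightarrow> 'a) \<Rightarrow> bool"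
where
  "operations s G e f \<longleftrightarrow>
     f [] = 0 \<and> multilinear_on s s UNIV f \<and>
     (\<forall>xs ds. xs \<noteq> [] \<longrightarrow> list_all2 (\<lambda>x d. x \<in> G d) xs ds \<longrightarrow>
        f xs \<in> G (sum_list ds + int (length xs) + e))"

definition agd_infinity ::
  "('k \<Rightarrow> 'a::ab_group_add \<Rightarrow> 'a) \<Rightarrow> (int \<Rightarrow> 'a set) \<Rightarrow>
   ('a list \<Rightarrow> 'a) \<Rightarrow> ('a list \<Rightarrow> 'a) \<Rightarrow> ('a list \<Rightarrow> 'a) \<Rightarrow> bool"
where
  "agd_infinity s G m h \<delta> \<longleftrightarrow>
     operations s G (-2) m \<and> operations s G (-1) h \<and> operations s G (-1) \<delta> \<and>
     (\<forall>n\<ge>1. \<forall>xs. length xs = n \<longrightarrow>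
        (\<Sum>(p, q, r) \<in> splits n. ksgn (p + q * r) (pcomp G m p m (int q - 2) q xs)) = 0 \<and>
        (\<Sum>(p, q, r) \<in> splits n. ksgn (p + q * r) (pcomp G m p h (int q - 1) q xs)) +
        (\<Sum>(p, q, r) \<in> splits n. ksgn (p + q * (r + 1)) (pcomp G h p m (int q - 2) q xs)) = 0 \<and>
        (\<Sum>(p, q, r) \<in> {(p, q, r) \<in> splits n. p \<ge> 1}.
            ksgn (p + q * r) (pcomp G m p h (int q - 1) q xs)) +
        (\<Sum>(p, q, r) \<in> {(p, q, r) \<in> splits n. p = 0}.
            ksgn (q * r) (pcomp G m 0 \<delta> (int q - 1) q xs)) +
        (\<Sum>(p, q, r) \<in> splits n. ksgn (p + q * (r + 1)) (pcomp G \<delta> p m (int q - 2) q xs)) = 0)"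


section \<open>The Koszul dual cooperad\<close>

text \<open>The labels of the basis \<open>\<mu>\<^sup>c\<^sub>n, h\<^sup>c\<^sub>n, \<delta>\<^sup>c\<^sub>n\<close> of the component of arity \<open>n \<ge> 1\<close>.\<close>

datatype agd = Mu | H | Dl

instantiation agd :: finite
begin
instance
proof
  have "(UNIV :: agd set) \<subseteq> {Mu, H, Dl}"
    using agd.exhaust by blast
  then show "finite (UNIV :: agd set)"
    by (rule finite_subset) simp
qed
end

definition cdeg :: "agd \<Rightarrow> nat \<Rightarrow> int" where
  "cdeg c n = (if c = Mu then int n - 1 else int n)"

definition dsgn :: "nat list \<Rightarrow> nat" where
  "dsgn is = (\<Sum>j<length is. (is ! j - 1) * (length is - 1 - j))"

definition tsgn :: "nat \<Rightarrow> nat list \<Rightarrow> nat" where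
  "tsgn v is = (\<Sum>j=v..<length is. is ! j - 1)"

definition upper_label :: "agd \<Rightarrow> nat \<Rightarrow> agd" where
  "upper_label c j = (if c = Dl \<and> j = 0 then Dl else H)"

text \<open>
  The full decomposition map \<open>\<Delta>\<close>: for \<open>w = [(c\<^sub>1, i\<^sub>1), \<dots>, (c\<^sub>k, i\<^sub>k)]\<close> with all \<open>i\<^sub>j \<ge> 1\<close> and
  \<open>n = i\<^sub>1 + \<dots> + i\<^sub>k\<close>, the number \<open>agd_decomp c c\<^sub>0 w\<close> is the coefficient of
  \<open>(c\<^sub>0)\<^sub>k \<otimes> ((c\<^sub>1)\<^bsub>i\<^sub>1\<^esub> \<otimes> \<dots> \<otimes> (c\<^sub>k)\<^bsub>i\<^sub>k\<^esub>)\<close> in \<open>\<Delta>(c\<^sub>n)\<close>.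
  A coassociative counital \<open>\<Delta>\<close> is determined by its infinitesimal part \<open>\<Delta>\<^sub>(\<^sub>1\<^sub>)\<close>; the one below is
  the one with the prescribed \<open>\<Delta>\<^sub>(\<^sub>1\<^sub>)\<close> (lemma \<open>agd_infinitesimal\<close>). For \<open>\<mu>\<^sup>c\<close> the sign is the standard
  one \<open>(-1)\<^bsup>\<Sum>(i\<^sub>j - 1)(k - j)\<^esup>\<close> of the Koszul dual of the associative operad. For the others think of
  \<open>h\<^sup>c\<close> and \<open>\<delta>\<^sup>c\<close> as \<open>\<mu>\<^sup>c\<close> followed on the right by a symbol of degree \<open>1\<close>, which is moved
  to the left past the factors \<open>\<mu>\<^sup>c\<close> standing after the place where it ends up.
\<close>

definition agd_decomp :: "agd \<Rightarrow> agd \<Rightarrow> (agd \<times> nat) list \<Rightarrow> int" where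
  "agd_decomp c c0 w =
     (let cs = map fst w; is = map snd w; k = length w in
       (if c0 = c \<and> cs = replicate k Mu
        then (-1) ^ (dsgn is + (if c = Mu then 0 else tsgn 0 is)) else 0) +
       (if c \<noteq> Mu \<and> c0 = Mu
        then \<Sum>j<k. if cs = (replicate k Mu)[j := upper_label c j]
                     then (-1) ^ (dsgn is + tsgn (Suc j) is) else 0
        else 0))"

text \<open>
  The counit is \<open>1\<close> on \<open>\<mu>\<^sup>c\<^sub>1\<close> and \<open>0\<close> on all other basis elements, so the coefficient of
  \<open>(c\<^sub>0)\<^bsub>p+r+1\<^esub> \<boxtimes>\<^bsub>p+1\<^esub> e\<^sub>q\<close> in \<open>\<Delta>\<^sub>(\<^sub>1\<^sub>)(c\<^bsub>p+q+r\<^esub>)\<close> is the coefficient in \<open>\<Delta>\<close> computed here.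
\<close>

lemma dsgn_infinitesimal:
  assumes "q \<ge> 1"
  shows "dsgn (replicate p 1 @ [q] @ replicate r 1) = (q - 1) * r"
proof -
  have "dsgn (replicate p 1 @ [q] @ replicate r 1) =
      (\<Sum>j<p + Suc r. if j = p then (q - 1) * r else 0)"
    unfolding dsgn_def by (rule sum.cong) (auto simp: nth_append nth_Cons')
  then show ?thesis by simp
qed

lemma tsgn_infinitesimal:
  assumes "q \<ge> 1" "v \<le> p + Suc r"
  shows "tsgn v (replicate p 1 @ [q] @ replicate r 1) = (if v \<le> p then q - 1 else 0)"
proof -
  have "tsgn v (replicate p 1 @ [q] @ replicate r 1) =
      (\<Sum>j=v..<p + Suc r. if j = p then q - 1 else 0)"
    unfolding tsgn_def by (rule sum.cong) (auto simp: nth_append nth_Cons')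
  then show ?thesis by simp
qed

lemma label_eq:
  assumes "j < p + Suc r" "u \<noteq> Mu"
  shows "replicate p Mu @ [e] @ replicate r Mu = (replicate (p + Suc r) Mu)[j := u] \<longleftrightarrow> j = p \<and> e = u"
proof -
  have "(replicate (p + Suc r) Mu)[p := u] = replicate p Mu @ [u] @ replicate r Mu"
    by (simp only: replicate_add list_update_append) simp
  moreover have "j = p" if "replicate p Mu @ [e] @ replicate r Mu = (replicate (p + Suc r) Mu)[j := u]"
  proof (rule ccontr)
    assume "j \<noteq> p"
    have "(replicate p Mu @ [e] @ replicate r Mu) ! j = u"
      unfolding that using assms by (simp only: nth_list_update_eq length_replicate)
    then show False using \<open>j \<noteq> p\<close> assms by (auto simp: nth_append nth_Cons' split: if_splits)
  qed
  ultimately show ?thesis by auto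
qed

lemma agd_infinitesimal:
  assumes "q \<ge> 1"
  defines "w \<equiv> \<lambda>p e r. replicate p (Mu, 1) @ [(e, q)] @ replicate r (Mu, 1)"
  shows "agd_decomp Mu c0 (w p e r) = (if c0 = Mu \<and> e = Mu then (-1) ^ (r * (q - 1)) else 0)"
    and "agd_decomp H c0 (w p e r) =
      (if c0 = Mu \<and> e = H then (-1) ^ (r * (q - 1)) else 0) +
      (if c0 = H \<and> e = Mu then (-1) ^ ((r + 1) * (q - 1)) else 0)"
    and "agd_decomp Dl c0 (w p e r) =
      (if c0 = Dl \<and> e = Mu then (-1) ^ ((r + 1) * (q - 1)) else 0) +
      (if c0 = Mu \<and> e = Dl \<and> p = 0 then (-1) ^ (r * (q - 1)) else 0) +
      (if c0 = Mu \<and> e = H \<and> p \<ge> 1 then (-1) ^ (r * (q - 1)) else 0)"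
proof -
  have m: "map fst (w p e r) = replicate p Mu @ [e] @ replicate r Mu"
    "map snd (w p e r) = replicate p 1 @ [q] @ replicate r 1"
    "length (w p e r) = p + Suc r"
    by (simp_all add: w_def)
  have a: "replicate p Mu @ [e] @ replicate r Mu = replicate (p + Suc r) Mu \<longleftrightarrow> e = Mu"
    by (simp only: replicate_add replicate_Suc append_same_eq same_append_eq) simp
  have u: "upper_label c j \<noteq> Mu" for c j
    by (simp add: upper_label_def)
  have b: "(\<Sum>j<p + Suc r. if map fst (w p e r) = (replicate (p + Suc r) Mu)[j := upper_label c j]
       then (-1) ^ (dsgn (map snd (w p e r)) + tsgn (Suc j) (map snd (w p e r))) else (0::int)) =
     (if e = upper_label c p then (-1) ^ (r * (q - 1)) else 0)" (is "?L = _") for c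
  proof -
    have "?L = (\<Sum>j<p + Suc r. if j = p then
       (if e = upper_label c p then (-1) ^ (r * (q - 1)) else (0::int)) else 0)"
      unfolding m
    proof (rule sum.cong)
      fix j assume "j \<in> {..<p + Suc r}"
      then have j: "j < p + Suc r" by simp
      show "(if replicate p Mu @ [e] @ replicate r Mu = (replicate (p + Suc r) Mu)[j := upper_label c j]
          then (-1) ^ (dsgn (replicate p 1 @ [q] @ replicate r 1) +
             tsgn (Suc j) (replicate p 1 @ [q] @ replicate r 1)) else (0::int)) =
        (if j = p then (if e = upper_label c p then (-1) ^ (r * (q - 1)) else 0) else 0)"
        unfolding label_eq[OF j u] dsgn_infinitesimal[OF assms(1)]
        using j tsgn_infinitesimal[OF assms(1), of "Suc j" p r] by (auto simp: mult.commute)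
    qed simp
    then show ?thesis by simp
  qed
  have t: "dsgn (map snd (w p e r)) = r * (q - 1)" "tsgn 0 (map snd (w p e r)) = q - 1"
    unfolding m using dsgn_infinitesimal[OF assms(1)] tsgn_infinitesimal[OF assms(1), of 0 p r]
    by (simp_all add: mult.commute)
  have z: "agd_decomp c c0 (w p e r) =
      (if c0 = c \<and> e = Mu then (-1) ^ (r * (q - 1) + (if c = Mu then 0 else q - 1)) else 0) +
      (if c \<noteq> Mu \<and> c0 = Mu then if e = upper_label c p then (-1) ^ (r * (q - 1)) else 0 else 0)" for c
    unfolding agd_decomp_def Let_def m(3) unfolding b unfolding t by (simp only: m(1) a)
  have s: "(r + 1) * (q - 1) = r * (q - 1) + (q - 1)" by simp
  show "agd_decomp Mu c0 (w p e r) = (if c0 = Mu \<and> e = Mu then (-1) ^ (r * (q - 1)) else 0)"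
    unfolding z by simp
  show "agd_decomp H c0 (w p e r) =
      (if c0 = Mu \<and> e = H then (-1) ^ (r * (q - 1)) else 0) +
      (if c0 = H \<and> e = Mu then (-1) ^ ((r + 1) * (q - 1)) else 0)"
    unfolding z s by (auto simp: upper_label_def)
  show "agd_decomp Dl c0 (w p e r) =
      (if c0 = Dl \<and> e = Mu then (-1) ^ ((r + 1) * (q - 1)) else 0) +
      (if c0 = Mu \<and> e = Dl \<and> p = 0 then (-1) ^ (r * (q - 1)) else 0) +
      (if c0 = Mu \<and> e = H \<and> p \<ge> 1 then (-1) ^ (r * (q - 1)) else 0)"
    unfolding z s by (auto simp: upper_label_def)
qed

section \<open>Cofree coalgebras and coderivations\<close>

text \<open>
  \<open>\<C>(V) = \<Oplus>\<^sub>n \<C>(n) \<otimes> V\<^sup>\<otimes>\<^sup>n\<close> for the cooperad \<open>\<C>\<close> above. Since \<open>\<C>(n)\<close> has the basis \<open>\<mu>\<^sup>c\<^sub>n, h\<^sup>c\<^sub>n, \<delta>\<^sup>c\<^sub>n\<close>,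
  a linear form on \<open>\<C>(V)\<close> is a family \<open>\<phi> c\<close> of functions on nonempty lists over \<open>V\<close>, multilinear in
  each arity. Over a field a vector space embeds into the dual of its space of linear forms, so
  \<open>\<C>(V)\<close> is realised as the span of the evaluation functionals
  \<open>c \<otimes> x\<^sub>1 \<otimes> \<dots> \<otimes> x\<^sub>n = (\<phi> \<mapsto> \<phi> c [x\<^sub>1, \<dots>, x\<^sub>n])\<close>. The construction can be iterated, because the result
  is again a subspace of a vector space.
\<close>

type_synonym ('k, 'v) cof = "(agd \<Rightarrow> 'v list \<Rightarrow> 'k) \<Rightarrow> 'k"

definition fscale :: "'k::field \<Rightarrow> ('x \<Rightarrow> 'k) \<Rightarrow> ('x \<Rightarrow> 'k)" where
  "fscale a f = (\<lambda>x. a * f x)"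

lemma vector_space_fscale: "vector_space (fscale :: 'k::field \<Rightarrow> ('x \<Rightarrow> 'k) \<Rightarrow> ('x \<Rightarrow> 'k))"
  by unfold_locales (auto simp: fscale_def fun_eq_iff algebra_simps)

definition forms ::
  "('k::field \<Rightarrow> 'v::ab_group_add \<Rightarrow> 'v) \<Rightarrow> 'v set \<Rightarrow> (agd \<Rightarrow> 'v list \<Rightarrow> 'k) set"
where
  "forms s V = {\<phi>. \<forall>c. multilinear_on s (*) V (\<phi> c)}"

definition pure ::
  "('k::field \<Rightarrow> 'v::ab_group_add \<Rightarrow> 'v) \<Rightarrow> 'v set \<Rightarrow> agd \<Rightarrow> 'v list \<Rightarrow> ('k, 'v) cof"
where
  "pure s V c xs = (\<lambda>\<phi>. if \<phi> \<in> forms s V then \<phi> c xs else 0)"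

definition cof_space ::
  "('k::field \<Rightarrow> 'v::ab_group_add \<Rightarrow> 'v) \<Rightarrow> 'v set \<Rightarrow> ('k, 'v) cof set"
where
  "cof_space s V = module.span fscale {pure s V c xs | c xs. xs \<noteq> [] \<and> set xs \<subseteq> V}"

definition cof_grading ::
  "('k::field \<Rightarrow> 'v::ab_group_add \<Rightarrow> 'v) \<Rightarrow> 'v set \<Rightarrow> (int \<Rightarrow> 'v set) \<Rightarrow> int \<Rightarrow> ('k, 'v) cof set"
where
  "cof_grading s V G k = module.span fscale
     {pure s V c xs | c xs ds. xs \<noteq> [] \<and> list_all2 (\<lambda>x d. x \<in> G d) xs ds \<and>
        k = cdeg c (length xs) + sum_list ds}"

text \<open>
  The linear map \<open>\<C>(V) \<rightarrow> \<C>(W)\<close> with \<open>c \<otimes> x\<^sub>1 \<otimes> \<dots> \<otimes> x\<^sub>n \<mapsto> M c [x\<^sub>1, \<dots>, x\<^sub>n]\<close>, for multilinear \<open>M\<close>.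
\<close>

definition cof_lift ::
  "(agd \<Rightarrow> 'v list \<Rightarrow> ('k, 'w) cof) \<Rightarrow> ('k, 'v) cof \<Rightarrow> ('k, 'w) cof"
where
  "cof_lift M x = (\<lambda>\<psi>. x (\<lambda>c xs. M c xs \<psi>))"

lemma cof_lift_linear:
  fixes M :: "agd \<Rightarrow> 'v list \<Rightarrow> ('k::field, 'w) cof"
  shows "cof_lift M (x + y) = cof_lift M x + cof_lift M y"
    and "cof_lift M (fscale a x) = fscale a (cof_lift M x)"
  by (simp_all add: cof_lift_def fscale_def fun_eq_iff)

lemma cof_lift_pure:
  assumes "\<And>\<psi>. (\<lambda>c xs. M c xs \<psi>) \<in> forms s V"
  shows "cof_lift M (pure s V c xs) = M c xs"
  using assms by (simp add: cof_lift_def pure_def)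

text \<open>
  For \<open>w = [(c\<^sub>1, i\<^sub>1), \<dots>, (c\<^sub>k, i\<^sub>k)]\<close>, cut \<open>xs\<close> into consecutive blocks of lengths \<open>i\<^sub>1, \<dots>, i\<^sub>k\<close> and form
  the list of the \<open>c\<^sub>j \<otimes> block\<^sub>j\<close>. The Koszul sign arises from moving \<open>(c\<^sub>j)\<^bsub>i\<^sub>j\<^esub>\<close> past the earlier blocks.
\<close>

fun blocks ::
  "('k::field \<Rightarrow> 'v::ab_group_add \<Rightarrow> 'v) \<Rightarrow> 'v set \<Rightarrow> (int \<Rightarrow> 'v set) \<Rightarrow>
   (agd \<times> nat) list \<Rightarrow> 'v list \<Rightarrow> ('k, 'v) cof list"
where
  "blocks s V G [] xs = []"
| "blocks s V G ((c, i) # w) xs =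
     pure s V c (map (koszul G (\<Sum>(c', i')\<leftarrow>w. cdeg c' i')) (take i xs)) #
     blocks s V G w (drop i xs)"

text \<open>The structure map \<open>\<C>(V) \<rightarrow> \<C>(\<C>(V))\<close> of the cofree coalgebra, induced by \<open>\<Delta>\<close>.\<close>

definition cof_decomp ::
  "('k::field \<Rightarrow> 'v::ab_group_add \<Rightarrow> 'v) \<Rightarrow> 'v set \<Rightarrow> (int \<Rightarrow> 'v set) \<Rightarrow>
   ('k, 'v) cof \<Rightarrow> ('k, ('k, 'v) cof) cof"
where
  "cof_decomp s V G = cof_lift (\<lambda>c xs.
     \<Sum>c0\<in>UNIV. \<Sum>w | (\<forall>(c', i)\<in>set w. i \<ge> 1) \<and> sum_list (map snd w) = length xs.
       fscale (of_int (agd_decomp c c0 w))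
         (pure fscale (cof_space s V) c0 (blocks s V G w xs)))"

text \<open>
  The map \<open>\<Sum>\<^sub>i Id\<^sub>\<C> \<otimes> (Id\<^sup>\<otimes>\<^sup>i\<^sup>-\<^sup>1 \<otimes> d \<otimes> Id\<^sup>\<otimes>\<^sup>n\<^sup>-\<^sup>i)\<close> on \<open>\<C>(C)\<close>, for \<open>d\<close> of degree \<open>e\<close>.
\<close>

definition cof_deriv ::
  "('k::field \<Rightarrow> 'c::ab_group_add \<Rightarrow> 'c) \<Rightarrow> 'c set \<Rightarrow> (int \<Rightarrow> 'c set) \<Rightarrow> int \<Rightarrow> ('c \<Rightarrow> 'c) \<Rightarrow>
   ('k, 'c) cof \<Rightarrow> ('k, 'c) cof"
where
  "cof_deriv s C G e d = cof_lift (\<lambda>c xs.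
     \<Sum>i<length xs. ksgn (e * cdeg c (length xs))
       (pure s C c (map (koszul G e) (take i xs) @ d (xs ! i) # drop (Suc i) xs)))"

text \<open>
  Coderivations of degree \<open>e\<close> of a coalgebra \<open>(C, \<Delta>)\<close> with grading \<open>G\<close>; the values of \<open>d\<close> outside
  the carrier \<open>C\<close> are fixed to be \<open>undefined\<close>, so that \<open>d\<close> stands for a map \<open>C \<rightarrow> C\<close>.
\<close>

definition coderivation ::
  "('k::field \<Rightarrow> 'c::ab_group_add \<Rightarrow> 'c) \<Rightarrow> 'c set \<Rightarrow> (int \<Rightarrow> 'c set) \<Rightarrow>
   ('c \<Rightarrow> ('k, 'c) cof) \<Rightarrow> int \<Rightarrow> ('c \<Rightarrow> 'c) \<Rightarrow> bool"
where
  "coderivation s C G \<Delta> e d \<longleftrightarrow>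
     d \<in> C \<rightarrow>\<^sub>E C \<and> linear_on s s C d \<and>
     (\<forall>k. \<forall>x\<in>G k. d x \<in> G (k + e)) \<and>
     (\<forall>x\<in>C. \<Delta> (d x) = cof_deriv s C G e d (\<Delta> x))"

definition square_zero :: "'c::zero set \<Rightarrow> ('c \<Rightarrow> 'c) \<Rightarrow> bool" where
  "square_zero C d \<longleftrightarrow> (\<forall>x\<in>C. d (d x) = 0)"

text \<open>
  The projection \<open>\<epsilon> \<otimes> Id: \<C>(A) \<rightarrow> A\<close>, sending \<open>\<mu>\<^sup>c\<^sub>1 \<otimes> a\<close> to \<open>a\<close> and killing the other summands. The
  element \<open>a\<close> is recovered from the values at \<open>x\<close> of the linear forms induced from those on \<open>A\<close>.
\<close>

definition cof_proj ::
  "('k::field \<Rightarrow> 'a::ab_group_add \<Rightarrow> 'a) \<Rightarrow> ('k, 'a) cof \<Rightarrow> 'a"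
where
  "cof_proj s x = (THE a. \<forall>f. Vector_Spaces.linear s (*) f \<longrightarrow>
     f a = x (\<lambda>c xs. if c = Mu \<and> length xs = 1 then f (hd xs) else 0))"

text \<open>
  The operations \<open>A\<^sup>\<otimes>\<^sup>n \<rightarrow> A\<close>, \<open>n \<ge> 1\<close>, obtained by restricting the corestriction of \<open>d\<close> to \<open>A\<close>
  to the summands \<open>c\<^sub>n \<otimes> A\<^sup>\<otimes>\<^sup>n\<close>.
\<close>

definition component ::
  "('k::field \<Rightarrow> 'a::ab_group_add \<Rightarrow> 'a) \<Rightarrow> (('k, 'a) cof \<Rightarrow> ('k, 'a) cof) \<Rightarrow> agd \<Rightarrow> 'a list \<Rightarrow> 'a"
where
  "component s d c xs = (if xs = [] then 0 else cof_proj s (d (pure s UNIV c xs)))"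

end

theory Submission
  imports Defs
begin

text \<open>
  A coderivation \<open>d\<close> of the cofree coalgebra is recovered from its corestriction to \<open>A\<close>: project every
  upper factor of \<open>\<Delta> (d x) = d (\<Delta> x)\<close> to \<open>A\<close> and use counitality. Conversely, a family \<open>D\<close> of
  operations extends to \<open>d = (Id \<circ>\<^sub>(\<^sub>1\<^sub>) D) \<Delta>\<^sub>(\<^sub>1\<^sub>)\<close>, and \<open>\<Delta> d = d \<Delta>\<close> reduces to a coassociativity
  identity between the coefficients of \<open>\<Delta>\<close> and \<open>\<Delta>\<^sub>(\<^sub>1\<^sub>)\<close>, valid separately for each way of
  choosing a block and an inner segment of it. So coderivations of degree \<open>-1\<close> correspond to triples
  \<open>(m, h, \<delta>)\<close>. Since \<open>d\<close> has odd degree, \<open>d\<^sup>2\<close> is again a coderivation (the mixed terms cancel) and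
  vanishes iff its corestriction does; the three components of that corestriction are the left-hand
  sides of the three families of defining relations.
\<close>

section \<open>Signs and linear maps on subspaces\<close>

text \<open>The cofree construction is applied twice, and C(A) is a span of functionals instead of a
  whole type. So graded spaces are treated for a carrier V inside a type and then instantiated for A
  and, under the prefix \<open>C\<close>, for C(A): \<open>P\<close> and \<open>C\<close> are the
  pure tensors and the carrier of C(A), \<open>C.P\<close> and \<open>C.C\<close> those of C(C(A)).
  This needs the degree components of C(A), given as spans, to form a direct sum.

  Koszul signs are linear operators on vectors that need not be homogeneous. Every identity is
  therefore one between multilinear functions, and signs that depend on degrees of entries are
  computed on homogeneous entries only.

  The two sides of the coderivation property have different intermediate labels, so coefficients are
  compared after summing over these. Since \<Delta> preserves degrees, the Koszul signs do not
  depend on the intermediate label and leave the sum; what remains is an identity between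
  integers.\<close>

definition sg :: "int \<Rightarrow> int" where
  "sg e = (if even e then 1 else -1)"

lemma sg_simps [simp]: "sg 0 = 1" "sg (- a) = sg a" "sg a * sg a = 1"
  by (auto simp: sg_def)

lemma sg_add: "sg (a + b) = sg a * sg b"
  by (auto simp: sg_def)

lemma sg_diff: "sg (a - b) = sg a * sg b"
  by (auto simp: sg_def)

lemma sg_cong: "even (a - b) \<Longrightarrow> sg a = sg b"
  by (auto simp: sg_def)

lemma power_neg_one_sg: "(-1) ^ n = sg (int n)"
  by (auto simp: sg_def)

lemma ksgn_simps [simp]: "ksgn 0 x = x" "ksgn e 0 = 0" "ksgn (- e) x = ksgn e x"
  by (auto simp: ksgn_def)

lemma ksgn_ksgn: "ksgn a (ksgn b x) = ksgn (a + b) x"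
  by (auto simp: ksgn_def)

lemma ksgn_add: "ksgn e (x + y) = ksgn e x + ksgn e y"
  by (auto simp: ksgn_def)

lemma ksgn_sum: "ksgn e (sum f S) = (\<Sum>i\<in>S. ksgn e (f i))"
  by (auto simp: ksgn_def sum_negf)

lemma ksgn_cong: "even (a - b) \<Longrightarrow> ksgn a x = ksgn b x"
  by (auto simp: ksgn_def)

lemma vector_space_mult: "vector_space ((*) :: 'k::field \<Rightarrow> 'k \<Rightarrow> 'k)"
  by unfold_locales (auto simp: algebra_simps)

context vector_space
begin

lemma ksgn_scale: "ksgn e x = scale (of_int (sg e)) x"
  by (auto simp: ksgn_def sg_def)

lemma scale_ksgn: "scale a (ksgn e x) = ksgn e (scale a x)"
  by (auto simp: ksgn_def)

lemma subspace_ksgn: "subspace V \<Longrightarrow> x \<in> V \<Longrightarrow> ksgn e x \<in> V"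
  by (auto simp: ksgn_def subspace_neg)

end

lemma fscale_simps [simp]: "fscale 0 x = 0" "fscale 1 x = x" "fscale a 0 = 0"
  by (auto simp: fscale_def fun_eq_iff)

lemma ksgn_fscale: "ksgn e x = fscale (of_int (sg e)) x"
  by (rule vector_space.ksgn_scale) (rule vector_space_fscale)

lemma linear_onI:
  assumes "\<And>x y. x \<in> V \<Longrightarrow> y \<in> V \<Longrightarrow> f (x + y) = f x + f y"
    and "\<And>c x. x \<in> V \<Longrightarrow> f (s c x) = t c (f x)"
  shows "linear_on s t V f"
  using assms by (auto simp: linear_on_def)

text \<open>Linearity is known on a carrier only. Interpreted for the map that varies a single entry
  of a multilinear function, this locale moves sums, scalars and signs out of that entry.\<close>

locale linear_on_sp =
  fixes s :: "'k::field \<Rightarrow> 'v::ab_group_add \<Rightarrow> 'v" and t :: "'k \<Rightarrow> 'w::ab_group_add \<Rightarrow> 'w"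
    and V :: "'v set" and f :: "'v \<Rightarrow> 'w"
  assumes vs: "vector_space s" and vt: "vector_space t"
    and sub: "module.subspace s V" and lin: "linear_on s t V f"
begin

sublocale s: vector_space s by (rule vs)
sublocale t: vector_space t by (rule vt)

lemma add: "x \<in> V \<Longrightarrow> y \<in> V \<Longrightarrow> f (x + y) = f x + f y"
  and scale: "x \<in> V \<Longrightarrow> f (s c x) = t c (f x)"
  using lin by (auto simp: linear_on_def)

lemma zero: "f 0 = 0"
  using scale[of 0 0] s.subspace_0[OF sub] by simp

lemma neg: "x \<in> V \<Longrightarrow> f (- x) = - f x"
  using scale[of x "-1"] by simp

lemma ksgn: "x \<in> V \<Longrightarrow> f (ksgn e x) = ksgn e (f x)"
  by (auto simp: ksgn_def neg)

lemma sum: "(\<And>i. i \<in> S \<Longrightarrow> g i \<in> V) \<Longrightarrow> f (sum g S) = (\<Sum>i\<in>S. f (g i))"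
proof (induction S rule: infinite_finite_induct)
  case (insert x F)
  then have "sum g F \<in> V" by (auto intro: s.subspace_sum[OF sub])
  with insert show ?case by (auto simp: add)
qed (auto simp: zero)

end

lemma linear_on_compose:
  assumes "linear_on s t V f" "linear_on t u W g" "\<And>x. x \<in> V \<Longrightarrow> f x \<in> W"
  shows "linear_on s u V (\<lambda>x. g (f x))"
  using assms by (auto simp: linear_on_def)

lemma linear_on_subset: "linear_on s t V f \<Longrightarrow> U \<subseteq> V \<Longrightarrow> linear_on s t U f"
  unfolding linear_on_def by blast

text \<open>One arity at a time: the functions below cut lists at fixed places or have coefficients
  depending on the length, and they are assembled separately for each length n.\<close>

definition mlin ::
  "('k \<Rightarrow> 'v::ab_group_add \<Rightarrow> 'v) \<Rightarrow> ('k \<Rightarrow> 'w::ab_group_add \<Rightarrow> 'w) \<Rightarrow> 'v set \<Rightarrow> nat \<Rightarrow> ('v list \<Rightarrow> 'w) \<Rightarrow> bool"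
where
  "mlin s t V n f \<longleftrightarrow>
     (\<forall>xs ys. set xs \<subseteq> V \<longrightarrow> set ys \<subseteq> V \<longrightarrow> length xs + Suc (length ys) = n \<longrightarrow>
        linear_on s t V (\<lambda>x. f (xs @ x # ys)))"

lemma mlinI:
  assumes "\<And>xs ys. set xs \<subseteq> V \<Longrightarrow> set ys \<subseteq> V \<Longrightarrow> length xs + Suc (length ys) = n \<Longrightarrow>
     linear_on s t V (\<lambda>x. f (xs @ x # ys))"
  shows "mlin s t V n f"
  using assms by (auto simp: mlin_def)

lemma mlinD:
  assumes "mlin s t V n f" "set xs \<subseteq> V" "set ys \<subseteq> V" "length xs + Suc (length ys) = n"
  shows "linear_on s t V (\<lambda>x. f (xs @ x # ys))"
  using assms by (auto simp: mlin_def)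

lemma multilinear_on_iff_mlin: "multilinear_on s t V f \<longleftrightarrow> (\<forall>n. mlin s t V n f)"
  by (auto simp: multilinear_on_def mlin_def)

lemma linear_on_cong:
  assumes "\<And>x. x \<in> V \<Longrightarrow> f x = g x" "module.subspace s V" "module s"
  shows "linear_on s t V f = linear_on s t V g"
  using assms module.subspace_add[OF assms(3,2)] module.subspace_scale[OF assms(3,2)]
  by (auto simp: linear_on_def)

lemma mlin_cong:
  assumes "module.subspace s V" "module s"
    and "\<And>xs. set xs \<subseteq> V \<Longrightarrow> length xs = n \<Longrightarrow> f xs = g xs"
  shows "mlin s t V n f = mlin s t V n g"
proof -
  have "linear_on s t V (\<lambda>x. f (xs @ x # ys)) = linear_on s t V (\<lambda>x. g (xs @ x # ys))"
    if "set xs \<subseteq> V" "set ys \<subseteq> V" "length xs + Suc (length ys) = n" for xs ys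
    using that by (intro linear_on_cong assms) auto
  then show ?thesis by (auto simp: mlin_def)
qed

lemma mlin_compose:
  assumes "mlin s t V n f" "linear_on t u W g" "\<And>xs. set xs \<subseteq> V \<Longrightarrow> length xs = n \<Longrightarrow> f xs \<in> W"
  shows "mlin s u V n (\<lambda>xs. g (f xs))"
  by (rule mlinI, rule linear_on_compose[OF mlinD[OF assms(1)] assms(2)]) (auto intro!: assms(3))

lemma mlin_sum:
  assumes "\<And>i. i \<in> S \<Longrightarrow> mlin s t V n (f i)" "vector_space t"
  shows "mlin s t V n (\<lambda>xs. \<Sum>i\<in>S. f i xs)"
proof -
  interpret vector_space t by fact
  show ?thesis
    using assms(1) by (fastforce simp: mlin_def linear_on_def sum.distrib scale_sum_right intro!: sum.cong)
qed

lemma mlin_fscale: "mlin s fscale V n f \<Longrightarrow> mlin s fscale V n (\<lambda>xs. fscale a (f xs))"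
  by (auto simp: mlin_def linear_on_def fscale_def fun_eq_iff algebra_simps)

lemma mlin_ksgn:
  assumes "mlin s t V n f" "vector_space t"
  shows "mlin s t V n (\<lambda>xs. ksgn e (f xs))"
proof -
  interpret vector_space t by fact
  show ?thesis using assms(1) by (auto simp: mlin_def linear_on_def ksgn_add scale_ksgn)
qed

lemma mlin_diff:
  assumes "mlin s t V n f" "mlin s t V n g" "vector_space t"
  shows "mlin s t V n (\<lambda>xs. f xs - g xs)"
proof -
  interpret vector_space t by fact
  show ?thesis
    using assms(1,2) by (auto simp: mlin_def linear_on_def scale_right_diff_distrib)
qed

text \<open>The entry that varies lies in one of the two segments, and the other segment is then
  constant.\<close>

lemma mlin_split:
  assumes "p \<le> n"
    and "\<And>ys. set ys \<subseteq> V \<Longrightarrow> length ys = n - p \<Longrightarrow> mlin s t V p (\<lambda>xs. f xs ys)"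
    and "\<And>xs. set xs \<subseteq> V \<Longrightarrow> length xs = p \<Longrightarrow> mlin s t V (n - p) (f xs)"
  shows "mlin s t V n (\<lambda>xs. f (take p xs) (drop p xs))"
proof (rule mlinI)
  fix us vs assume A: "set us \<subseteq> V" "set vs \<subseteq> V" "length us + Suc (length vs) = n"
  show "linear_on s t V (\<lambda>x. f (take p (us @ x # vs)) (drop p (us @ x # vs)))"
  proof (cases "length us < p")
    case True
    then obtain i where i: "p - length us = Suc i" by (cases "p - length us") auto
    have "set (take i vs) \<subseteq> V" "set (drop i vs) \<subseteq> V"
      using A(2) set_take_subset set_drop_subset by fast+
    with True A i assms(1) have "linear_on s t V (\<lambda>x. f (us @ x # take i vs) (drop i vs))"
      by (intro mlinD[OF assms(2)]) (auto simp: min_def)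
    with True i show ?thesis by simp
  next
    case False
    have "set (take p us) \<subseteq> V" "set (drop p us) \<subseteq> V"
      using A(1) set_take_subset set_drop_subset by fast+
    with False A have "linear_on s t V (\<lambda>x. f (take p us) (drop p us @ x # vs))"
      by (intro mlinD[OF assms(3)]) auto
    with False show ?thesis by simp
  qed
qed

lemma mlin_map:
  assumes "mlin t u W n f" "linear_on s t V g" "\<And>x. x \<in> V \<Longrightarrow> g x \<in> W"
  shows "mlin s u V n (\<lambda>xs. f (map g xs))"
proof (rule mlinI)
  fix us vs assume A: "set us \<subseteq> V" "set vs \<subseteq> V" "length us + Suc (length vs) = n"
  show "linear_on s u V (\<lambda>x. f (map g (us @ x # vs)))"
    unfolding map_append list.map
    by (rule linear_on_compose[OF assms(2) mlinD[OF assms(1)]]) (use A assms(3) in auto)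
qed

lemma mlin_context:
  assumes "mlin s t V (length us + n + length vs) f" "set us \<subseteq> V" "set vs \<subseteq> V"
  shows "mlin s t V n (\<lambda>xs. f (us @ xs @ vs))"
proof (rule mlinI)
  fix xs ys assume "set xs \<subseteq> V" "set ys \<subseteq> V" "length xs + Suc (length ys) = n"
  then show "linear_on s t V (\<lambda>x. f (us @ (xs @ x # ys) @ vs))"
    using mlinD[OF assms(1), of "us @ xs" "ys @ vs"] assms(2,3) by simp
qed

lemma mlin_zero_entry:
  assumes "mlin s t V n f" "vector_space s" "vector_space t" "module.subspace s V"
    and "set xs \<subseteq> V" "length xs = n" "0 \<in> set xs"
  shows "f xs = 0"
proof -
  interpret s: vector_space s by fact
  from assms(7) obtain us vs where xs: "xs = us @ 0 # vs" by (meson split_list)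
  interpret linear_on_sp s t V "\<lambda>x. f (us @ x # vs)"
    by (rule linear_on_sp.intro[OF assms(2-4) mlinD[OF assms(1)]]) (use assms xs in auto)
  show ?thesis using zero xs by simp
qed

section \<open>Graded vector spaces\<close>

locale graded =
  fixes s :: "'k::field_char_0 \<Rightarrow> 'v::ab_group_add \<Rightarrow> 'v" and V :: "'v set" and G :: "int \<Rightarrow> 'v set"
  assumes graded: "graded_space s V G"
begin

sublocale vector_space s
  using graded by (simp add: graded_space_def)

lemma subV: "subspace V" and subG: "subspace (G i)" and GV: "G i \<subseteq> V"
  using graded by (auto simp: graded_space_def)

lemma ex1_decomposition: "x \<in> V \<Longrightarrow> \<exists>!f. is_decomposition G x f"
  using graded by (auto simp: graded_space_def)

lemma hom_part_decomposition: "x \<in> V \<Longrightarrow> is_decomposition G x (hom_part G x)"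
  unfolding hom_part_def using theI'[OF ex1_decomposition] .

lemma hom_part_eqI: "x \<in> V \<Longrightarrow> is_decomposition G x f \<Longrightarrow> hom_part G x = f"
  using ex1_decomposition hom_part_decomposition by blast

lemma hom_part_in: "x \<in> V \<Longrightarrow> hom_part G x i \<in> G i"
  and finite_hom_part: "x \<in> V \<Longrightarrow> finite {i. hom_part G x i \<noteq> 0}"
  and sum_hom_part: "x \<in> V \<Longrightarrow> (\<Sum>i | hom_part G x i \<noteq> 0. hom_part G x i) = x"
  using hom_part_decomposition by (auto simp: is_decomposition_def)

lemma is_decompositionI:
  assumes "finite S" "\<And>i. f i \<in> G i" "\<And>i. i \<notin> S \<Longrightarrow> f i = 0" "sum f S = x"
  shows "is_decomposition G x f"
proof -
  have *: "{i. f i \<noteq> 0} \<subseteq> S" using assms(3) by auto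
  with assms show ?thesis
    unfolding is_decomposition_def
    by (auto intro: finite_subset simp flip: assms(4) intro!: sum.mono_neutral_left)
qed

lemma sum_hom_part_superset:
  assumes "x \<in> V" "finite S" "{i. hom_part G x i \<noteq> 0} \<subseteq> S"
  shows "sum (hom_part G x) S = x"
  using sum.mono_neutral_left[OF assms(2,3), of "hom_part G x"] sum_hom_part[OF assms(1)] by auto

lemma hom_part_add: "x \<in> V \<Longrightarrow> y \<in> V \<Longrightarrow> hom_part G (x + y) i = hom_part G x i + hom_part G y i"
proof -
  assume A: "x \<in> V" "y \<in> V"
  let ?S = "{i. hom_part G x i \<noteq> 0} \<union> {i. hom_part G y i \<noteq> 0}"
  have "is_decomposition G (x + y) (\<lambda>i. hom_part G x i + hom_part G y i)"
    by (rule is_decompositionI[of ?S])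
      (auto simp: finite_hom_part A sum.distrib sum_hom_part_superset subspace_add[OF subG] hom_part_in)
  then show ?thesis using hom_part_eqI A subspace_add[OF subV] by metis
qed

lemma hom_part_scale: "x \<in> V \<Longrightarrow> hom_part G (s c x) i = s c (hom_part G x i)"
proof -
  assume A: "x \<in> V"
  have "is_decomposition G (s c x) (\<lambda>i. s c (hom_part G x i))"
    by (rule is_decompositionI[of "{i. hom_part G x i \<noteq> 0}"])
      (auto simp: finite_hom_part A sum_hom_part subspace_scale[OF subG] hom_part_in
         simp flip: scale_sum_right)
  then show ?thesis using hom_part_eqI A subspace_scale[OF subV] by metis
qed

lemma hom_part_homogeneous: "x \<in> G d \<Longrightarrow> hom_part G x i = (if i = d then x else 0)"
proof -
  assume A: "x \<in> G d"
  have "is_decomposition G x (\<lambda>i. if i = d then x else 0)"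
    by (rule is_decompositionI[of "{d}"]) (auto simp: A subspace_0[OF subG])
  then have "hom_part G x = (\<lambda>i. if i = d then x else 0)" using hom_part_eqI A GV by blast
  then show ?thesis by simp
qed

text \<open>Used with the Koszul signs \<open>w i = (-1)\<^bsup>e i\<^esup>\<close> and with \<open>w i = 2\<^sup>i\<close>.\<close>

definition weight :: "(int \<Rightarrow> 'k) \<Rightarrow> 'v \<Rightarrow> 'v" where
  "weight w x = (\<Sum>i | hom_part G x i \<noteq> 0. s (w i) (hom_part G x i))"

lemma weight_superset:
  assumes "finite S" "{i. hom_part G x i \<noteq> 0} \<subseteq> S"
  shows "weight w x = (\<Sum>i\<in>S. s (w i) (hom_part G x i))"
  unfolding weight_def by (rule sum.mono_neutral_left) (use assms in auto)

lemma weight_linear: "linear_on s s V (weight w)"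
proof (rule linear_onI)
  fix x y assume A: "x \<in> V" "y \<in> V"
  let ?S = "{i. hom_part G x i \<noteq> 0} \<union> {i. hom_part G y i \<noteq> 0}"
  have f: "finite ?S" by (simp add: finite_hom_part A)
  have "weight w (x + y) = (\<Sum>i\<in>?S. s (w i) (hom_part G (x + y) i))"
    by (rule weight_superset[OF f]) (auto simp: hom_part_add A)
  also have "\<dots> = weight w x + weight w y"
    using A by (simp add: weight_superset[OF f] hom_part_add scale_right_distrib sum.distrib)
  finally show "weight w (x + y) = weight w x + weight w y" .
next
  fix c x assume A: "x \<in> V"
  have "weight w (s c x) = (\<Sum>i | hom_part G x i \<noteq> 0. s (w i) (hom_part G (s c x) i))"
    by (rule weight_superset) (auto simp: hom_part_scale finite_hom_part A)
  also have "\<dots> = s c (weight w x)"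
    by (simp add: weight_def hom_part_scale A scale_sum_right mult.commute)
  finally show "weight w (s c x) = s c (weight w x)" .
qed

lemma weight_homogeneous: "x \<in> G d \<Longrightarrow> weight w x = s (w d) x"
  by (subst weight_superset[of "{d}"]) (auto simp: hom_part_homogeneous)

lemma weight_in: "x \<in> V \<Longrightarrow> weight w x \<in> V"
  unfolding weight_def
  by (intro subspace_sum[OF subV] subspace_scale[OF subV]) (use hom_part_in GV in auto)

lemma koszul_weight: "koszul G e = weight (\<lambda>i. of_int (sg (e * i)))"
  by (simp add: koszul_def weight_def fun_eq_iff ksgn_scale)

lemma koszul_linear: "linear_on s s V (koszul G e)"
  and koszul_in: "x \<in> V \<Longrightarrow> koszul G e x \<in> V"
  and koszul_homogeneous: "x \<in> G d \<Longrightarrow> koszul G e x = ksgn (e * d) x"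
  unfolding koszul_weight by (simp_all add: weight_linear weight_in weight_homogeneous ksgn_scale)

sublocale koszul: linear_on_sp s s V "koszul G e"
  by unfold_locales (rule subV koszul_linear)+

lemma graded_induct [consumes 1, case_names homogeneous add]:
  assumes "x \<in> V" and "\<And>x d. x \<in> G d \<Longrightarrow> P x"
    and "\<And>x y. x \<in> V \<Longrightarrow> y \<in> V \<Longrightarrow> P x \<Longrightarrow> P y \<Longrightarrow> P (x + y)"
  shows "P x"
proof -
  have "(\<Sum>i\<in>S. hom_part G x i) \<in> V \<and> P (\<Sum>i\<in>S. hom_part G x i)" if "finite S" for S
    using that
  proof (induction S)
    case empty
    then show ?case using assms(2)[OF subspace_0[OF subG]] subspace_0[OF subV] by simp
  next
    case (insert i S)
    have "hom_part G x i \<in> V" "P (hom_part G x i)"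
      using hom_part_in[OF assms(1)] assms(2) GV by blast+
    with insert show ?case by (auto intro: assms(3) subspace_add[OF subV])
  qed
  from this[OF finite_hom_part[OF assms(1)]] show ?thesis using sum_hom_part[OF assms(1)] by simp
qed

lemma koszul_koszul: "x \<in> V \<Longrightarrow> koszul G a (koszul G b x) = koszul G (a + b) x"
proof (induction rule: graded_induct)
  case (homogeneous x d)
  moreover have "x \<in> V" using homogeneous GV by blast
  ultimately show ?case by (simp add: koszul_homogeneous koszul.ksgn ksgn_ksgn algebra_simps)
qed (simp add: koszul.add koszul_in)

lemma koszul_0: "x \<in> V \<Longrightarrow> koszul G 0 x = x"
  by (induction rule: graded_induct) (auto simp: koszul_homogeneous koszul.add)

lemma map_koszul_koszul:
  "set xs \<subseteq> V \<Longrightarrow> map (koszul G a) (map (koszul G b) xs) = map (koszul G (a + b)) xs"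
  by (auto simp: koszul_koszul)

lemma set_map_koszul: "set xs \<subseteq> V \<Longrightarrow> set (map (koszul G a) xs) \<subseteq> V"
  by (auto simp: koszul_in)

text \<open>A relation and not a degree function, because the zero vector lies in every component
  and so the total degree k is not determined by the list.\<close>

definition homogeneous :: "'v list \<Rightarrow> int \<Rightarrow> bool" where
  "homogeneous xs k \<longleftrightarrow> (\<exists>ds. list_all2 (\<lambda>x d. x \<in> G d) xs ds \<and> sum_list ds = k)"

lemma homogeneous_Nil [simp]: "homogeneous [] k \<longleftrightarrow> k = 0"
  by (auto simp: homogeneous_def)

lemma homogeneous_Cons: "homogeneous (x # xs) k \<longleftrightarrow> (\<exists>d. x \<in> G d \<and> homogeneous xs (k - d))"
  by (force simp: homogeneous_def list_all2_Cons1)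

lemma homogeneous_append: "homogeneous (xs @ ys) k \<longleftrightarrow> (\<exists>d. homogeneous xs d \<and> homogeneous ys (k - d))"
proof (induction xs arbitrary: k)
  case (Cons x xs)
  show ?case
  proof
    assume "homogeneous ((x # xs) @ ys) k"
    then obtain d d' where "x \<in> G d" "homogeneous xs d'" "homogeneous ys (k - d - d')"
      by (auto simp: homogeneous_Cons Cons)
    then show "\<exists>d. homogeneous (x # xs) d \<and> homogeneous ys (k - d)"
      by (intro exI[of _ "d + d'"]) (auto simp: homogeneous_Cons algebra_simps intro!: exI[of _ d])
  next
    assume "\<exists>d. homogeneous (x # xs) d \<and> homogeneous ys (k - d)"
    then obtain d e where "x \<in> G e" "homogeneous xs (d - e)" "homogeneous ys (k - d)"
      by (auto simp: homogeneous_Cons)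
    moreover from this have "homogeneous (xs @ ys) (k - e)"
      unfolding Cons by (intro exI[of _ "d - e"]) simp
    ultimately show "homogeneous ((x # xs) @ ys) k" by (auto simp: homogeneous_Cons)
  qed
qed simp

lemma homogeneous_subset: "homogeneous xs k \<Longrightarrow> set xs \<subseteq> V"
  by (induction xs arbitrary: k) (use GV in \<open>auto simp: homogeneous_Cons\<close>)

lemma homogeneous_koszul: "homogeneous xs k \<Longrightarrow> homogeneous (map (koszul G e) xs) k"
proof (induction xs arbitrary: k)
  case (Cons x xs)
  then show ?case
    by (fastforce simp: homogeneous_Cons koszul_homogeneous intro: subspace_ksgn[OF subG])
qed simp

text \<open>Entries are decomposed one by one from the right. The induction is over the prefix
  \<open>us\<close> of arbitrary vectors, for all suffixes \<open>hs\<close> that are already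
  homogeneous.\<close>

lemma mlin_homogeneous_in:
  assumes "mlin s t V n f" "vector_space t" "module.subspace t S"
    and "\<And>xs k. length xs = n \<Longrightarrow> homogeneous xs k \<Longrightarrow> f xs \<in> S"
    and "set xs \<subseteq> V" "length xs = n"
  shows "f xs \<in> S"
proof -
  interpret t: vector_space t by fact
  have "f (us @ hs) \<in> S" if "set us \<subseteq> V" "homogeneous hs k" "length us + length hs = n" for us hs k
    using that
  proof (induction us arbitrary: hs k rule: rev_induct)
    case (snoc x us)
    have hs: "set hs \<subseteq> V" using snoc.prems homogeneous_subset by blast
    interpret L: linear_on_sp s t V "\<lambda>x. f (us @ x # hs)"
      by (rule linear_on_sp.intro[OF vector_space_axioms assms(2) subV mlinD[OF assms(1)]])
        (use snoc.prems hs in auto)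
    have "x \<in> V" using snoc.prems by simp
    then have "f (us @ x # hs) \<in> S"
    proof (induction rule: graded_induct)
      case (homogeneous x d)
      show ?case by (rule snoc.IH[of _ "k + d"]) (use snoc.prems homogeneous in \<open>auto simp: homogeneous_Cons intro!: exI[of _ d]\<close>)
    next
      case (add x y)
      then show ?case by (simp add: L.add t.subspace_add[OF assms(3)])
    qed
    then show ?case by simp
  qed (use assms(4) in auto)
  from this[of xs "[]" 0] show ?thesis using assms by simp
qed

lemma mlin_homogeneous_eq:
  assumes "mlin s t V n f" "mlin s t V n g" "vector_space t"
    and "\<And>xs k. length xs = n \<Longrightarrow> homogeneous xs k \<Longrightarrow> f xs = g xs"
    and "set xs \<subseteq> V" "length xs = n"
  shows "f xs = g xs"
proof -
  interpret t: vector_space t by fact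
  have "f xs - g xs \<in> {0}"
    by (rule mlin_homogeneous_in[OF mlin_diff[OF assms(1-3)] assms(3)]) (use assms in auto)
  then show ?thesis by simp
qed

text \<open>The hypotheses make w a character of the group of degrees, so the eigenvalues of the
  single entries multiply to \<open>w k\<close>. The prefix \<open>us\<close> collects entries
  already treated in the induction; the applications take it empty.\<close>

lemma mlin_weight_homogeneous:
  assumes w: "w 0 = 1" "\<And>a b. w (a + b) = w a * w b"
    and "mlin s t V (length us + length xs) f" "vector_space t" "homogeneous xs k" "set us \<subseteq> V"
  shows "f (us @ map (weight w) xs) = t (w k) (f (us @ xs))"
  using assms(3-)
proof (induction xs arbitrary: us k)
  case (Cons x xs)
  from Cons.prems obtain d where d: "x \<in> G d" "homogeneous xs (k - d)"
    by (auto simp: homogeneous_Cons)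
  have xs: "set xs \<subseteq> V" "x \<in> V" using d homogeneous_subset GV by blast+
  interpret L: linear_on_sp s t V "\<lambda>y. f (us @ y # xs)"
    by (rule linear_on_sp.intro[OF vector_space_axioms Cons.prems(2) subV mlinD[OF Cons.prems(1)]])
      (use Cons.prems xs in auto)
  interpret t: vector_space t by fact
  have "f (us @ map (weight w) (x # xs)) = f ((us @ [weight w x]) @ map (weight w) xs)" by simp
  also have "\<dots> = t (w (k - d)) (f (us @ weight w x # xs))"
    by (subst Cons.IH[of _ "k - d"]) (use Cons.prems d weight_in xs in auto)
  also have "\<dots> = t (w k) (f (us @ x # xs))"
    unfolding weight_homogeneous[OF d(1)] L.scale[OF xs(2)] using w(2)[of "k - d" d] by simp
  finally show ?case .
next
  case Nil
  interpret t: vector_space t by fact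
  from Nil show ?case by (simp add: w)
qed

lemma mlin_koszul_homogeneous:
  assumes "mlin s t V (length xs) f" "vector_space t" "homogeneous xs k"
  shows "f (map (koszul G e) xs) = ksgn (e * k) (f xs)"
  using mlin_weight_homogeneous[of "\<lambda>i. of_int (sg (e * i))" t "[]"] assms
  by (simp add: koszul_weight vector_space.ksgn_scale[of t] sg_add distrib_left)

text \<open>A map of degree e turns degree d into d + e, which changes the exponent a d by a e. For
  a = e odd this is the minus sign behind the cancellation in the square of a coderivation.\<close>

lemma graded_map_koszul:
  assumes "graded t W G'" "linear_on s t V f" "\<And>k x. x \<in> G k \<Longrightarrow> f x \<in> G' (k + e)" "x \<in> V"
  shows "f (koszul G a x) = ksgn (a * e) (koszul G' a (f x))"
proof -
  interpret T: graded t W G' by fact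
  interpret L: linear_on_sp s t V f using assms(2) by unfold_locales (rule subV)
  have W: "f x \<in> W" if "x \<in> V" for x
    using that by (induction rule: graded_induct) (use assms(3) T.GV L.add T.subspace_add[OF T.subV] in auto)
  show ?thesis using assms(4)
  proof (induction rule: graded_induct)
    case (homogeneous x d)
    moreover have "x \<in> V" using homogeneous GV by blast
    ultimately have "f (koszul G a x) = ksgn (a * d) (f x)" by (simp add: koszul_homogeneous L.ksgn)
    moreover have "koszul G' a (f x) = ksgn (a * (d + e)) (f x)"
      using assms(3)[OF homogeneous] by (rule T.koszul_homogeneous)
    ultimately show ?case by (auto simp: ksgn_ksgn intro!: ksgn_cong simp: algebra_simps)
  next
    case (add x y)
    then show ?case by (simp add: koszul.add L.add W T.koszul.add koszul_in ksgn_add)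
  qed
qed

end

section \<open>The cofree coalgebra\<close>

interpretation fs: vector_space "fscale :: 'k::field \<Rightarrow> ('x \<Rightarrow> 'k) \<Rightarrow> 'x \<Rightarrow> 'k"
  by (rule vector_space_fscale)

lemma fs_span_linear_in:
  assumes "linear_on fscale t (fs.span B) f" "vector_space t" "module.subspace t S"
    and "\<And>b. b \<in> B \<Longrightarrow> f b \<in> S" "x \<in> fs.span B"
  shows "f x \<in> S"
proof -
  interpret L: linear_on_sp fscale t "fs.span B" f
    by (intro linear_on_sp.intro assms vector_space_fscale fs.subspace_span)
  have "x \<in> fs.span B \<and> f x \<in> S"
    using assms(5)
  proof (induction rule: fs.span_induct_alt)
    case base
    then show ?case using L.zero L.t.subspace_0[OF assms(3)] fs.span_zero by metis
  next
    case (step c x y)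
    then have "fscale c x \<in> fs.span B" using fs.span_base fs.span_scale by blast
    with step show ?case
      using L.add[of "fscale c x" y] L.scale[of x c] assms(4) fs.span_base[of x B]
        L.t.subspace_add[OF assms(3)] L.t.subspace_scale[OF assms(3)] fs.span_add
      by metis
  qed
  then show ?thesis by simp
qed

lemma linear_on_diff:
  assumes "linear_on s t V f" "linear_on s t V g" "vector_space t"
  shows "linear_on s t V (\<lambda>x. f x - g x)"
proof -
  interpret vector_space t by fact
  show ?thesis using assms(1,2) by (auto simp: linear_on_def scale_right_diff_distrib)
qed

lemma linear_on_id: "linear_on s s V (\<lambda>x. x)"
  by (simp add: linear_on_def)

lemma fs_span_linear_eq:
  assumes "linear_on fscale t (fs.span B) f" "linear_on fscale t (fs.span B) g" "vector_space t"
    and "\<And>b. b \<in> B \<Longrightarrow> f b = g b" "x \<in> fs.span B"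
  shows "f x = g x"
proof -
  interpret vector_space t by fact
  have "f x - g x \<in> {0}"
    by (rule fs_span_linear_in[OF linear_on_diff[OF assms(1-3)] assms(3)]) (use assms in auto)
  then show ?thesis by simp
qed

lemma linear_on_cof_lift: "linear_on fscale fscale S (cof_lift M)"
  by (simp add: linear_on_def cof_lift_linear)

lemma linear_on_scale_fs: "linear_on fscale fscale S (fscale a)"
  by (simp add: linear_on_def fs.scale_right_distrib mult.commute)

lemma is_decomposition_sum:
  assumes "is_decomposition G x f" "finite S" "{i. f i \<noteq> 0} \<subseteq> S"
  shows "sum f S = x"
proof -
  have "(\<Sum>i | f i \<noteq> 0. f i) = sum f S"
    by (rule sum.mono_neutral_left[OF assms(2,3)]) auto
  then show ?thesis using assms(1) unfolding is_decomposition_def by metis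
qed

abbreviation wsum :: "(agd \<times> nat) list \<Rightarrow> nat" where "wsum w \<equiv> sum_list (map snd w)"
abbreviation wdeg :: "(agd \<times> nat) list \<Rightarrow> int" where "wdeg w \<equiv> (\<Sum>(c, i)\<leftarrow>w. cdeg c i)"
abbreviation pos :: "(agd \<times> nat) list \<Rightarrow> bool" where "pos w \<equiv> (\<forall>(c, i)\<in>set w. i \<ge> 1)"

section \<open>The grading of the cofree coalgebra\<close>

context graded
begin

abbreviation C :: "('k, 'v) cof set" where "C \<equiv> cof_space s V"
abbreviation GC :: "int \<Rightarrow> ('k, 'v) cof set" where "GC \<equiv> cof_grading s V G"
abbreviation P :: "agd \<Rightarrow> 'v list \<Rightarrow> ('k, 'v) cof" where "P \<equiv> pure s V"

lemma pure_mlin: "mlin s fscale V n (P c)"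
  unfolding mlin_def linear_on_def pure_def forms_def multilinear_on_def
  by (auto simp: fun_eq_iff fscale_def)

lemma pure_koszul_mlin: "mlin s fscale V n (\<lambda>xs. P c (map (koszul G e) xs))"
  by (rule mlin_map[OF pure_mlin koszul_linear]) (rule koszul_in)

lemma pure_in: "xs \<noteq> [] \<Longrightarrow> set xs \<subseteq> V \<Longrightarrow> P c xs \<in> C"
  unfolding cof_space_def by (rule fs.span_base) auto

lemma subC: "fs.subspace C"
  unfolding cof_space_def by (rule fs.subspace_span)

lemma cof_grading_eq:
  "GC k = fs.span {P c xs | c xs. xs \<noteq> [] \<and> homogeneous xs (k - cdeg c (length xs))}"
  unfolding cof_grading_def homogeneous_def
  by (rule arg_cong[where f = fs.span]) (force simp: algebra_simps)

lemma pure_homogeneous: "xs \<noteq> [] \<Longrightarrow> homogeneous xs k \<Longrightarrow> P c xs \<in> GC (cdeg c (length xs) + k)"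
  unfolding cof_grading_eq
  by (intro fs.span_base CollectI exI[of _ c] exI[of _ xs]) simp

lemma subGC: "fs.subspace (GC k)"
  unfolding cof_grading_def by (rule fs.subspace_span)

lemma cof_linear_in:
  assumes "linear_on fscale t C f" "vector_space t" "module.subspace t S"
    and "\<And>c xs. xs \<noteq> [] \<Longrightarrow> set xs \<subseteq> V \<Longrightarrow> f (P c xs) \<in> S" "x \<in> C"
  shows "f x \<in> S"
  using assms(5) unfolding cof_space_def
  by (rule fs_span_linear_in[OF assms(1)[unfolded cof_space_def] assms(2,3), rotated]) (use assms(4) in auto)

lemma cof_linear_eq:
  assumes "linear_on fscale t C f" "linear_on fscale t C g" "vector_space t"
    and "\<And>c xs. xs \<noteq> [] \<Longrightarrow> set xs \<subseteq> V \<Longrightarrow> f (P c xs) = g (P c xs)" "x \<in> C"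
  shows "f x = g x"
  using assms(5) unfolding cof_space_def
  by (rule fs_span_linear_eq[OF assms(1,2)[unfolded cof_space_def] assms(3), rotated]) (use assms(4) in auto)

lemma GC_subset: "GC k \<subseteq> C"
  unfolding cof_grading_eq cof_space_def by (rule fs.span_mono) (use homogeneous_subset in blast)

lemma cof_homogeneous_in:
  assumes "linear_on fscale t C f" "vector_space t" "module.subspace t S"
    and "\<And>c xs. xs \<noteq> [] \<Longrightarrow> homogeneous xs (k - cdeg c (length xs)) \<Longrightarrow> f (P c xs) \<in> S" "x \<in> GC k"
  shows "f x \<in> S"
  using assms(5) unfolding cof_grading_eq
  by (rule fs_span_linear_in[OF linear_on_subset[OF assms(1) GC_subset, unfolded cof_grading_eq] assms(2,3), rotated])
    (use assms(4) in auto)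

lemma cof_lift_pure': 
  assumes "\<And>c n. mlin s fscale V n (M c)"
  shows "cof_lift M (P c xs) = M c xs"
proof (rule cof_lift_pure)
  fix \<psi>
  show "(\<lambda>c xs. M c xs \<psi>) \<in> forms s V"
    using assms unfolding forms_def multilinear_on_iff_mlin mlin_def linear_on_def
    by (auto simp: fun_eq_iff fscale_def)
qed

text \<open>The eigenvalues \<open>2\<^sup>k\<close> of this operator on the homogeneous components are distinct in
  characteristic zero, so the sum of the components is direct.\<close>

definition scaling :: "('k, 'v) cof \<Rightarrow> ('k, 'v) cof" where
  "scaling = cof_lift (\<lambda>c xs. fscale (2 powi cdeg c (length xs)) (P c (map (weight (\<lambda>i. 2 powi i)) xs)))"

lemma scaling_homogeneous: "x \<in> GC k \<Longrightarrow> scaling x = fscale (2 powi k) x"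
proof -
  have lin: "linear_on fscale fscale C (\<lambda>x. scaling x - fscale (2 powi k) x)"
    unfolding scaling_def
    by (rule linear_on_diff[OF linear_on_cof_lift linear_on_scale_fs vector_space_fscale])
  have m: "mlin s fscale V n (\<lambda>xs. fscale (2 powi cdeg c (length xs)) (P c (map (weight (\<lambda>i. 2 powi i)) xs)))" for c n
  proof (rule iffD1[OF mlin_cong[OF subV module_axioms]])
    show "mlin s fscale V n (\<lambda>xs. fscale (2 powi cdeg c n) (P c (map (weight (\<lambda>i. 2 powi i)) xs)))"
      by (intro mlin_fscale mlin_map[OF pure_mlin weight_linear] weight_in)
  qed simp
  have "scaling (P c xs) - fscale (2 powi k) (P c xs) \<in> {0}"
    if "xs \<noteq> []" "homogeneous xs (k - cdeg c (length xs))" for c xs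
  proof -
    have "P c (map (weight (\<lambda>i. 2 powi i)) xs) = fscale (2 powi (k - cdeg c (length xs))) (P c xs)"
      using mlin_weight_homogeneous[of "\<lambda>i. 2 powi i" fscale "[]" xs "P c"] that(2)
      by (simp add: pure_mlin power_int_add vector_space_fscale)
    moreover have "(2::'k) powi cdeg c (length xs) * 2 powi (k - cdeg c (length xs)) = 2 powi k"
      by (simp flip: power_int_add)
    ultimately show ?thesis
      unfolding scaling_def by (subst cof_lift_pure'[OF m]) simp
  qed
  moreover assume "x \<in> GC k"
  ultimately have "scaling x - fscale (2 powi k) x \<in> {0}"
    using cof_homogeneous_in[OF lin vector_space_fscale, of "{0}" k] fs.subspace_single_0 by blast
  then show ?thesis by simp
qed

lemma power_int_2_inject: "(2 :: 'k) powi a = 2 powi b \<Longrightarrow> a = b"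
proof (induction a b rule: linorder_wlog)
  case (le a b)
  then have "(2 :: 'k) powi (b - a) = 1" by (simp add: power_int_diff)
  then have "(2 :: 'k) ^ nat (b - a) = 1" using le by (simp add: power_int_def)
  then have "(of_nat (2 ^ nat (b - a)) :: 'k) = of_nat 1" by simp
  then have "(2::nat) ^ nat (b - a) = 1" unfolding of_nat_eq_iff .
  then show ?case using le by simp
next
  case (sym a b)
  then show ?case by (metis sym)
qed

text \<open>Independence of eigenvectors: applying \<open>scaling\<close> and subtracting 2^l times
  the relation removes the term of index l and multiplies the others by 2^k - 2^l, which is nonzero;
  the induction hypothesis covers the rest.\<close>

lemma cof_grading_independent:
  assumes "finite S" "\<And>k. k \<in> S \<Longrightarrow> f k \<in> GC k" "sum f S = 0" "k \<in> S"
  shows "f k = 0"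
  using assms
proof (induction S arbitrary: f k)
  case (insert l S)
  interpret T: linear_on_sp fscale fscale UNIV scaling
    by (intro linear_on_sp.intro vector_space_fscale fs.subspace_UNIV)
      (simp add: scaling_def linear_on_cof_lift)
  have z: "fscale (2 powi k - 2 powi l) (f k) = 0" if "k \<in> S" for k
  proof (rule insert.IH[OF _ _ that])
    show "fscale (2 powi k - 2 powi l) (f k) \<in> GC k" if "k \<in> S" for k
      using insert.prems(1) that fs.subspace_scale[OF subGC] by blast
    have "(\<Sum>k\<in>insert l S. fscale (2 powi k) (f k)) = scaling (sum f (insert l S))"
      by (subst T.sum, simp, rule sum.cong[OF refl], rule scaling_homogeneous[symmetric],
          rule insert.prems(1))
    then have "(\<Sum>k\<in>insert l S. fscale (2 powi k) (f k)) = 0" using insert.prems(2) T.zero by metis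
    moreover have "(\<Sum>k\<in>insert l S. fscale (2 powi l) (f k)) = 0"
      unfolding fs.scale_sum_right[symmetric] insert.prems(2) by (rule fs.scale_zero_right)
    ultimately have "(\<Sum>k\<in>insert l S. fscale (2 powi k - 2 powi l) (f k)) = 0"
      by (simp add: fs.scale_left_diff_distrib sum_subtractf)
    then show "(\<Sum>k\<in>S. fscale (2 powi k - 2 powi l) (f k)) = 0" using insert.hyps by simp
  qed
  have "f k = 0" if "k \<in> S" for k
  proof -
    have "(2 :: 'k) powi k - 2 powi l \<noteq> 0"
      using power_int_2_inject[of k l] insert.hyps(2) that by force
    then show ?thesis using z[OF that] by (simp only: fs.scale_eq_0_iff) blast
  qed
  then show ?case using insert.prems insert.hyps by auto
qed simp

text \<open>The elements having a decomposition form a subspace, so pure tensors with homogeneous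
  entries suffice for existence. Uniqueness is independence applied to the difference of two
  decompositions. All facts about \<open>graded\<close> then hold for C(V) too.\<close>

lemma graded_cof: "graded fscale C GC"
proof
  have ex: "\<exists>f. is_decomposition GC x f" if "x \<in> C" for x
  proof -
    have sub: "fs.subspace {x. \<exists>f. is_decomposition GC x f}"
    proof (rule fs.subspaceI)
      show "0 \<in> {x. \<exists>f. is_decomposition GC x f}"
        by (auto simp: is_decomposition_def fs.subspace_0[OF subGC] intro!: exI[of _ "\<lambda>_. 0"])
    next
      fix x y assume "x \<in> {x. \<exists>f. is_decomposition GC x f}" "y \<in> {x. \<exists>f. is_decomposition GC x f}"
      then obtain f g where fg: "is_decomposition GC x f" "is_decomposition GC y g" by auto
      let ?S = "{i. f i \<noteq> 0} \<union> {i. g i \<noteq> 0}"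
      have fin: "finite ?S" using fg by (simp add: is_decomposition_def)
      have "sum f ?S = x" "sum g ?S = y"
        using fg fin by (auto intro: is_decomposition_sum)
      then have "sum (\<lambda>i. f i + g i) ?S = x + y" by (simp add: sum.distrib)
      moreover have "(\<Sum>i | f i + g i \<noteq> 0. f i + g i) = sum (\<lambda>i. f i + g i) ?S"
        by (rule sum.mono_neutral_left[OF fin]) auto
      moreover have "finite {i. f i + g i \<noteq> 0}" by (rule finite_subset[OF _ fin]) auto
      ultimately have "is_decomposition GC (x + y) (\<lambda>i. f i + g i)"
        using fg fs.subspace_add[OF subGC] by (auto simp: is_decomposition_def)
      then show "x + y \<in> {x. \<exists>f. is_decomposition GC x f}" by blast
    next
      fix a x assume "x \<in> {x. \<exists>f. is_decomposition GC x f}"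
      then obtain f where f: "is_decomposition GC x f" by auto
      then have "is_decomposition GC (fscale a x) (\<lambda>i. fscale a (f i))"
        by (cases "a = 0") (auto simp: is_decomposition_def fs.subspace_scale[OF subGC] fs.subspace_0[OF subGC] simp flip: fs.scale_sum_right)
      then show "fscale a x \<in> {x. \<exists>f. is_decomposition GC x f}" by blast
    qed
    have "x \<in> {x. \<exists>f. is_decomposition GC x f}"
    proof (rule cof_linear_in[OF linear_on_id vector_space_fscale sub _ that])
      fix c xs assume xs: "xs \<noteq> []" "set xs \<subseteq> V"
      show "P c xs \<in> {x. \<exists>f. is_decomposition GC x f}"
      proof (rule mlin_homogeneous_in[OF pure_mlin vector_space_fscale sub _ xs(2) refl])
        fix ys k assume ys: "length ys = length xs" "homogeneous ys k"
        let ?k = "cdeg c (length ys) + k"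
        have "P c ys \<in> GC ?k" using ys xs by (intro pure_homogeneous) auto
        then have "is_decomposition GC (P c ys) (\<lambda>i. if i = ?k then P c ys else 0)"
          by (auto simp: is_decomposition_def fs.subspace_0[OF subGC])
        then show "P c ys \<in> {x. \<exists>f. is_decomposition GC x f}" by blast
      qed
    qed
    then show ?thesis by simp
  qed
  have uniq: "f = g" if fg: "is_decomposition GC x f" "is_decomposition GC x g" for x f g
  proof -
    let ?S = "{i. f i \<noteq> 0} \<union> {i. g i \<noteq> 0}"
    have fin: "finite ?S" using fg by (simp add: is_decomposition_def)
    have "sum f ?S = x" "sum g ?S = x"
      using fg fin by (auto intro: is_decomposition_sum)
    then have "sum (\<lambda>i. f i - g i) ?S = 0" by (simp add: sum_subtractf)
    moreover have "f i - g i \<in> GC i" for i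
      using fg by (auto simp: is_decomposition_def fs.subspace_diff[OF subGC])
    ultimately have "f i - g i = 0" if "i \<in> ?S" for i
      using cof_grading_independent[OF fin, of "\<lambda>i. f i - g i"] that by blast
    then show "f = g" by (intro ext) (metis (mono_tags, lifting) UnI1 UnI2 eq_iff_diff_eq_0 mem_Collect_eq)
  qed
  show "graded_space fscale C GC"
    unfolding graded_space_def using vector_space_fscale subC subGC GC_subset ex uniq by blast
qed

text \<open>The degree of a pure tensor is that of its label plus those of its entries: the label
  gives a global sign, and the entries are signed one by one.\<close>

lemma koszul_pure:
  assumes "xs \<noteq> []" "set xs \<subseteq> V"
  shows "koszul GC e (P c xs) = ksgn (e * cdeg c (length xs)) (P c (map (koszul G e) xs))"
proof -
  interpret C: graded fscale C GC by (rule graded_cof)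
  show ?thesis
  proof (rule mlin_homogeneous_eq[where f = "\<lambda>ys. koszul GC e (P c ys)" and
        g = "\<lambda>ys. ksgn (e * cdeg c (length xs)) (P c (map (koszul G e) ys))",
        OF _ _ vector_space_fscale _ assms(2) refl])
    show "mlin s fscale V (length xs) (\<lambda>ys. koszul GC e (P c ys))"
      by (rule mlin_compose[OF pure_mlin C.koszul_linear], rule pure_in, use assms in auto)
    show "mlin s fscale V (length xs) (\<lambda>ys. ksgn (e * cdeg c (length xs)) (P c (map (koszul G e) ys)))"
      by (intro mlin_ksgn vector_space_fscale pure_koszul_mlin)
    fix ys k assume ys: "length ys = length xs" "homogeneous ys k"
    moreover have "ys \<noteq> []" using ys assms by auto
    ultimately have "koszul GC e (P c ys) = ksgn (e * (cdeg c (length xs) + k)) (P c ys)"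
      using C.koszul_homogeneous[OF pure_homogeneous[of ys k c]] assms by auto
    also have "\<dots> = ksgn (e * cdeg c (length xs)) (P c (map (koszul G e) ys))"
      by (simp add: mlin_koszul_homogeneous[OF pure_mlin vector_space_fscale ys(2)] ksgn_ksgn algebra_simps)
    finally show "koszul GC e (P c ys) = \<dots>" .
  qed
qed

section \<open>Cutting inputs into blocks\<close>

lemma length_blocks [simp]: "length (blocks s V G w xs) = length w"
  by (induction w arbitrary: xs) auto

lemma blocks_in:
  "pos w \<Longrightarrow> wsum w \<le> length xs \<Longrightarrow> set xs \<subseteq> V \<Longrightarrow> set (blocks s V G w xs) \<subseteq> C"
proof (induction w arbitrary: xs)
  case (Cons a w)
  obtain c i where a: "a = (c, i)" by (cases a)
  have "set (take i xs) \<subseteq> V" "set (drop i xs) \<subseteq> V"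
    using Cons.prems set_take_subset set_drop_subset by fast+
  with Cons a show ?case by (auto intro!: pure_in koszul_in)
qed simp

text \<open>All labels of v move past all inputs of w, whence the exponent \<open>wdeg v\<close> on
  these inputs.\<close>

lemma blocks_append:
  assumes "wsum w \<le> length xs" "set xs \<subseteq> V"
  shows "blocks s V G (w @ v) xs =
    blocks s V G w (map (koszul G (wdeg v)) (take (wsum w) xs)) @ blocks s V G v (drop (wsum w) xs)"
  using assms
proof (induction w arbitrary: xs)
  case (Cons a w)
  obtain c i where a: "a = (c, i)" by (cases a)
  have V: "set (take i xs) \<subseteq> V" "set (drop i xs) \<subseteq> V"
    using Cons.prems set_take_subset set_drop_subset by fast+
  have "wsum w \<le> length (drop i xs)" using Cons.prems a by simp
  from Cons.IH[OF this V(2)] V show ?case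
    by (simp add: a take_map drop_map map_koszul_koszul min_def drop_take add.commute
        del: map_map)
qed simp

text \<open>This makes the formula in \<open>cof_decomp\<close> multilinear in each arity, so that
  \<open>cof_lift\<close> takes the intended values on pure tensors.\<close>

lemma mlin_blocks:
  assumes "mlin fscale t C (length w) f" "pos w" "wsum w = n" "vector_space t"
  shows "mlin s t V n (\<lambda>xs. f (blocks s V G w xs))"
  using assms(1-3)
proof (induction w arbitrary: f n)
  case Nil
  then show ?case by (auto simp: mlin_def)
next
  case (Cons a w)
  interpret C: graded fscale C GC by (rule graded_cof)
  obtain c i where a: "a = (c, i)" by (cases a)
  have n: "n - i = wsum w" "i \<le> n" "i \<ge> 1" using Cons.prems a by auto
  let ?K = "koszul G (wdeg w)"
  have "mlin s t V n (\<lambda>xs. f (P c (map ?K (take i xs)) # blocks s V G w (drop i xs)))"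
  proof (rule mlin_split[OF n(2)])
    fix ys assume ys: "set ys \<subseteq> V" "length ys = n - i"
    have b: "set (blocks s V G w ys) \<subseteq> C"
      by (rule blocks_in) (use Cons.prems n ys in auto)
    have "linear_on fscale t C (\<lambda>y. f ([] @ y # blocks s V G w ys))"
      by (rule mlinD[OF Cons.prems(1)]) (use b in auto)
    then have "mlin s t V i (\<lambda>xs. f ([] @ P c (map ?K xs) # blocks s V G w ys))"
      by (rule mlin_compose[OF pure_koszul_mlin])
        (use n in \<open>auto intro!: pure_in koszul_in\<close>)
    then show "mlin s t V i (\<lambda>xs. f (P c (map ?K xs) # blocks s V G w ys))" by simp
  next
    fix xs assume xs: "set xs \<subseteq> V" "length xs = i"
    have "P c (map ?K xs) \<in> C" using xs n by (intro pure_in set_map_koszul) auto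
    then have "mlin fscale t C (length w) (\<lambda>ys. f ([P c (map ?K xs)] @ ys @ []))"
      by (intro mlin_context) (use Cons.prems in auto)
    then show "mlin s t V (n - i) (\<lambda>ys. f (P c (map ?K xs) # blocks s V G w ys))"
      using Cons.IH[of "\<lambda>ys. f (P c (map ?K xs) # ys)"] Cons.prems n by simp
  qed
  then show ?case by (simp add: a)
qed

text \<open>Block by block, \<open>koszul_pure\<close> gives the sign of the label and an operator
  on the entries, which commutes with the Koszul operators inside \<open>blocks\<close>. It serves
  to move d past the blocks on its left.\<close>

lemma koszul_blocks:
  assumes "mlin fscale t C (length us + length w + length vs) f" "vector_space t"
    and "pos w" "wsum w = length xs" "set xs \<subseteq> V" "set us \<subseteq> C" "set vs \<subseteq> C"
  shows "f (us @ map (koszul GC e) (blocks s V G w xs) @ vs) =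
    ksgn (e * wdeg w) (f (us @ blocks s V G w (map (koszul G e) xs) @ vs))"
  using assms
proof (induction w arbitrary: xs us)
  case (Cons a w)
  interpret C: graded fscale C GC by (rule graded_cof)
  obtain c i where a: "a = (c, i)" by (cases a)
  let ?K = "koszul G (wdeg w)"
  let ?y = "P c (map ?K (take i xs))"
  let ?y' = "P c (map ?K (take i (map (koszul G e) xs)))"
  have V: "set (take i xs) \<subseteq> V" "set (drop i xs) \<subseteq> V"
    using Cons.prems set_take_subset set_drop_subset by fast+
  have i: "i \<ge> 1" "i \<le> length xs" using Cons.prems a by auto
  have y: "?y \<in> C" "?y' \<in> C"
    using V i by (force intro!: pure_in simp: take_map koszul_in)+
  have "koszul GC e ?y = ksgn (e * cdeg c i) (P c (map (koszul G e) (map ?K (take i xs))))"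
    using V i by (subst koszul_pure) (auto intro!: koszul_in simp: min_def)
  also have "map (koszul G e) (map ?K (take i xs)) = map ?K (take i (map (koszul G e) xs))"
    using V by (simp add: take_map map_koszul_koszul add.commute del: map_map)
  finally have k: "koszul GC e ?y = ksgn (e * cdeg c i) ?y'" .
  have "f (us @ map (koszul GC e) (blocks s V G (a # w) xs) @ vs) =
      f ((us @ [koszul GC e ?y]) @ map (koszul GC e) (blocks s V G w (drop i xs)) @ vs)"
    by (simp add: a)
  also have "\<dots> = ksgn (e * wdeg w) (f ((us @ [koszul GC e ?y]) @ blocks s V G w (map (koszul G e) (drop i xs)) @ vs))"
    by (rule Cons.IH) (use Cons.prems a V y C.koszul_in in auto)
  also have "f ((us @ [koszul GC e ?y]) @ blocks s V G w (map (koszul G e) (drop i xs)) @ vs) =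
      f (us @ koszul GC e ?y # (blocks s V G w (map (koszul G e) (drop i xs)) @ vs))" by simp
  also have "\<dots> = ksgn (e * cdeg c i) (f (us @ ?y' # (blocks s V G w (map (koszul G e) (drop i xs)) @ vs)))"
  proof -
    have b: "set (blocks s V G w (map (koszul G e) (drop i xs))) \<subseteq> C"
      by (rule blocks_in) (use Cons.prems a V in \<open>auto simp: koszul_in\<close>)
    interpret L: linear_on_sp fscale t C "\<lambda>y. f (us @ y # (blocks s V G w (map (koszul G e) (drop i xs)) @ vs))"
      by (rule linear_on_sp.intro[OF vector_space_fscale Cons.prems(2) subC mlinD[OF Cons.prems(1)]])
        (use Cons.prems b in auto)
    show ?thesis unfolding k by (rule L.ksgn[OF y(2)])
  qed
  finally show ?case by (simp add: a ksgn_ksgn take_map drop_map algebra_simps)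
qed simp

end

text \<open>The shape shared by \<open>slot\<close> (with q = 1) and \<open>insert_D\<close>. The
  entry that varies lies before, inside or after the segment to which g is applied.\<close>

lemma mlin_comp_append:
  assumes "mlin s t V (p + Suc r) f" "vector_space t" "vector_space s" "module.subspace s V"
    and k: "linear_on s s V k" "\<And>x. x \<in> V \<Longrightarrow> k x \<in> V"
    and g: "mlin s s V q g" "\<And>xs. set xs \<subseteq> V \<Longrightarrow> length xs = q \<Longrightarrow> g xs \<in> V"
  shows "mlin s t V (p + q + r) (\<lambda>xs. f (map k (take p xs) @ g (take q (drop p xs)) # drop (p + q) xs))"
proof -
  have inner: "mlin s t V (q + r) (\<lambda>ys. f (us @ g (take q ys) # drop q ys))"
    if us: "set us \<subseteq> V" "length us = p" for us
  proof (rule mlin_split)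
    fix ys assume ys: "set ys \<subseteq> V" "length ys = q + r - q"
    then have "linear_on s t V (\<lambda>y. f (us @ y # ys))"
      using us by (intro mlinD[OF assms(1)]) auto
    then show "mlin s t V q (\<lambda>xs. f (us @ g xs # ys))"
      by (rule mlin_compose[OF g(1)]) (rule g(2))
  next
    fix xs assume xs: "set xs \<subseteq> V" "length xs = q"
    have "mlin s t V r (\<lambda>ys. f ((us @ [g xs]) @ ys @ []))"
      by (rule mlin_context) (use assms us xs in auto)
    then show "mlin s t V (q + r - q) (\<lambda>ys. f (us @ g xs # ys))" by simp
  qed simp
  have "mlin s t V (p + q + r) (\<lambda>xs. f (map k (take p xs) @ g (take q (drop p xs)) # drop q (drop p xs)))"
  proof (rule mlin_split)
    fix ys assume ys: "set ys \<subseteq> V" "length ys = p + q + r - p"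
    have s: "set (take q ys) \<subseteq> V" "set (drop q ys) \<subseteq> V"
      using ys(1) set_take_subset set_drop_subset by fast+
    have "mlin s t V p (\<lambda>xs. f ([] @ xs @ (g (take q ys) # drop q ys)))"
      by (rule mlin_context) (use assms s ys in auto)
    then show "mlin s t V p (\<lambda>xs. f (map k xs @ g (take q ys) # drop q ys))"
      using mlin_map[of s t V p "\<lambda>xs. f (xs @ g (take q ys) # drop q ys)", OF _ k] by simp
  next
    fix xs assume "set xs \<subseteq> V" "length xs = p"
    then show "mlin s t V (p + q + r - p) (\<lambda>ys. f (map k xs @ g (take q ys) # drop q ys))"
      using inner[of "map k xs"] k(2) by auto
  qed simp
  then show ?thesis by (simp add: add.commute)
qed

text \<open>In the application i and j are the positions of two successive applications of d; the
  surviving diagonal is the square of d in one position.\<close>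

lemma sum_antisym_square:
  fixes X :: "nat \<Rightarrow> nat \<Rightarrow> 'b::ab_group_add"
  assumes "\<And>i j. i < j \<Longrightarrow> j < n \<Longrightarrow> X i j = - X j i"
  shows "(\<Sum>i<n. \<Sum>j<n. X i j) = (\<Sum>i<n. X i i)"
  using assms
proof (induction n)
  case (Suc n)
  have "(\<Sum>i<n. X i n) + (\<Sum>j<n. X n j) = 0"
    using Suc.prems by (simp flip: sum.distrib)
  with Suc show ?case by (simp add: sum.distrib algebra_simps)
qed simp

definition words :: "nat \<Rightarrow> (agd \<times> nat) list set" where
  "words n = {w. (pos w) \<and> wsum w = n}"

lemma finite_words: "finite (words n)"
proof (rule finite_subset)
  show "words n \<subseteq> {w. set w \<subseteq> UNIV \<times> {..n} \<and> length w \<le> n}"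
  proof
    fix w assume w: "w \<in> words n"
    have "length v \<le> wsum v" if "pos v" for v :: "(agd \<times> nat) list"
      using that by (induction v) fastforce+
    moreover have "i \<le> n" if "(c, i) \<in> set w" for c i
      using w member_le_sum_list[of i "map snd w"] that by (force simp: words_def)
    ultimately show "w \<in> {w. set w \<subseteq> UNIV \<times> {..n} \<and> length w \<le> n}" using w by (auto simp: words_def)
  qed
qed (intro finite_lists_length_le finite_SigmaI; simp)

section \<open>The projection of C(A) onto A\<close>

locale cofree = graded s "UNIV" G
  for s :: "'k::field_char_0 \<Rightarrow> 'a::ab_group_add \<Rightarrow> 'a" and G :: "int \<Rightarrow> 'a set"
begin

sublocale C: graded fscale C GC
  by (rule graded_cof)

text \<open>Elements of C(A) are functionals on forms, so the value of x at
  \<open>corestr_form f\<close> is f applied to the projection of x to A.\<close>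

definition corestr_form :: "('a \<Rightarrow> 'k) \<Rightarrow> agd \<Rightarrow> 'a list \<Rightarrow> 'k" where
  "corestr_form f = (\<lambda>c xs. if c = Mu \<and> length xs = 1 then f (hd xs) else 0)"

lemma corestr_form: "Vector_Spaces.linear s (*) f \<Longrightarrow> corestr_form f \<in> forms s UNIV"
proof -
  assume "Vector_Spaces.linear s (*) f"
  then interpret Vector_Spaces.linear s "(*)" f .
  show ?thesis
    by (auto simp: corestr_form_def forms_def multilinear_on_def linear_on_def add scale Cons_eq_append_conv
        append_eq_Cons_conv)
qed

lemma linear_forms_separate:
  assumes "\<And>f. Vector_Spaces.linear s (*) f \<Longrightarrow> f a = f b"
  shows "a = b"
proof (rule ccontr)
  assume ab: "a \<noteq> b"
  interpret vector_space_pair s "(*) :: 'k \<Rightarrow> 'k \<Rightarrow> 'k"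
    by (intro vector_space_pair.intro vector_space_axioms vector_space_mult)
  have "independent {a - b}" using ab by (simp add: dependent_single)
  from linear_independent_extend[OF this, of "\<lambda>_. 1"] obtain f
    where f: "Vector_Spaces.linear s (*) f" "f (a - b) = 1" by auto
  interpret Vector_Spaces.linear s "(*)" f by (rule f(1))
  show False using f(2) assms[OF f(1)] by (simp add: diff)
qed

lemma cof_proj_eqI:
  assumes "\<And>f. Vector_Spaces.linear s (*) f \<Longrightarrow> f a = x (corestr_form f)"
  shows "cof_proj s x = a"
proof -
  have *: "(\<lambda>c xs. if c = Mu \<and> length xs = 1 then f (hd xs) else 0) = corestr_form f" for f
    by (simp add: corestr_form_def)
  show ?thesis
    unfolding cof_proj_def *
  proof (rule the_equality)
    fix b assume "\<forall>f. Vector_Spaces.linear s (*) f \<longrightarrow> f b = x (corestr_form f)"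
    then show "b = a" by (intro linear_forms_separate) (simp only: assms)
  qed (use assms in blast)
qed

text \<open>The definite description in \<open>cof_proj\<close> has a value: the elements x for
  which a suitable vector exists form a subspace containing the pure tensors. Uniqueness of the
  vector holds because linear forms separate points.\<close>

lemma cof_proj_char:
  assumes "x \<in> C" "Vector_Spaces.linear s (*) f"
  shows "f (cof_proj s x) = x (corestr_form f)"
proof -
  let ?S = "{x. \<exists>a. \<forall>f. Vector_Spaces.linear s (*) f \<longrightarrow> f a = x (corestr_form f)}"
  have lin: "Vector_Spaces.linear s (*) f \<Longrightarrow> f 0 = 0 \<and> f (a + b) = f a + f b \<and> f (s c a) = c * f a" for f a b c
    by (metis Vector_Spaces.linear.axioms(3) linear_iff_module_hom module_hom.add module_hom.scale module_hom.zero)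
  have "fs.subspace ?S"
  proof (rule fs.subspaceI)
    show "0 \<in> ?S" by (auto intro!: exI[of _ 0] simp: lin)
  next
    fix x y assume "x \<in> ?S" "y \<in> ?S"
    then obtain a b where "\<forall>f. Vector_Spaces.linear s (*) f \<longrightarrow> f a = x (corestr_form f)"
      "\<forall>f. Vector_Spaces.linear s (*) f \<longrightarrow> f b = y (corestr_form f)" by auto
    then show "x + y \<in> ?S" by (auto intro!: exI[of _ "a + b"] simp: lin)
  next
    fix c x assume "x \<in> ?S"
    then obtain a where "\<forall>f. Vector_Spaces.linear s (*) f \<longrightarrow> f a = x (corestr_form f)" by auto
    then show "fscale c x \<in> ?S" by (auto intro!: exI[of _ "s c a"] simp: lin fscale_def)
  qed
  moreover have "P c xs \<in> ?S" if "xs \<noteq> []" for c xs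
  proof -
    have "f (if c = Mu \<and> length xs = 1 then hd xs else 0) = P c xs (corestr_form f)"
      if "Vector_Spaces.linear s (*) f" for f
      using corestr_form[OF that] lin[OF that] by (simp add: pure_def) (simp add: corestr_form_def)
    then show ?thesis by blast
  qed
  ultimately have "x \<in> ?S"
    by (intro cof_linear_in[OF linear_on_id vector_space_fscale _ _ assms(1)]) auto
  then obtain a where a: "\<And>f. Vector_Spaces.linear s (*) f \<Longrightarrow> f a = x (corestr_form f)" by auto
  then show ?thesis using cof_proj_eqI[of a x] assms(2) by simp
qed

lemma cof_proj_pure: "cof_proj s (P c xs) = (if c = Mu \<and> length xs = 1 then hd xs else 0)"
proof (rule cof_proj_eqI)
  fix f assume f: "Vector_Spaces.linear s (*) f"
  then interpret Vector_Spaces.linear s "(*)" f .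
  show "f (if c = Mu \<and> length xs = 1 then hd xs else 0) = P c xs (corestr_form f)"
    using corestr_form[OF f] by (simp add: pure_def) (simp add: corestr_form_def)
qed

lemma cof_proj_linear: "linear_on fscale s C (cof_proj s)"
proof (rule linear_onI)
  fix x y assume A: "x \<in> C" "y \<in> C"
  show "cof_proj s (x + y) = cof_proj s x + cof_proj s y"
  proof (rule cof_proj_eqI)
    fix f assume f: "Vector_Spaces.linear s (*) f"
    then interpret Vector_Spaces.linear s "(*)" f .
    show "f (cof_proj s x + cof_proj s y) = (x + y) (corestr_form f)"
      using A f by (simp add: add cof_proj_char)
  qed
next
  fix c x assume A: "x \<in> C"
  show "cof_proj s (fscale c x) = s c (cof_proj s x)"
  proof (rule cof_proj_eqI)
    fix f assume f: "Vector_Spaces.linear s (*) f"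
    then interpret Vector_Spaces.linear s "(*)" f .
    show "f (s c (cof_proj s x)) = fscale c x (corestr_form f)"
      using A f by (simp add: scale cof_proj_char fscale_def)
  qed
qed

sublocale proj: linear_on_sp fscale s C "cof_proj s"
  by (intro linear_on_sp.intro vector_space_fscale vector_space_axioms subC cof_proj_linear)

lemma cof_proj_homogeneous: "x \<in> GC k \<Longrightarrow> cof_proj s x \<in> G k"
proof (rule cof_homogeneous_in[OF cof_proj_linear vector_space_axioms subG])
  fix c xs assume "xs \<noteq> []" "homogeneous xs (k - cdeg c (length xs))"
  then show "cof_proj s (P c xs) \<in> G k"
    by (cases xs) (auto simp: cof_proj_pure subspace_0[OF subG] homogeneous_Cons cdeg_def)
qed

section \<open>The structure map and the action of d on C(C(A))\<close>

abbreviation "\<Delta> \<equiv> cof_decomp s UNIV G"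

lemma cof_decomp_eq: "\<Delta> = cof_lift (\<lambda>c xs. \<Sum>c0\<in>UNIV. \<Sum>w\<in>words (length xs).
    fscale (of_int (agd_decomp c c0 w)) (C.P c0 (blocks s UNIV G w xs)))"
  unfolding cof_decomp_def words_def ..

lemma pure_blocks_mlin: "w \<in> words n \<Longrightarrow> mlin s fscale UNIV n (\<lambda>xs. C.P c0 (blocks s UNIV G w xs))"
  by (rule mlin_blocks[OF C.pure_mlin _ _ vector_space_fscale]) (auto simp: words_def)

lemma cof_decomp_pure: "\<Delta> (P c xs) = (\<Sum>c0\<in>UNIV. \<Sum>w\<in>words (length xs).
    fscale (of_int (agd_decomp c c0 w)) (C.P c0 (blocks s UNIV G w xs)))"
  unfolding cof_decomp_eq
proof (rule cof_lift_pure')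
  fix c n
  show "mlin s fscale UNIV n (\<lambda>xs. \<Sum>c0\<in>UNIV. \<Sum>w\<in>words (length xs).
      fscale (of_int (agd_decomp c c0 w)) (C.P c0 (blocks s UNIV G w xs)))"
  proof (rule iffD1[OF mlin_cong[OF subV module_axioms]])
    show "mlin s fscale UNIV n (\<lambda>xs. \<Sum>c0\<in>UNIV. \<Sum>w\<in>words n.
      fscale (of_int (agd_decomp c c0 w)) (C.P c0 (blocks s UNIV G w xs)))"
      by (intro mlin_sum vector_space_fscale mlin_fscale pure_blocks_mlin)
  qed simp
qed

lemma blocks_words_in: "w \<in> words (length xs) \<Longrightarrow> set (blocks s UNIV G w xs) \<subseteq> C"
  by (rule blocks_in) (auto simp: words_def)

lemma words_nonempty: "w \<in> words n \<Longrightarrow> n \<noteq> 0 \<Longrightarrow> w \<noteq> []"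
  by (auto simp: words_def)

lemma cof_decomp_in: "x \<in> C \<Longrightarrow> \<Delta> x \<in> C.C"
proof (rule cof_linear_in[where f = \<Delta>, OF _ vector_space_fscale C.subC])
  show "linear_on fscale fscale C \<Delta>" unfolding cof_decomp_eq by (rule linear_on_cof_lift)
  fix c and xs :: "'a list" assume xs: "xs \<noteq> []"
  have "fscale a (C.P c0 (blocks s UNIV G w xs)) \<in> C.C" if w: "w \<in> words (length xs)" for a c0 w
  proof -
    have "w \<noteq> []" using words_nonempty[OF w] xs by simp
    then have "blocks s UNIV G w xs \<noteq> []" by (cases w) auto
    from fs.subspace_scale[OF C.subC C.pure_in[OF this blocks_words_in[OF w]]] show ?thesis .
  qed
  then show "\<Delta> (P c xs) \<in> C.C"
    unfolding cof_decomp_pure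
    by (rule fs.subspace_sum[OF C.subC, OF fs.subspace_sum[OF C.subC]])
qed assumption

text \<open>One summand of \<open>cof_deriv\<close>, without the sign that d receives from passing
  the label.\<close>

definition slot :: "int \<Rightarrow> (('k, 'a) cof \<Rightarrow> ('k, 'a) cof) \<Rightarrow> nat \<Rightarrow> ('k, 'a) cof list \<Rightarrow> ('k, 'a) cof list" where
  "slot e d i ys = map (koszul GC e) (take i ys) @ d (ys ! i) # drop (Suc i) ys"

abbreviation "deriv \<equiv> cof_deriv fscale C GC"

lemma slot_mlin:
  assumes "linear_on fscale fscale C d" "\<And>x. x \<in> C \<Longrightarrow> d x \<in> C" "i < n"
  shows "mlin fscale fscale C n (\<lambda>ys. C.P c (slot e d i ys))"
proof -
  have "mlin fscale fscale C (i + 1 + (n - Suc i)) (\<lambda>ys. C.P c (map (koszul GC e) (take i ys) @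
      (\<lambda>l. d (hd l)) (take 1 (drop i ys)) # drop (i + 1) ys))"
  proof (rule mlin_comp_append[OF C.pure_mlin vector_space_fscale vector_space_fscale subC C.koszul_linear C.koszul_in])
    show "mlin fscale fscale C 1 (\<lambda>l. d (hd l))"
      using assms(1) by (auto simp: mlin_def)
    show "d (hd xs) \<in> C" if "set xs \<subseteq> C" "length xs = 1" for xs
      using that assms(2) by (cases xs) auto
  qed
  moreover have "i + 1 + (n - Suc i) = n" using assms(3) by simp
  ultimately have "mlin fscale fscale C n (\<lambda>ys. C.P c (map (koszul GC e) (take i ys) @
      d (hd (take 1 (drop i ys))) # drop (i + 1) ys))" by simp
  then show ?thesis
  proof (rule iffD1[OF mlin_cong[OF subC fs.module_axioms], rotated])
    show "C.P c (map (koszul GC e) (take i ys) @ d (hd (take 1 (drop i ys))) # drop (i + 1) ys) = C.P c (slot e d i ys)"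
      if "length ys = n" for ys
      using that assms(3) by (simp add: slot_def hd_drop_conv_nth)
  qed
qed

lemma deriv_pure:
  assumes "linear_on fscale fscale C d" "\<And>x. x \<in> C \<Longrightarrow> d x \<in> C"
  shows "deriv e d (C.P c ys) = (\<Sum>i<length ys. ksgn (e * cdeg c (length ys)) (C.P c (slot e d i ys)))"
  unfolding cof_deriv_def slot_def[symmetric]
proof (rule C.cof_lift_pure')
  fix c n
  show "mlin fscale fscale C n (\<lambda>ys. \<Sum>i<length ys. ksgn (e * cdeg c (length ys)) (C.P c (slot e d i ys)))"
  proof (rule iffD1[OF mlin_cong[OF subC fs.module_axioms]])
    show "mlin fscale fscale C n (\<lambda>ys. \<Sum>i<n. ksgn (e * cdeg c n) (C.P c (slot e d i ys)))"
      by (intro mlin_sum vector_space_fscale mlin_ksgn slot_mlin assms) auto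
  qed simp
qed

lemma set_slot:
  assumes "set ys \<subseteq> C" "i < length ys" "\<And>x. x \<in> C \<Longrightarrow> d x \<in> C"
  shows "set (slot e d i ys) \<subseteq> C"
proof -
  have "d (ys ! i) \<in> C" using assms nth_mem by blast
  then show ?thesis
    using assms(1) C.koszul_in by (auto simp: slot_def dest: in_set_takeD in_set_dropD)
qed

lemma length_slot: "i < length ys \<Longrightarrow> length (slot e d i ys) = length ys"
  by (simp add: slot_def)

lemma linear_on_deriv: "linear_on fscale fscale S (deriv e d)"
  unfolding cof_deriv_def by (rule linear_on_cof_lift)

lemma deriv_0: "z \<in> C.C \<Longrightarrow> deriv e (\<lambda>_. 0) z = 0"
proof (rule C.cof_linear_eq[OF linear_on_deriv _ vector_space_fscale])
  fix c ys assume "set ys \<subseteq> C"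
  have "C.P c (slot e (\<lambda>_. 0) i ys) = 0" if "i < length ys" for i
  proof (rule mlin_zero_entry[OF C.pure_mlin vector_space_fscale vector_space_fscale subC])
    show "set (slot e (\<lambda>_. 0) i ys) \<subseteq> C"
      by (rule set_slot) (use that \<open>set ys \<subseteq> C\<close> fs.subspace_0[OF subC] in auto)
  qed (auto simp: slot_def)
  then show "deriv e (\<lambda>_. 0) (C.P c ys) = 0"
    by (subst deriv_pure) (auto simp: linear_on_def fs.subspace_0[OF subC])
qed (simp_all add: linear_on_def zero_fun_def fscale_def)

text \<open>The sign from the label occurs twice and cancels. For different positions the two orders
  of application differ by (-1)^(e e) = -1. For equal positions the two operators of exponent e on
  the entries to the left compose to the one of exponent 2 e.\<close>

lemma deriv_deriv:
  assumes d: "linear_on fscale fscale C d" "\<And>x. x \<in> C \<Longrightarrow> d x \<in> C" "\<And>k x. x \<in> GC k \<Longrightarrow> d x \<in> GC (k + e)"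
    and "odd e" "z \<in> C.C"
  shows "deriv e d (deriv e d z) = deriv (2 * e) (\<lambda>x. d (d x)) z"
proof (rule C.cof_linear_eq[OF _ linear_on_deriv vector_space_fscale _ assms(5)])
  show "linear_on fscale fscale C.C (\<lambda>z. deriv e d (deriv e d z))"
    by (rule linear_on_compose[OF linear_on_deriv linear_on_deriv]) (rule UNIV_I)
  fix c ys assume ys: "set ys \<subseteq> C"
  let ?n = "length ys"
  interpret D: linear_on_sp fscale fscale UNIV "deriv e d"
    by (intro linear_on_sp.intro vector_space_fscale fs.subspace_UNIV linear_on_deriv)
  define X where "X i j = C.P c (slot e d j (slot e d i ys))" for i j
  have "deriv e d (deriv e d (C.P c ys)) =
      (\<Sum>i<?n. ksgn (e * cdeg c ?n) (\<Sum>j<?n. ksgn (e * cdeg c ?n) (X i j)))"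
    by (simp add: deriv_pure[OF d(1,2)] D.sum D.ksgn X_def)
      (rule sum.cong[OF refl], simp add: length_slot)
  also have "\<dots> = (\<Sum>i<?n. \<Sum>j<?n. X i j)"
    by (simp add: ksgn_sum[symmetric] ksgn_ksgn) (simp add: ksgn_def)
  also have "\<dots> = (\<Sum>i<?n. X i i)"
  proof (rule sum_antisym_square)
    fix i j assume ij: "i < j" "j < ?n"
    define us a vs b ws where "us = take i ys" and "a = ys ! i" and
      "vs = take (j - Suc i) (drop (Suc i) ys)" and "b = ys ! j" and "ws = drop (Suc j) ys"
    have y: "ys = us @ a # vs @ b # ws"
    proof -
      have "drop (Suc i) ys = vs @ drop (j - Suc i) (drop (Suc i) ys)"
        unfolding vs_def by (rule append_take_drop_id[symmetric])
      also have "drop (j - Suc i) (drop (Suc i) ys) = b # ws"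
        using ij by (simp add: b_def ws_def Cons_nth_drop_Suc)
      finally show ?thesis using ij id_take_nth_drop[of i ys] by (simp add: us_def a_def)
    qed
    have len: "i = length us" "j = Suc (length us + length vs)" using ij by (auto simp: us_def vs_def)
    let ?K = "koszul GC e"
    \<comment> \<open>If d acts at i first, the later application at j signs the value
      \<open>d a\<close>; in the other order a itself is signed before d reaches it.\<close>
    have 1: "slot e d j (slot e d i ys) = map ?K (map ?K us) @ ?K (d a) # map ?K vs @ d b # ws"
      unfolding slot_def y len by (simp add: nth_append)
    have 2: "slot e d i (slot e d j ys) = map ?K (map ?K us) @ d (?K a) # map ?K vs @ d b # ws"
      unfolding slot_def y len by (simp add: nth_append)
    have C: "set us \<subseteq> C" "a \<in> C" "set vs \<subseteq> C" "b \<in> C" "set ws \<subseteq> C" using ys unfolding y by auto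
    have "d (?K a) = ksgn (e * e) (?K (d a))"
      by (rule C.graded_map_koszul[OF C.graded_axioms d(1,3) C(2)])
    then have dK: "d (?K a) = - ?K (d a)" using \<open>odd e\<close> by (simp add: ksgn_def)
    interpret L: linear_on_sp fscale fscale C "\<lambda>x. C.P c (map ?K (map ?K us) @ x # map ?K vs @ d b # ws)"
      by (rule linear_on_sp.intro[OF vector_space_fscale vector_space_fscale subC mlinD[OF C.pure_mlin]])
        (use C C.koszul_in d(2) in auto)
    show "X i j = - X j i" unfolding X_def 1 2 dK using L.neg C.koszul_in d(2) C(2) by simp
  qed
  also have "\<dots> = (\<Sum>i<?n. ksgn (2 * e * cdeg c ?n) (C.P c (slot (2 * e) (\<lambda>x. d (d x)) i ys)))"
  proof (rule sum.cong[OF refl])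
    fix i assume "i \<in> {..<?n}"
    then have i: "i < ?n" by simp
    have "slot e d i (slot e d i ys) = slot (2 * e) (\<lambda>x. d (d x)) i ys"
      using i ys by (auto simp: slot_def nth_append C.koszul_koszul dest!: in_set_takeD)
    then show "X i i = ksgn (2 * e * cdeg c ?n) (C.P c (slot (2 * e) (\<lambda>x. d (d x)) i ys))"
      unfolding X_def by (simp add: ksgn_def)
  qed
  also have "\<dots> = deriv (2 * e) (\<lambda>x. d (d x)) (C.P c ys)"
    by (rule deriv_pure[symmetric]) (use linear_on_compose[OF d(1) d(1)] d(2) in auto)
  finally show "deriv e d (deriv e d (C.P c ys)) = deriv (2 * e) (\<lambda>x. d (d x)) (C.P c ys)" .
qed

text \<open>Neither a degree nor values outside the carrier are prescribed, so total functions such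
  as 0, the square of d and an extension given by \<open>cof_lift\<close> can be compared
  directly.\<close>

definition coder :: "int \<Rightarrow> (('k, 'a) cof \<Rightarrow> ('k, 'a) cof) \<Rightarrow> bool" where
  "coder e d \<longleftrightarrow> linear_on fscale fscale C d \<and> (\<forall>x\<in>C. d x \<in> C) \<and> (\<forall>x\<in>C. \<Delta> (d x) = deriv e d (\<Delta> x))"

text \<open>The square of a coderivation is compared with this one in the uniqueness
  argument.\<close>

lemma coder_0: "coder e (\<lambda>_. 0)"
proof -
  have "\<Delta> 0 = 0" unfolding cof_decomp_eq by (simp add: cof_lift_def fun_eq_iff)
  then show ?thesis
    by (auto simp: coder_def linear_on_def fs.subspace_0[OF subC] deriv_0 cof_decomp_in)
qed

lemma coder_square:
  assumes "coder e d" "odd e" "\<And>k x. x \<in> GC k \<Longrightarrow> d x \<in> GC (k + e)"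
  shows "coder (2 * e) (\<lambda>x. d (d x))"
proof -
  have d: "linear_on fscale fscale C d" "x \<in> C \<Longrightarrow> d x \<in> C" "x \<in> C \<Longrightarrow> \<Delta> (d x) = deriv e d (\<Delta> x)" for x
    using assms(1) by (auto simp: coder_def)
  then show ?thesis
    using deriv_deriv[OF d(1,2) assms(3,2) cof_decomp_in] linear_on_compose[OF d(1) d(1) d(2)]
    by (simp add: coder_def)
qed

section \<open>Counitality and the uniqueness of coderivations\<close>

definition proj_list :: "('k, ('k, 'a) cof) cof \<Rightarrow> ('k, 'a) cof" where
  "proj_list = cof_lift (\<lambda>c ys. P c (map (cof_proj s) ys))"

lemma proj_list_pure: "proj_list (C.P c ys) = P c (map (cof_proj s) ys)"
  unfolding proj_list_def by (rule C.cof_lift_pure') (rule mlin_map[OF pure_mlin cof_proj_linear UNIV_I])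

lemma agd_decomp_counit:
  "agd_decomp c c0 (replicate n (Mu, 1)) = (if c0 = c then 1 else 0)"
proof -
  have l: "replicate n Mu \<noteq> (replicate n Mu)[j := upper_label c j]" if "j < n" for j
  proof
    assume "replicate n Mu = (replicate n Mu)[j := upper_label c j]"
    then have "replicate n Mu ! j = (replicate n Mu)[j := upper_label c j] ! j" by simp
    then show False using that by (simp add: upper_label_def split: if_splits)
  qed
  have "dsgn (replicate n 1) = 0" "tsgn 0 (replicate n 1) = 0"
    by (simp_all add: dsgn_def tsgn_def)
  then show ?thesis using l by (auto simp: agd_decomp_def Let_def)
qed

lemma blocks_replicate_counit:
  "length xs = n \<Longrightarrow> map (cof_proj s) (blocks s UNIV G (replicate n (Mu, 1)) xs) = xs"
proof (induction n arbitrary: xs)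
  case (Suc n)
  from Suc show ?case
    by (cases xs) (auto simp: cof_proj_pure koszul_0 cdeg_def sum_list_replicate)
qed simp

text \<open>The projection kills every block except \<mu>^c_1 \<otimes> x. Each factor
  \<open>(Mu, 1)\<close> uses up one input, so a word of such factors only is the one of length
  \<open>length xs\<close>.\<close>

lemma proj_blocks_zero:
  assumes "w \<in> words (length xs)" "w \<noteq> replicate (length xs) (Mu, 1)"
  shows "0 \<in> set (map (cof_proj s) (blocks s UNIV G w xs))"
  using assms
proof (induction w arbitrary: xs)
  case (Cons a w)
  obtain c i where a: "a = (c, i)" by (cases a)
  have i: "i \<ge> 1" "i \<le> length xs" "w \<in> words (length (drop i xs))" using Cons.prems a by (auto simp: words_def)
  show ?case
  proof (cases "c = Mu \<and> i = 1")
    case False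
    then show ?thesis using i by (auto simp: a cof_proj_pure)
  next
    case True
    then have "w \<noteq> replicate (length (drop i xs)) (Mu, 1)"
      using Cons.prems(2) i a by (cases xs) auto
    from Cons.IH[OF i(3) this] show ?thesis by (auto simp: a)
  qed
qed (auto simp: words_def)

text \<open>After projecting every upper factor only the word consisting of factors
  \<open>(Mu, 1)\<close> contributes, and its coefficient singles out the original label: this is
  (Id \<circ> \<epsilon>) \<Delta> = Id on C(A).\<close>

lemma counit: "x \<in> C \<Longrightarrow> proj_list (\<Delta> x) = x"
proof (rule cof_linear_eq[OF _ linear_on_id vector_space_fscale])
  show "linear_on fscale fscale C (\<lambda>x. proj_list (\<Delta> x))"
    unfolding proj_list_def cof_decomp_eq by (rule linear_on_compose[OF linear_on_cof_lift linear_on_cof_lift UNIV_I])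
  fix c and xs :: "'a list" assume "xs \<noteq> []"
  interpret L: linear_on_sp fscale fscale UNIV proj_list
    by (intro linear_on_sp.intro vector_space_fscale fs.subspace_UNIV) (simp add: proj_list_def linear_on_cof_lift)
  let ?w = "replicate (length xs) (Mu, 1)"
  have w: "?w \<in> words (length xs)" by (simp add: words_def sum_list_replicate)
  have "proj_list (\<Delta> (P c xs)) = (\<Sum>c0\<in>UNIV. \<Sum>w\<in>words (length xs).
      fscale (of_int (agd_decomp c c0 w)) (P c0 (map (cof_proj s) (blocks s UNIV G w xs))))"
    by (simp add: cof_decomp_pure L.sum L.scale proj_list_pure)
  also have "\<dots> = (\<Sum>c0\<in>UNIV. \<Sum>w\<in>words (length xs).
      if w = ?w then (if c0 = c then P c xs else 0) else 0)"
  proof (intro sum.cong refl)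
    fix c0 w assume "w \<in> words (length xs)"
    show "fscale (of_int (agd_decomp c c0 w)) (P c0 (map (cof_proj s) (blocks s UNIV G w xs))) =
        (if w = ?w then (if c0 = c then P c xs else 0) else 0)"
    proof (cases "w = ?w")
      case True
      show ?thesis unfolding True agd_decomp_counit blocks_replicate_counit[OF refl] by simp
    next
      case False
      have "P c0 (map (cof_proj s) (blocks s UNIV G w xs)) = 0"
        by (rule mlin_zero_entry[OF pure_mlin vector_space_axioms vector_space_fscale subV subset_UNIV refl])
          (rule proj_blocks_zero[OF \<open>w \<in> words (length xs)\<close> False])
      then show ?thesis using False by simp
    qed
  qed
  also have "\<dots> = P c xs" using w by (simp add: finite_words)
  finally show "proj_list (\<Delta> (P c xs)) = P c xs" .
qed

text \<open>The projection is applied to every entry, so \<open>proj_list (deriv e d z)\<close> sees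
  d only through \<open>cof_proj s (d y)\<close>; by \<open>counit\<close> it determines d x when z
  is \<Delta> x.\<close>

lemma coder_eqI:
  assumes d: "coder e d" and d': "coder e d'"
    and eq: "\<And>c xs. xs \<noteq> [] \<Longrightarrow> cof_proj s (d (P c xs)) = cof_proj s (d' (P c xs))"
    and x: "x \<in> C"
  shows "d x = d' x"
proof -
  interpret L: linear_on_sp fscale fscale UNIV proj_list
    by (intro linear_on_sp.intro vector_space_fscale fs.subspace_UNIV) (simp add: proj_list_def linear_on_cof_lift)
  have eqC: "cof_proj s (d x) = cof_proj s (d' x)" if "x \<in> C" for x
    by (rule cof_linear_eq[OF _ _ vector_space_axioms _ that])
      (use d d' eq in \<open>auto simp: coder_def intro!: linear_on_compose[OF _ cof_proj_linear]\<close>)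
  have "proj_list (deriv e d z) = proj_list (deriv e d' z)" if "z \<in> C.C" for z
  proof (rule C.cof_linear_eq[OF _ _ vector_space_fscale _ that])
    fix c ys assume ys: "set ys \<subseteq> C"
    have "map (cof_proj s) (slot e d i ys) = map (cof_proj s) (slot e d' i ys)" if "i < length ys" for i
      using ys that by (simp add: slot_def eqC subset_iff)
    then show "proj_list (deriv e d (C.P c ys)) = proj_list (deriv e d' (C.P c ys))"
      using d d' by (simp add: coder_def deriv_pure L.sum L.ksgn proj_list_pure)
  qed (use L.lin linear_on_deriv in \<open>auto intro!: linear_on_compose[OF linear_on_deriv]\<close>)
  from this[OF cof_decomp_in[OF x]] have "proj_list (\<Delta> (d x)) = proj_list (\<Delta> (d' x))"
    using d d' x by (simp add: coder_def)
  moreover have "d x \<in> C" "d' x \<in> C" using d d' x by (auto simp: coder_def)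
  ultimately show ?thesis using counit[of "d x"] counit[of "d' x"] by simp
qed

end

section \<open>Coassociativity of the decomposition coefficients\<close>

lemma tsgn_Suc_Cons: "tsgn (Suc v) (i # is) = tsgn v is"
  unfolding tsgn_def by (simp only: length_Cons sum.shift_bounds_Suc_ivl nth_Cons_Suc)

lemma tsgn_Nil [simp]: "tsgn v [] = 0"
  by (simp add: tsgn_def)

lemma tsgn_Cons: "tsgn 0 (i # is) = (i - 1) + tsgn 0 is"
proof -
  have "tsgn 0 (i # is) = (i - 1) + tsgn (Suc 0) (i # is)"
    unfolding tsgn_def by (simp add: sum.atLeast_Suc_lessThan)
  then show ?thesis by (simp only: tsgn_Suc_Cons)
qed

lemma tsgn_append: "tsgn 0 (is @ js) = tsgn 0 is + tsgn 0 js"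
  by (induction "is") (simp_all add: tsgn_Cons)

lemma dsgn_Cons: "dsgn (i # is) = (i - 1) * length is + dsgn is"
  unfolding dsgn_def by (simp only: length_Cons sum.lessThan_Suc_shift nth_Cons_Suc nth_Cons_0) simp

text \<open>Each entry of the first list has \<open>length js\<close> additional factors to its
  right.\<close>

lemma dsgn_append: "dsgn (is @ js) = dsgn is + tsgn 0 is * length js + dsgn js"
  by (induction "is") (simp_all add: tsgn_Cons dsgn_Cons algebra_simps, simp add: dsgn_def)

abbreviation dsg :: "(agd \<times> nat) list \<Rightarrow> nat" where "dsg w \<equiv> dsgn (map snd w)"
abbreviation tsg :: "(agd \<times> nat) list \<Rightarrow> nat" where "tsg w \<equiv> tsgn 0 (map snd w)"
abbreviation all_mu :: "(agd \<times> nat) list \<Rightarrow> bool" where "all_mu w \<equiv> map fst w = replicate (length w) Mu"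

text \<open>The signed number of ways in which \<open>w\<close>, placed after \<open>k\<close> other factors, contains the
  distinguished factor of \<open>\<Delta> c\<close> and \<open>\<mu>\<^sup>c\<close> elsewhere.\<close>

primrec leaf :: "agd \<Rightarrow> nat \<Rightarrow> (agd \<times> nat) list \<Rightarrow> int" where
  "leaf c k [] = 0"
| "leaf c k (a # w) = (if fst a = upper_label c k \<and> all_mu w then sg (tsg w) else 0) +
    (if fst a = Mu then leaf c (Suc k) w else 0)"

text \<open>Position j of w is position k + j of the whole word, while the sign counts only factors
  to the right and is unaffected by the offset. The recursion peels off the first factor.\<close>

lemma leaf_sum:
  "(\<Sum>j<length w. if map fst w = (replicate (length w) Mu)[j := upper_label c (k + j)]
      then (-1) ^ tsgn (Suc j) (map snd w) else 0) = leaf c k w"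
proof (induction w arbitrary: k)
  case (Cons a w)
  let ?f = "\<lambda>j. if map fst w = (replicate (length w) Mu)[j := upper_label c (Suc k + j)]
      then (-1) ^ tsgn (Suc j) (map snd w) else (0::int)"
  let ?g = "\<lambda>j. if map fst (a # w) = (replicate (length (a # w)) Mu)[j := upper_label c (k + j)]
      then (-1) ^ tsgn (Suc j) (map snd (a # w)) else (0::int)"
  have 0: "?g 0 = (if fst a = upper_label c k \<and> all_mu w then sg (tsg w) else 0)"
    by (simp add: tsgn_Suc_Cons power_neg_one_sg)
  have S: "?g (Suc j) = (if fst a = Mu then ?f j else 0)" for j
    by (simp add: tsgn_Suc_Cons)
  have "(\<Sum>j<length (a # w). ?g j) = ?g 0 + (\<Sum>j<length w. ?g (Suc j))"
    by (simp only: length_Cons sum.lessThan_Suc_shift)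
  also have "(\<Sum>j<length w. ?g (Suc j)) = (if fst a = Mu then \<Sum>j<length w. ?f j else 0)"
    unfolding S by simp
  also have "(\<Sum>j<length w. ?f j) = leaf c (Suc k) w" by (rule Cons)
  finally show ?case unfolding 0 by simp
qed simp

lemma agd_decomp_leaf:
  "agd_decomp c c0 w = sg (dsg w) *
     ((if c0 = c \<and> all_mu w then if c = Mu then 1 else sg (tsg w) else 0) +
      (if c \<noteq> Mu \<and> c0 = Mu then leaf c 0 w else 0))"
proof -
  have "(\<Sum>j<length w. if map fst w = (replicate (length w) Mu)[j := upper_label c j]
      then (-1) ^ (dsg w + tsgn (Suc j) (map snd w)) else 0) = sg (dsg w) * leaf c 0 w"
    unfolding leaf_sum[of w c 0, symmetric] sum_distrib_left
    by (rule sum.cong) (auto simp: power_add power_neg_one_sg)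
  then show ?thesis
    by (auto simp: agd_decomp_def Let_def power_neg_one_sg sg_add)
qed

text \<open>\<open>Dl\<close> is special in the very first position only; beyond it the
  distinguished factor is always \<open>H\<close>.\<close>

lemma leaf_Suc: "leaf c (Suc k) w = leaf H 0 w"
proof (induction w arbitrary: c k)
  case (Cons a w)
  have "upper_label c (Suc k) = upper_label H 0" by (simp add: upper_label_def)
  moreover have "leaf c (Suc (Suc k)) w = leaf H (Suc 0) w" by (simp only: Cons)
  ultimately show ?case by simp
qed simp

lemma all_mu_append: "all_mu (w1 @ w2) \<longleftrightarrow> all_mu w1 \<and> all_mu w2"
  by (simp add: replicate_add)

text \<open>The distinguished factor lies in w1, and its symbol of degree one has then passed all of
  w2 as well, or it lies in w2.\<close>

lemma leaf_append:
  "leaf c k (w1 @ w2) = (if all_mu w2 then leaf c k w1 * sg (tsg w2) else 0) +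
    (if all_mu w1 then leaf c (k + length w1) w2 else 0)"
proof (induction w1 arbitrary: k)
  case (Cons a w1)
  show ?case
    by (simp add: Cons replicate_add tsgn_append sg_add) (auto simp: algebra_simps upper_label_def)
qed simp

text \<open>Three places are possible for the distinguished factor: in w1, at the marked factor, or
  in w2. Writing the marked arity as a successor avoids truncated subtraction in the
  exponents.\<close>

lemma agd_decomp_split:
  "agd_decomp c c0 (w1 @ (e, Suc i) # w2) =
    sg (int (dsg w1 + tsg w1 * (1 + length w2) + i * length w2 + dsg w2)) *
    ((if c0 = c \<and> all_mu w1 \<and> e = Mu \<and> all_mu w2
      then if c = Mu then 1 else sg (int (tsg w1 + i + tsg w2)) else 0) +
     (if c \<noteq> Mu \<and> c0 = Mu
      then (if e = Mu \<and> all_mu w2 then leaf c 0 w1 * sg (int (i + tsg w2)) else 0) +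
        (if all_mu w1
         then (if e = upper_label c (length w1) \<and> all_mu w2 then sg (int (tsg w2)) else 0) +
           (if e = Mu then leaf H 0 w2 else 0)
         else 0)
      else 0))"
  unfolding agd_decomp_leaf leaf_append all_mu_append
  by (simp add: leaf_Suc dsgn_append dsgn_Cons tsgn_append tsgn_Cons algebra_simps)

lemma cdeg_all_mu: "pos w \<Longrightarrow> all_mu w \<Longrightarrow> wdeg w = int (tsg w)"
  by (induction w) (auto simp: tsgn_Cons cdeg_def of_nat_diff)

text \<open>Exactly one factor is not \<open>Mu\<close>, and its degree is one higher than that of
  \<open>Mu\<close> in the same arity.\<close>

lemma cdeg_leaf: "pos w \<Longrightarrow> leaf c k w \<noteq> 0 \<Longrightarrow> wdeg w = int (tsg w) + 1"
proof (induction w arbitrary: k)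
  case (Cons a w)
  then show ?case
    using cdeg_all_mu[of w]
    by (cases a) (auto simp: tsgn_Cons cdeg_def of_nat_diff upper_label_def split: if_splits)
qed simp

lemma leaf_all_mu: "all_mu w \<Longrightarrow> leaf c k w = 0"
  by (induction w arbitrary: k) (auto simp: upper_label_def)

lemma sum_snd_eq: "pos w \<Longrightarrow> wsum w = tsg w + length w"
  by (induction w) (auto simp: tsgn_Cons)

lemma UNIV_agd: "(UNIV :: agd set) = {Mu, H, Dl}"
  by (auto intro: agd.exhaust)

lemma sum_agd: "(\<Sum>c\<in>UNIV. f c) = f Mu + f H + (f Dl :: 'b::comm_monoid_add)"
  by (simp add: UNIV_agd add.assoc)

text \<open>For \<mu>^c this is n - 1 = (k - 1) + sum of the (i_j - 1). The extra symbol of degree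
  one in h^c and \<delta>^c ends up either in the lower label or in exactly one upper label.\<close>

lemma agd_decomp_degree:
  assumes "agd_decomp c c0 w \<noteq> 0" "pos w"
  shows "cdeg c (wsum w) = cdeg c0 (length w) + wdeg w"
  using assms cdeg_all_mu[OF assms(2)] cdeg_leaf[OF assms(2), of c 0]
  by (auto simp: agd_decomp_leaf cdeg_def sum_snd_eq[OF assms(2)] split: if_splits)

text \<open>The coefficient in \<Delta>_(1) of c of the term with lower label c0 and with e of arity
  q in its input p + 1, read off from the full decomposition map.\<close>

definition inf_coeff :: "agd \<Rightarrow> agd \<Rightarrow> nat \<Rightarrow> agd \<Rightarrow> nat \<Rightarrow> nat \<Rightarrow> int" where
  "inf_coeff c c0 p e q r = agd_decomp c c0 (replicate p (Mu, 1) @ [(e, q)] @ replicate r (Mu, 1))"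

lemma inf_coeff_Suc:
  "inf_coeff c c0 p e (Suc q) r =
    (if c0 = c \<and> e = Mu then sg (int ((if c = Mu then r else r + 1) * q)) else 0) +
    (if c \<noteq> Mu \<and> c0 = Mu \<and> e = upper_label c p then sg (int (r * q)) else 0)"
  unfolding inf_coeff_def
  using agd_infinitesimal[of "Suc q" c0 p e r]
  by (cases c) (auto simp: power_neg_one_sg upper_label_def)

lemma inf_coeff_degree:
  assumes "inf_coeff c c0 p e q r \<noteq> 0" "q \<ge> 1"
  shows "cdeg c (p + q + r) = cdeg c0 (p + 1 + r) + cdeg e q"
proof -
  have "cdeg Mu 1 = 0" by (simp add: cdeg_def)
  then show ?thesis
    using agd_decomp_degree[OF assms(1)[unfolded inf_coeff_def]] assms(2)
    by (auto simp: sum_list_replicate set_replicate_conv_if add.assoc)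
qed

text \<open>The sign on the right-hand side comes from moving \<open>e\<^sub>q\<close> past the blocks \<open>w2\<close>.\<close>

lemma inf_coeff_coassoc:
  assumes pos: "pos w1" "pos w2" and q: "q \<ge> 1"
  shows "(\<Sum>c0\<in>UNIV. inf_coeff c c0 (wsum w1 + p) e q (r + wsum w2) *
      agd_decomp c0 c1 (w1 @ (c', p + 1 + r) # w2)) =
    (\<Sum>c''\<in>UNIV. agd_decomp c c1 (w1 @ (c'', p + q + r) # w2) * inf_coeff c'' c' p e q r) *
      sg (wdeg w2 * cdeg e q)"
proof -
  obtain k where k: "q = Suc k" using q by (cases q) auto
  have d: "cdeg e q = int k + (if e = Mu then 0 else 1)" by (simp add: k cdeg_def)
  define t1 t2 k1 k2 d1 d2 where v: "t1 = tsg w1" "t2 = tsg w2" "k1 = length w1" "k2 = length w2"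
    "d1 = dsg w1" "d2 = dsg w2"
  define D where "D = wdeg w2"
  have s: "wsum w1 = t1 + k1" "wsum w2 = t2 + k2"
    using pos by (simp_all add: sum_snd_eq v)
  have e: "p + 1 + r = Suc (p + r)" "p + q + r = Suc (p + k + r)" by (simp_all add: k)
  \<comment> \<open>\<open>upper_label\<close> is evaluated at position k1 of a word on one side and
    at t1 + k1 + p on the other. Both must agree on what is first, and k1 = 0 forces w1 to be
    empty.\<close>
  have z: "k1 = 0 \<Longrightarrow> t1 = 0 \<and> all_mu w1 \<and> leaf c 0 w1 = 0" for c by (simp add: v tsgn_def)
  have m1: "all_mu w1 \<Longrightarrow> leaf c 0 w1 = 0" and m2: "all_mu w2 \<Longrightarrow> leaf H 0 w2 = 0" for c
    by (simp_all add: leaf_all_mu)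
  have D1: "all_mu w2 \<Longrightarrow> D = int t2" and D2: "leaf H 0 w2 \<noteq> 0 \<Longrightarrow> D = int t2 + 1"
    using cdeg_all_mu[OF pos(2)] cdeg_leaf[OF pos(2)] by (simp_all add: D_def v)
  \<comment> \<open>From here on w1 and w2 enter only through numbers and truth values, so a finite
    check over labels remains.\<close>
  define A1 A2 l2 where "A1 = all_mu w1" "A2 = all_mu w2" "l2 = leaf H 0 w2"
  define l1 where "l1 c = leaf c 0 w1" for c
  have z: "k1 = 0 \<Longrightarrow> t1 = 0 \<and> A1 \<and> l1 c = 0" for c using z by (simp add: A1_A2_l2_def l1_def)
  have m1: "A1 \<Longrightarrow> l1 c = 0" and m2: "A2 \<Longrightarrow> l2 = 0" for c
    using m1 m2 by (simp_all add: A1_A2_l2_def l1_def)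
  have D1: "A2 \<Longrightarrow> D = int t2" and D2: "l2 \<noteq> 0 \<Longrightarrow> D = int t2 + 1"
    using D1 D2 by (simp_all add: A1_A2_l2_def)
  have sg2: "sg a * (sg a * b) = b" "sg 1 = -1" "sg (2 * a) = 1" for a b
    by (auto simp: sg_def)
  have k1: "\<not> A1 \<Longrightarrow> k1 \<noteq> 0" using z by blast
  \<comment> \<open>D occurs in the sign on the right and is known if w2 consists of
    \<open>Mu\<close> only or contains one distinguished factor. In the remaining case l2 = 0 and
    all terms vanish.\<close>
  have "A1 \<and> A2 \<or> A1 \<and> \<not> A2 \<and> l2 = 0 \<or> A1 \<and> \<not> A2 \<and> D = int t2 + 1 \<or>
    \<not> A1 \<and> A2 \<or> \<not> A1 \<and> \<not> A2 \<and> l2 = 0 \<or> \<not> A1 \<and> \<not> A2 \<and> D = int t2 + 1"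
    using D2 by blast
  then show ?thesis
    unfolding sum_agd D_def[symmetric] d s e
    unfolding k agd_decomp_split inf_coeff_Suc
    unfolding A1_A2_l2_def[symmetric] l1_def[symmetric]
    unfolding v[symmetric]
    by (elim disjE conjE; cases c; cases e; cases c1; cases c')
      (simp_all add: upper_label_def m1 m2 D1 k1 z, simp_all add: sg_add sg2 algebra_simps)
qed

section \<open>The coderivation with a given corestriction\<close>

lemma finite_splits: "finite (splits n)"
  by (rule finite_subset[of _ "{..n} \<times> {..n} \<times> {..n}"]) (auto simp: splits_def)

text \<open>The common index set of both sides of the coderivation property: an operation is applied to
  \<open>q\<close> inputs of a block that has \<open>p\<close> further inputs before and \<open>r\<close> after them, and \<open>w1\<close>, \<open>w2\<close> are
  the blocks on its left and right. The label \<open>c\<close> belongs to the block after the insertion.\<close>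

definition configurations :: "nat \<Rightarrow> ((agd \<times> nat) list \<times> agd \<times> nat \<times> nat \<times> nat \<times> (agd \<times> nat) list) set" where
  "configurations n = {(w1, c, p, q, r, w2). (pos w1) \<and> (pos w2) \<and> q \<ge> 1 \<and>
     wsum w1 + p + q + r + wsum w2 = n}"

text \<open>Position p of the concatenated blocks falls into one block, at offset p'. With the
  uniqueness below this identifies the block containing the output of an operation.\<close>

lemma split_word_at:
  "p < sum_list (map snd w) \<Longrightarrow>
    \<exists>w1 c i w2 p'. w = w1 @ (c, i) # w2 \<and> p = sum_list (map snd w1) + p' \<and> p' < i"
  for w :: "('b \<times> nat) list"
proof (induction w arbitrary: p)
  case (Cons a w)
  obtain c i where a: "a = (c, i)" by (cases a)
  show ?case
  proof (cases "p < i")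
    case True
    then have "a # w = [] @ (c, i) # w \<and> p = sum_list (map snd ([] :: ('b \<times> nat) list)) + p \<and> p < i" using a by simp
    then show ?thesis by blast
  next
    case False
    then obtain w1 c' i' w2 p' where "w = w1 @ (c', i') # w2" "p - i = sum_list (map snd w1) + p'" "p' < i'"
      using Cons.prems Cons.IH[of "p - i"] a by (auto simp: less_diff_conv2)
    then have "a # w = (a # w1) @ (c', i') # w2 \<and> p = sum_list (map snd (a # w1)) + p' \<and> p' < i'"
      using False a by simp
    then show ?thesis by blast
  qed
qed simp

lemma split_word_unique:
  fixes w1 v1 :: "('b \<times> nat) list"
  assumes "w1 @ (c, i) # w2 = v1 @ (b, j) # v2"
    and "sum_list (map snd w1) + p = sum_list (map snd v1) + p'" "p < i" "p' < j"
  shows "w1 = v1 \<and> c = b \<and> i = j \<and> w2 = v2 \<and> p = p'"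
  using assms
proof (induction w1 arbitrary: v1)
  case Nil
  then show ?case by (cases v1) auto
next
  case (Cons a w1)
  then show ?case by (cases v1) auto
qed

text \<open>The index set of \<Delta> (d x): an operation is applied first and the resulting list is
  cut afterwards. The marked block is the one that contains the output.\<close>

lemma sum_splits_words:
  fixes f :: "nat \<Rightarrow> nat \<Rightarrow> nat \<Rightarrow> (agd \<times> nat) list \<Rightarrow> 'b::comm_monoid_add"
  shows "(\<Sum>(p, q, r)\<in>splits n. \<Sum>w\<in>words (p + 1 + r). f p q r w) =
    (\<Sum>(w1, c, p, q, r, w2)\<in>configurations n.
      f (wsum w1 + p) q (r + wsum w2) (w1 @ (c, p + 1 + r) # w2))"
proof -
  define h :: "(agd \<times> nat) list \<times> agd \<times> nat \<times> nat \<times> nat \<times> (agd \<times> nat) list \<Rightarrow> _" where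
    "h = (\<lambda>(w1, c, p, q, r, w2). ((wsum w1 + p, q, r + wsum w2), w1 @ (c, p + 1 + r) # w2))"
  let ?S = "Sigma (splits n) (\<lambda>(p, q, r). words (p + 1 + r))"
  have bij: "bij_betw h (configurations n) ?S"
    unfolding bij_betw_def
  proof
    show "inj_on h (configurations n)"
    proof (rule inj_onI)
      fix x y assume "x \<in> configurations n" "y \<in> configurations n" and eq: "h x = h y"
      obtain w1 c p q r w2 v1 b p' q' r' v2 where xy: "x = (w1, c, p, q, r, w2)" "y = (v1, b, p', q', r', v2)"
        by (metis surj_pair)
      have "w1 = v1 \<and> c = b \<and> p + 1 + r = p' + 1 + r' \<and> w2 = v2 \<and> p = p'"
        by (rule split_word_unique) (use eq in \<open>auto simp: xy h_def\<close>)
      with eq show "x = y" by (auto simp: xy h_def)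
    qed
    show "h ` configurations n = ?S"
    proof
      show "h ` configurations n \<subseteq> ?S"
        by (auto simp: h_def configurations_def splits_def words_def)
      show "?S \<subseteq> h ` configurations n"
      proof
        fix x assume x: "x \<in> ?S"
        then obtain P q R w where xw: "x = ((P, q, R), w)" "(P, q, R) \<in> splits n" "w \<in> words (P + 1 + R)" by auto
        then have "P < wsum w" by (simp add: words_def)
        then obtain w1 c i w2 p where w: "w = w1 @ (c, i) # w2" "P = wsum w1 + p" "p < i"
          using split_word_at by blast
        then have R: "R = (i - Suc p) + wsum w2" "i = p + 1 + (i - Suc p)"
          using xw(3) by (auto simp: words_def)
        have "(w1, c, p, q, i - Suc p, w2) \<in> configurations n"
          using xw w R by (auto simp: configurations_def splits_def words_def)
        moreover have "h (w1, c, p, q, i - Suc p, w2) = x"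
          using w R by (simp add: h_def xw)
        ultimately show "x \<in> h ` configurations n" by (metis imageI)
      qed
    qed
  qed
  have "(\<Sum>(p, q, r)\<in>splits n. \<Sum>w\<in>words (p + 1 + r). f p q r w) =
      (\<Sum>t\<in>splits n. \<Sum>w\<in>(case t of (p, q, r) \<Rightarrow> words (p + 1 + r)). (case t of (p, q, r) \<Rightarrow> f p q r w))"
    by (rule sum.cong) auto
  also have "\<dots> = (\<Sum>(t, w)\<in>?S. case t of (p, q, r) \<Rightarrow> f p q r w)"
    by (rule sum.Sigma) (auto simp: finite_splits finite_words)
  also have "\<dots> = (\<Sum>x\<in>configurations n. case h x of (t, w) \<Rightarrow> case t of (p, q, r) \<Rightarrow> f p q r w)"
    by (rule sum.reindex_bij_betw[OF bij, symmetric])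
  also have "\<dots> = (\<Sum>(w1, c, p, q, r, w2)\<in>configurations n.
      f (wsum w1 + p) q (r + wsum w2) (w1 @ (c, p + 1 + r) # w2))"
    by (rule sum.cong) (auto simp: h_def)
  finally show ?thesis .
qed

text \<open>The index set of d (\<Delta> x): the list is cut first and an operation is applied
  inside one block. The label c' of that block before the insertion is not part of a configuration
  and stays a separate sum.\<close>

lemma sum_words_splits:
  fixes g :: "(agd \<times> nat) list \<Rightarrow> nat \<Rightarrow> nat \<Rightarrow> nat \<Rightarrow> nat \<Rightarrow> agd \<Rightarrow> 'b::comm_monoid_add"
  shows "(\<Sum>w\<in>words n. \<Sum>i<length w. \<Sum>(p, q, r)\<in>splits (snd (w ! i)). \<Sum>c\<in>UNIV. g w i p q r c) =
    (\<Sum>(w1, c, p, q, r, w2)\<in>configurations n. \<Sum>c'\<in>UNIV.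
      g (w1 @ (c', p + q + r) # w2) (length w1) p q r c)"
proof -
  define h :: "((agd \<times> nat) list \<times> agd \<times> nat \<times> nat \<times> nat \<times> (agd \<times> nat) list) \<times> agd \<Rightarrow> _" where
    "h = (\<lambda>((w1, c, p, q, r, w2), c'). (w1 @ (c', p + q + r) # w2, length w1, (p, q, r), c))"
  let ?S = "SIGMA w:words n. SIGMA i:{..<length w}. splits (snd (w ! i)) \<times> (UNIV :: agd set)"
  have bij: "bij_betw h (configurations n \<times> UNIV) ?S"
    unfolding bij_betw_def
  proof
    show "inj_on h (configurations n \<times> UNIV)"
      by (auto simp: inj_on_def h_def)
    show "h ` (configurations n \<times> UNIV) = ?S"
    proof
      show "h ` (configurations n \<times> UNIV) \<subseteq> ?S"
        by (auto simp: h_def configurations_def splits_def words_def)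
      show "?S \<subseteq> h ` (configurations n \<times> UNIV)"
      proof
        fix x assume "x \<in> ?S"
        then obtain w i p q r c where x: "x = (w, i, (p, q, r), c)" "w \<in> words n" "i < length w"
          "(p, q, r) \<in> splits (snd (w ! i))" by auto
        obtain c' l where l: "w ! i = (c', l)" by (cases "w ! i")
        have w: "w = take i w @ (c', p + q + r) # drop (Suc i) w"
          using id_take_nth_drop[OF x(3)] x(4) l by (simp add: splits_def)
        have "pos (take i w @ (c', p + q + r) # drop (Suc i) w)"
          "wsum (take i w @ (c', p + q + r) # drop (Suc i) w) = n"
          unfolding w[symmetric] using x(2) by (auto simp: words_def)
        then have m: "(take i w, c, p, q, r, drop (Suc i) w) \<in> configurations n"
          using x(4) by (auto simp: configurations_def splits_def)
        have hx: "x = h ((take i w, c, p, q, r, drop (Suc i) w), c')"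
          unfolding h_def x(1) using x(3) by (simp flip: w)
        show "x \<in> h ` (configurations n \<times> UNIV)"
          unfolding hx using m by (intro imageI SigmaI UNIV_I)
      qed
    qed
  qed
  \<comment> \<open>Finiteness is inherited from the iterated index set through the
    bijection.\<close>
  have fin: "finite (configurations n)"
  proof -
    have "finite ?S" by (intro finite_SigmaI finite_words) (auto simp: finite_splits)
    then have "finite (configurations n \<times> (UNIV :: agd set))"
      using bij_betw_finite[OF bij] by simp
    then show ?thesis by (auto simp: finite_cartesian_product_iff)
  qed
  let ?g = "\<lambda>(w, i, (p, q, r), c). g w i p q r c"
  have "(\<Sum>w\<in>words n. \<Sum>i<length w. \<Sum>(p, q, r)\<in>splits (snd (w ! i)). \<Sum>c\<in>UNIV. g w i p q r c) =
      (\<Sum>w\<in>words n. \<Sum>i<length w. \<Sum>t\<in>splits (snd (w ! i)) \<times> (UNIV :: agd set). ?g (w, i, t))"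
    by (intro sum.cong refl) (simp add: sum.cartesian_product' split_def)
  also have "\<dots> = (\<Sum>w\<in>words n. \<Sum>t\<in>(SIGMA i:{..<length w}. splits (snd (w ! i)) \<times> (UNIV :: agd set)). ?g (w, t))"
    by (rule sum.cong[OF refl], subst sum.Sigma) (auto simp: finite_splits split_def)
  also have "\<dots> = (\<Sum>x\<in>?S. ?g x)"
    by (subst sum.Sigma) (auto simp: finite_words finite_splits split_def)
  also have "\<dots> = (\<Sum>x\<in>configurations n \<times> UNIV. ?g (h x))"
    by (rule sum.reindex_bij_betw[OF bij, symmetric])
  also have "\<dots> = (\<Sum>x\<in>configurations n. \<Sum>c'\<in>UNIV. ?g (h (x, c')))"
    unfolding sum.cartesian_product by (rule sum.cong) auto
  also have "\<dots> = (\<Sum>(w1, c, p, q, r, w2)\<in>configurations n. \<Sum>c'\<in>UNIV.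
      g (w1 @ (c', p + q + r) # w2) (length w1) p q r c)"
    by (rule sum.cong) (auto simp: h_def)
  finally show ?thesis .
qed

text \<open>The tensors \<open>X b c\<close> do not involve the intermediate label a, which is
  therefore absorbed into the coefficient.\<close>

lemma sum_fscale_swap:
  fixes X :: "'b \<Rightarrow> 'c \<Rightarrow> 'x \<Rightarrow> 'k::field"
  shows "(\<Sum>a\<in>A. fscale (of_int (f a)) (\<Sum>b\<in>B. \<Sum>c\<in>E. fscale (of_int (g a b c)) (X b c))) =
    (\<Sum>b\<in>B. \<Sum>c\<in>E. fscale (of_int (\<Sum>a\<in>A. f a * g a b c)) (X b c))"
proof -
  have "(\<Sum>a\<in>A. fscale (of_int (f a)) (\<Sum>b\<in>B. \<Sum>c\<in>E. fscale (of_int (g a b c)) (X b c))) =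
      (\<Sum>a\<in>A. \<Sum>b\<in>B. \<Sum>c\<in>E. fscale (of_int (f a * g a b c)) (X b c))"
    by (simp add: fs.scale_sum_right)
  also have "\<dots> = (\<Sum>b\<in>B. \<Sum>a\<in>A. \<Sum>c\<in>E. fscale (of_int (f a * g a b c)) (X b c))"
    by (rule sum.swap)
  also have "\<dots> = (\<Sum>b\<in>B. \<Sum>c\<in>E. \<Sum>a\<in>A. fscale (of_int (f a * g a b c)) (X b c))"
    by (rule sum.cong[OF refl]) (rule sum.swap)
  finally show ?thesis by (simp only: of_int_sum fs.scale_sum_left)
qed

lemma sum_swap_inner:
  "(\<Sum>e\<in>A. \<Sum>t\<in>S. \<Sum>c\<in>B. F e t c) = (\<Sum>c\<in>B. \<Sum>e\<in>A. \<Sum>t\<in>S. F e t c)"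
proof -
  have "(\<Sum>e\<in>A. \<Sum>t\<in>S. \<Sum>c\<in>B. F e t c) = (\<Sum>e\<in>A. \<Sum>c\<in>B. \<Sum>t\<in>S. F e t c)"
    by (rule sum.cong[OF refl]) (rule sum.swap)
  also have "\<dots> = (\<Sum>c\<in>B. \<Sum>e\<in>A. \<Sum>t\<in>S. F e t c)" by (rule sum.swap)
  finally show ?thesis .
qed

section \<open>Extension of operations to a coderivation\<close>

locale corestriction = cofree s G
  for s :: "'k::field_char_0 \<Rightarrow> 'a::ab_group_add \<Rightarrow> 'a" and G :: "int \<Rightarrow> 'a set" +
  fixes D :: "agd \<Rightarrow> 'a list \<Rightarrow> 'a"
  assumes ops: "operations s G (if c = Mu then -2 else -1) (D c)"
begin

lemma D_mlin: "mlin s s UNIV n (D c)"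
  using ops[of c] by (auto simp: operations_def multilinear_on_iff_mlin)

text \<open>The degrees n - 2 of m and n - 1 of h and \<delta> are uniformly
  \<open>cdeg c n - 1\<close>: jointly the operations form a map C(A) \<rightarrow> A of degree
  -1.\<close>

lemma D_homogeneous:
  assumes "xs \<noteq> []" "homogeneous xs k"
  shows "D c xs \<in> G (k + (cdeg c (length xs) - 1))"
proof -
  from assms(2) obtain ds where "list_all2 (\<lambda>x d. x \<in> G d) xs ds" "sum_list ds = k"
    by (auto simp: homogeneous_def)
  with ops[of c] assms(1) have "D c xs \<in> G (k + int (length xs) + (if c = Mu then -2 else -1))"
    unfolding operations_def by blast
  then show ?thesis by (simp add: cdeg_def algebra_simps split: if_splits)
qed

lemma D_koszul:
  assumes "xs \<noteq> []"
  shows "D c (map (koszul G a) xs) = ksgn (a * (cdeg c (length xs) - 1)) (koszul G a (D c xs))"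
proof (rule mlin_homogeneous_eq[where f = "\<lambda>ys. D c (map (koszul G a) ys)" and
    g = "\<lambda>ys. ksgn (a * (cdeg c (length xs) - 1)) (koszul G a (D c ys))", OF _ _ vector_space_axioms _ subset_UNIV refl])
  show "mlin s s UNIV (length xs) (\<lambda>ys. D c (map (koszul G a) ys))"
    by (rule mlin_map[OF D_mlin koszul_linear UNIV_I])
  show "mlin s s UNIV (length xs) (\<lambda>ys. ksgn (a * (cdeg c (length xs) - 1)) (koszul G a (D c ys)))"
    by (rule mlin_ksgn[OF mlin_compose[OF D_mlin koszul_linear UNIV_I] vector_space_axioms])
  fix ys k assume ys: "length ys = length xs" "homogeneous ys k"
  then have "ys \<noteq> []" using assms by auto
  then have "koszul G a (D c ys) = ksgn (a * (k + (cdeg c (length xs) - 1))) (D c ys)"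
    using koszul_homogeneous[OF D_homogeneous[OF _ ys(2), of c]] ys(1) by simp
  then show "D c (map (koszul G a) ys) = ksgn (a * (cdeg c (length xs) - 1)) (koszul G a (D c ys))"
    using mlin_koszul_homogeneous[OF D_mlin vector_space_axioms ys(2)]
    by (auto simp: ksgn_ksgn algebra_simps intro!: ksgn_cong)
qed

text \<open>The p inputs on the left are passed by the label e of degree \<open>cdeg e q\<close>,
  split off by \<Delta>_(1), and by the map D of degree -1.\<close>

definition insert_D :: "agd \<Rightarrow> nat \<Rightarrow> nat \<Rightarrow> 'a list \<Rightarrow> 'a list" where
  "insert_D e p q xs = map (koszul G (cdeg e q - 1)) (take p xs) @ D e (take q (drop p xs)) # drop (p + q) xs"

text \<open>The factor \<open>sg (cdeg c0 (p + 1 + r))\<close> is the sign for moving D, of degree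
  -1, past the lower label.\<close>

definition ext :: "agd \<Rightarrow> 'a list \<Rightarrow> ('k, 'a) cof" where
  "ext c xs = (\<Sum>e\<in>UNIV. \<Sum>(p, q, r)\<in>splits (length xs). \<Sum>c0\<in>UNIV.
     fscale (of_int (inf_coeff c c0 p e q r * sg (cdeg c0 (p + 1 + r)))) (P c0 (insert_D e p q xs)))"

definition d :: "('k, 'a) cof \<Rightarrow> ('k, 'a) cof" where
  "d = cof_lift ext"

lemma insert_D_mlin: "mlin s fscale UNIV (p + q + r) (\<lambda>xs. P c0 (insert_D e p q xs))"
  unfolding insert_D_def
  by (rule mlin_comp_append[OF pure_mlin vector_space_fscale vector_space_axioms subV koszul_linear _ D_mlin]) auto

lemma ext_mlin: "mlin s fscale UNIV n (ext c)"
proof (rule iffD1[OF mlin_cong[OF subV module_axioms]])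
  have "mlin s fscale UNIV n (\<lambda>xs. \<Sum>c0\<in>UNIV.
      fscale (of_int (inf_coeff c c0 p e q r * sg (cdeg c0 (p + 1 + r)))) (P c0 (insert_D e p q xs)))"
    if "(p, q, r) \<in> splits n" for e p q r
    using that insert_D_mlin[of p q r]
    by (intro mlin_sum vector_space_fscale mlin_fscale) (auto simp: splits_def)
  then show "mlin s fscale UNIV n (\<lambda>xs. \<Sum>e\<in>UNIV. \<Sum>(p, q, r)\<in>splits n. \<Sum>c0\<in>UNIV.
      fscale (of_int (inf_coeff c c0 p e q r * sg (cdeg c0 (p + 1 + r)))) (P c0 (insert_D e p q xs)))"
    by (intro mlin_sum vector_space_fscale) auto
qed (simp add: ext_def)

lemma d_pure: "d (P c xs) = ext c xs"
  unfolding d_def by (rule cof_lift_pure'[OF ext_mlin])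

lemma linear_on_d: "linear_on fscale fscale S d"
  unfolding d_def by (rule linear_on_cof_lift)

lemma insert_D_nonempty [simp]: "insert_D e p q xs \<noteq> []"
  by (simp add: insert_D_def)

text \<open>Membership is asked for nonzero coefficients only, because degrees are known to add up
  just for these.\<close>

lemma ext_term_in:
  assumes "\<And>e p q r c0. (p, q, r) \<in> splits (length xs) \<Longrightarrow> inf_coeff c c0 p e q r \<noteq> 0 \<Longrightarrow>
      P c0 (insert_D e p q xs) \<in> S" "fs.subspace S"
  shows "ext c xs \<in> S"
proof -
  have "fscale (of_int (inf_coeff c c0 p e q r * sg (cdeg c0 (p + 1 + r)))) (P c0 (insert_D e p q xs)) \<in> S"
    if "(p, q, r) \<in> splits (length xs)" for e p q r c0
  proof (cases "inf_coeff c c0 p e q r = 0")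
    case False
    then show ?thesis using assms(1)[OF that] fs.subspace_scale[OF assms(2)] by blast
  qed (use fs.subspace_0[OF assms(2)] in simp)
  then show ?thesis
    unfolding ext_def by (intro fs.subspace_sum[OF assms(2)]) (auto intro!: fs.subspace_sum[OF assms(2)])
qed

lemma d_in: "x \<in> C \<Longrightarrow> d x \<in> C"
proof (rule cof_linear_in[where f = d, OF linear_on_d vector_space_fscale subC])
  show "d (P c xs) \<in> C" for c xs
    unfolding d_pure by (rule ext_term_in[OF pure_in subC]) auto
qed

lemma d_homogeneous: "x \<in> GC k \<Longrightarrow> d x \<in> GC (k + (-1))"
proof (rule cof_homogeneous_in[where f = d, OF linear_on_d vector_space_fscale subGC])
  fix c xs assume xs: "xs \<noteq> []" "homogeneous xs (k - cdeg c (length xs))"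
  show "d (P c xs) \<in> GC (k + (-1))"
    unfolding d_pure
  proof (rule ext_term_in[OF _ subGC])
    fix e p q r c0 assume s: "(p, q, r) \<in> splits (length xs)" and i: "inf_coeff c c0 p e q r \<noteq> 0"
    then have pq: "p + q + r = length xs" "q \<ge> 1" by (auto simp: splits_def)
    have "homogeneous (take p xs @ take q (drop p xs) @ drop (p + q) xs) (k - cdeg c (length xs))"
      using xs(2) by (metis add.commute append_take_drop_id drop_drop)
    then obtain k1 k2 k3 where k: "homogeneous (take p xs) k1" "homogeneous (take q (drop p xs)) k2"
        "homogeneous (drop (p + q) xs) k3" "k3 = k - cdeg c (length xs) - k1 - k2"
      by (auto simp: homogeneous_append)
    have len: "length (take q (drop p xs)) = q" using pq by simp
    then have ne: "take q (drop p xs) \<noteq> []" using pq(2) by force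
    have "homogeneous (D e (take q (drop p xs)) # drop (p + q) xs)
        (k2 + (cdeg e q - 1) + k3)"
      unfolding homogeneous_Cons
      by (rule exI[of _ "k2 + (cdeg e q - 1)"]) (use D_homogeneous[OF ne k(2), of e] k(3) len in simp)
    then have "homogeneous (insert_D e p q xs) (k1 + (k2 + (cdeg e q - 1) + k3))"
      unfolding insert_D_def homogeneous_append
      by (intro exI[of _ k1]) (use homogeneous_koszul[OF k(1), of "cdeg e q - 1"] in simp)
    moreover have "length (insert_D e p q xs) = p + 1 + r" using pq by (simp add: insert_D_def)
    ultimately have "P c0 (insert_D e p q xs) \<in> GC (cdeg c0 (p + 1 + r) +
        (k1 + (k2 + (cdeg e q - 1) + k3)))"
      using pure_homogeneous[OF insert_D_nonempty] by metis
    moreover have "cdeg c (length xs) = cdeg c0 (p + 1 + r) + cdeg e q"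
      using inf_coeff_degree[OF i pq(2)] pq(1) by simp
    ultimately show "P c0 (insert_D e p q xs) \<in> GC (k + (-1))" by (simp add: k(4) algebra_simps)
  qed
qed

text \<open>Moving d past the blocks of w1 gives \<open>wdeg w1\<close>; taking the operator of
  exponent \<open>wdeg w2\<close> out of D e gives the other summand. On the inputs of w1 the
  exponents \<open>cdeg c (p + q + r) + wdeg w2 - 1\<close> and
  \<open>cdeg c' (p + 1 + r) + wdeg w2 + (cdeg e q - 1)\<close> agree by the degree
  hypothesis.\<close>

lemma slot_blocks:
  assumes pos: "pos w1" "pos w2" and q: "q \<ge> 1" and n: "wsum w1 + p + q + r + wsum w2 = length xs"
    and deg: "cdeg c (p + q + r) = cdeg c' (p + 1 + r) + cdeg e q"
  defines "mid \<equiv> take (p + q + r) (drop (wsum w1) xs)"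
  shows "C.P c1 (map (koszul GC (-1)) (blocks s UNIV G w1 (map (koszul G (cdeg c (p + q + r) + wdeg w2)) (take (wsum w1) xs))) @
      P c' (insert_D e p q (map (koszul G (wdeg w2)) mid)) # blocks s UNIV G w2 (drop (wsum w1 + (p + q + r)) xs)) =
    ksgn (wdeg w1 + wdeg w2 * (cdeg e q - 1))
      (C.P c1 (blocks s UNIV G (w1 @ (c', p + 1 + r) # w2) (insert_D e (wsum w1 + p) q xs)))"
proof -
  define x1 x2 where "x1 = take (wsum w1) xs" and "x2 = drop (wsum w1 + (p + q + r)) xs"
  define u v z where "u = take p mid" and "v = take q (drop p mid)" and "z = drop (p + q) mid"
  have mid: "mid = u @ v @ z" unfolding u_def v_def z_def by (metis add.commute append_take_drop_id drop_drop)
  have xs: "xs = x1 @ u @ v @ z @ x2"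
    using mid unfolding x1_def x2_def mid_def by (metis add.commute append.assoc append_take_drop_id drop_drop)
  have len: "wsum w1 = length x1" "p = length u" "q = length v" "r = length z" "wsum w2 = length x2"
    using n by (simp_all add: x1_def x2_def u_def v_def z_def mid_def)
  have "v \<noteq> []" using q len by auto
  let ?a = "cdeg e q - 1" and ?K = "koszul G"
  have mid1: "insert_D e p q (map (?K (wdeg w2)) mid) =
      map (?K (wdeg w2 + ?a)) u @ D e (map (?K (wdeg w2)) v) # map (?K (wdeg w2)) z"
    unfolding mid insert_D_def len by (simp add: koszul_koszul add.commute)
  have D: "D e (map (?K (wdeg w2)) v) = ksgn (wdeg w2 * ?a) (?K (wdeg w2) (D e v))"
    using D_koszul[OF \<open>v \<noteq> []\<close>] len by simp
  let ?m = "map (?K (wdeg w2 + ?a)) u @ ?K (wdeg w2) (D e v) # map (?K (wdeg w2)) z"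
  interpret L: linear_on_sp s fscale UNIV "\<lambda>y. P c' (map (?K (wdeg w2 + ?a)) u @ y # map (?K (wdeg w2)) z)"
    by (rule linear_on_sp.intro[OF vector_space_axioms vector_space_fscale subV mlinD[OF pure_mlin]]) auto
  have mid2: "P c' (insert_D e p q (map (?K (wdeg w2)) mid)) = ksgn (wdeg w2 * ?a) (P c' ?m)"
    unfolding mid1 D by (rule L.ksgn[OF UNIV_I])
  let ?b = "cdeg c (p + q + r) + wdeg w2"
  let ?B1 = "blocks s UNIV G w1 (map (?K (-1)) (map (?K ?b) x1))"
  let ?B2 = "blocks s UNIV G w2 x2"
  have B2: "set ?B2 \<subseteq> C" by (rule blocks_in) (use pos len in auto)
  have B1: "set ?B1 \<subseteq> C" by (rule blocks_in) (use pos len in auto)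
  have m: "P c' ?m \<in> C" by (rule pure_in) auto
  interpret M: linear_on_sp fscale fscale C "\<lambda>y. C.P c1 (?B1 @ y # ?B2)"
    by (rule linear_on_sp.intro[OF vector_space_fscale vector_space_fscale subC mlinD[OF C.pure_mlin]])
      (use B1 B2 in auto)
  have "C.P c1 ([] @ map (koszul GC (-1)) (blocks s UNIV G w1 (map (?K ?b) x1)) @
      (ksgn (wdeg w2 * ?a) (P c' ?m) # ?B2)) =
      ksgn (-1 * wdeg w1) (C.P c1 ([] @ ?B1 @ (ksgn (wdeg w2 * ?a) (P c' ?m) # ?B2)))"
    by (rule koszul_blocks[OF C.pure_mlin vector_space_fscale pos(1)])
      (use len B2 fs.subspace_ksgn[OF subC m] in auto)
  also have "C.P c1 ([] @ ?B1 @ (ksgn (wdeg w2 * ?a) (P c' ?m) # ?B2)) = ksgn (wdeg w2 * ?a) (C.P c1 (?B1 @ P c' ?m # ?B2))"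
    using M.ksgn[OF m] by simp
  also have "?B1 @ P c' ?m # ?B2 = blocks s UNIV G (w1 @ (c', p + 1 + r) # w2) (insert_D e (wsum w1 + p) q xs)"
  proof -
    have Y: "insert_D e (wsum w1 + p) q xs = map (?K ?a) x1 @ (map (?K ?a) u @ D e v # z @ x2)"
      unfolding insert_D_def xs len by simp
    have t: "take (wsum w1) (map (?K ?a) x1 @ (map (?K ?a) u @ D e v # z @ x2)) = map (?K ?a) x1"
      "drop (wsum w1) (map (?K ?a) x1 @ (map (?K ?a) u @ D e v # z @ x2)) = map (?K ?a) u @ D e v # z @ x2"
      by (simp_all add: len(1))
    have "map (?K (cdeg c' (p + 1 + r) + wdeg w2)) (map (?K ?a) x1) = map (?K (-1)) (map (?K ?b) x1)"
      unfolding map_koszul_koszul[OF subset_UNIV] deg by (simp add: algebra_simps)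
    moreover have "blocks s UNIV G ((c', p + 1 + r) # w2) (map (?K ?a) u @ D e v # z @ x2) = P c' ?m # ?B2"
      by (simp add: len map_koszul_koszul del: map_map)
    ultimately show ?thesis
      unfolding Y by (subst blocks_append) (use len in \<open>auto simp: t simp del: map_map blocks.simps\<close>)
  qed
  finally show ?thesis
    unfolding mid2 x1_def[symmetric] x2_def[symmetric] by (simp add: ksgn_def)
qed

text \<open>Each term of d inside a block becomes a list of blocks of one list of elements of A with
  an operation inserted. These are the tensors that also occur in \<Delta> (d x).\<close>

lemma slot_expand:
  fixes w1 w2 :: "(agd \<times> nat) list" and c :: agd and l :: nat and xs :: "'a list"
  defines "w \<equiv> w1 @ (c, l) # w2"
  assumes w: "w \<in> words (length xs)"
  shows "C.P c1 (slot (-1) d (length w1) (blocks s UNIV G w xs)) =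
    (\<Sum>e\<in>UNIV. \<Sum>(p, q, r)\<in>splits l. \<Sum>c'\<in>UNIV.
      fscale (of_int (inf_coeff c c' p e q r * sg (cdeg c' (p + 1 + r)) * sg (wdeg w1 + wdeg w2 * (cdeg e q - 1))))
      (C.P c1 (blocks s UNIV G (w1 @ (c', p + 1 + r) # w2) (insert_D e (wsum w1 + p) q xs))))"
proof -
  have pos: "pos w1" "pos w2" "l \<ge> 1" and n: "wsum w1 + l + wsum w2 = length xs"
    using w by (auto simp: w_def words_def)
  define B1 where "B1 = map (koszul GC (-1)) (blocks s UNIV G w1 (map (koszul G (cdeg c l + wdeg w2)) (take (wsum w1) xs)))"
  define mid where "mid = map (koszul G (wdeg w2)) (take l (drop (wsum w1) xs))"
  define B2 where "B2 = blocks s UNIV G w2 (drop (wsum w1 + l) xs)"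
  have "blocks s UNIV G w xs = blocks s UNIV G w1 (map (koszul G (cdeg c l + wdeg w2)) (take (wsum w1) xs)) @ P c mid # B2"
    unfolding w_def mid_def B2_def by (subst blocks_append) (use n in \<open>auto simp: add.commute\<close>)
  then have slot: "slot (-1) d (length w1) (blocks s UNIV G w xs) = B1 @ d (P c mid) # B2"
    by (simp add: slot_def nth_append B1_def)
  have len: "length mid = l" using n by (simp add: mid_def)
  have "set (blocks s UNIV G w1 (map (koszul G (cdeg c l + wdeg w2)) (take (wsum w1) xs))) \<subseteq> C"
    by (rule blocks_in) (use pos n in auto)
  then have B1: "set B1 \<subseteq> C" unfolding B1_def by (rule C.set_map_koszul)
  have B2: "set B2 \<subseteq> C" unfolding B2_def by (rule blocks_in) (use pos n in auto)
  interpret M: linear_on_sp fscale fscale C "\<lambda>y. C.P c1 (B1 @ y # B2)"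
    by (rule linear_on_sp.intro[OF vector_space_fscale vector_space_fscale subC mlinD[OF C.pure_mlin B1 B2 refl]])
  have in_C: "P c' (insert_D e p q mid) \<in> C" "fscale a (P c' (insert_D e p q mid)) \<in> C" for a c' e p q
    by (auto intro!: fs.subspace_scale[OF subC] pure_in)
  have "C.P c1 (B1 @ d (P c mid) # B2) = (\<Sum>e\<in>UNIV. \<Sum>t\<in>splits l. case t of (p, q, r) \<Rightarrow> \<Sum>c'\<in>UNIV.
      fscale (of_int (inf_coeff c c' p e q r * sg (cdeg c' (p + 1 + r)))) (C.P c1 (B1 @ P c' (insert_D e p q mid) # B2)))"
    unfolding d_pure ext_def len split_def
    by (simp add: M.sum M.scale in_C fs.subspace_sum[OF subC])
  also have "\<dots> = (\<Sum>e\<in>UNIV. \<Sum>(p, q, r)\<in>splits l. \<Sum>c'\<in>UNIV.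
      fscale (of_int (inf_coeff c c' p e q r * sg (cdeg c' (p + 1 + r)) * sg (wdeg w1 + wdeg w2 * (cdeg e q - 1))))
      (C.P c1 (blocks s UNIV G (w1 @ (c', p + 1 + r) # w2) (insert_D e (wsum w1 + p) q xs))))"
  proof (intro sum.cong refl, clarify, intro sum.cong refl)
    fix e p q r c' assume "(p, q, r) \<in> splits l"
    then have q: "q \<ge> 1" "p + q + r = l" by (auto simp: splits_def)
    show "fscale (of_int (inf_coeff c c' p e q r * sg (cdeg c' (p + 1 + r)))) (C.P c1 (B1 @ P c' (insert_D e p q mid) # B2)) =
      fscale (of_int (inf_coeff c c' p e q r * sg (cdeg c' (p + 1 + r)) * sg (wdeg w1 + wdeg w2 * (cdeg e q - 1))))
      (C.P c1 (blocks s UNIV G (w1 @ (c', p + 1 + r) # w2) (insert_D e (wsum w1 + p) q xs)))"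
    \<comment> \<open>The degree equation required by \<open>slot_blocks\<close> is available for
      nonzero coefficients; otherwise both sides vanish.\<close>
    proof (cases "inf_coeff c c' p e q r = 0")
      case False
      have "wsum w1 + p + q + r + wsum w2 = length xs" using n q by simp
      from slot_blocks[OF pos(1,2) q(1) this inf_coeff_degree[OF False q(1)], of c1]
      show ?thesis unfolding q(2) B1_def B2_def mid_def by (simp only: ksgn_fscale fs.scale_scale of_int_mult)
    qed simp
  qed
  finally show ?thesis unfolding slot .
qed

text \<open>Both sides are written as sums over configurations of the same tensors
  \<open>?Z\<close>, with coefficients \<open>?L\<close> and \<open>?R\<close>. Their equality is
  \<open>inf_coeff_coassoc\<close> together with a comparison of Koszul signs.\<close>

lemma d_coderivation_pure: "\<Delta> (d (P c xs)) = deriv (-1) d (\<Delta> (P c xs))"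
proof -
  let ?n = "length xs"
  interpret Dl: linear_on_sp fscale fscale UNIV \<Delta>
    by (intro linear_on_sp.intro vector_space_fscale fs.subspace_UNIV) (simp add: cof_decomp_eq linear_on_cof_lift)
  interpret Dv: linear_on_sp fscale fscale UNIV "deriv (-1) d"
    by (intro linear_on_sp.intro vector_space_fscale fs.subspace_UNIV linear_on_deriv)
  let ?Z = "\<lambda>c1 e w1 c' p q r w2. C.P c1 (blocks s UNIV G (w1 @ (c', p + 1 + r) # w2) (insert_D e (wsum w1 + p) q xs))"
  let ?L = "\<lambda>c1 e w1 c' p q r w2. \<Sum>c0\<in>UNIV. inf_coeff c c0 (wsum w1 + p) e q (r + wsum w2) *
      sg (cdeg c0 (wsum w1 + p + 1 + (r + wsum w2))) * agd_decomp c0 c1 (w1 @ (c', p + 1 + r) # w2)"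
  let ?R = "\<lambda>c1 e w1 c' p q r w2. \<Sum>c''\<in>UNIV. agd_decomp c c1 (w1 @ (c'', p + q + r) # w2) *
      sg (cdeg c1 (length w1 + 1 + length w2)) * (inf_coeff c'' c' p e q r * sg (cdeg c' (p + 1 + r))) *
      sg (wdeg w1 + wdeg w2 * (cdeg e q - 1))"
  have len: "length (insert_D e p q xs) = p + 1 + r" if "(p, q, r) \<in> splits ?n" for e p q r
    using that by (auto simp: insert_D_def splits_def)
  have "\<Delta> (d (P c xs)) = (\<Sum>e\<in>UNIV. \<Sum>(p, q, r)\<in>splits ?n. \<Sum>c0\<in>UNIV.
     fscale (of_int (inf_coeff c c0 p e q r * sg (cdeg c0 (p + 1 + r)))) (\<Sum>c1\<in>UNIV. \<Sum>w\<in>words (p + 1 + r).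
     fscale (of_int (agd_decomp c0 c1 w)) (C.P c1 (blocks s UNIV G w (insert_D e p q xs)))))"
    unfolding d_pure ext_def
    by (auto simp: Dl.sum Dl.scale cof_decomp_pure len split_def intro!: sum.cong)
  also have "\<dots> = (\<Sum>e\<in>UNIV. \<Sum>(p, q, r)\<in>splits ?n. \<Sum>c1\<in>UNIV. \<Sum>w\<in>words (p + 1 + r). 
     fscale (of_int (\<Sum>c0\<in>UNIV. inf_coeff c c0 p e q r * sg (cdeg c0 (p + 1 + r)) * agd_decomp c0 c1 w))
       (C.P c1 (blocks s UNIV G w (insert_D e p q xs))))"
    unfolding sum_fscale_swap ..
  also have "\<dots> = (\<Sum>c1\<in>UNIV. \<Sum>e\<in>UNIV. \<Sum>(p, q, r)\<in>splits ?n. \<Sum>w\<in>words (p + 1 + r). 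
     fscale (of_int (\<Sum>c0\<in>UNIV. inf_coeff c c0 p e q r * sg (cdeg c0 (p + 1 + r)) * agd_decomp c0 c1 w))
       (C.P c1 (blocks s UNIV G w (insert_D e p q xs))))"
    unfolding split_def by (rule sum_swap_inner)
  also have "\<dots> = (\<Sum>c1\<in>UNIV. \<Sum>e\<in>UNIV. \<Sum>(w1, c', p, q, r, w2)\<in>configurations ?n.
      fscale (of_int (?L c1 e w1 c' p q r w2)) (?Z c1 e w1 c' p q r w2))"
    unfolding sum_splits_words ..
  also have "\<dots> = (\<Sum>c1\<in>UNIV. \<Sum>e\<in>UNIV. \<Sum>(w1, c', p, q, r, w2)\<in>configurations ?n.
      fscale (of_int (?R c1 e w1 c' p q r w2)) (?Z c1 e w1 c' p q r w2))"
  proof (intro sum.cong refl, clarify)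
    fix c1 e w1 c' p q r w2 assume "(w1, c', p, q, r, w2) \<in> configurations ?n"
    then have conf: "pos w1" "pos w2" "q \<ge> 1" by (auto simp: configurations_def)
    let ?w = "w1 @ (c', p + 1 + r) # w2"
    \<comment> \<open>Since \<Delta> preserves degrees, the sign of c0 equals this one whenever the
      coefficient is nonzero. It is independent of c0 and leaves the sum.\<close>
    let ?s = "sg (cdeg c1 (length ?w) + wdeg ?w)"
    have "?L c1 e w1 c' p q r w2 = (\<Sum>c0\<in>UNIV. inf_coeff c c0 (wsum w1 + p) e q (r + wsum w2) *
        agd_decomp c0 c1 ?w) * ?s"
      unfolding sum_distrib_right
    proof (rule sum.cong[OF refl])
      fix c0
      show "inf_coeff c c0 (wsum w1 + p) e q (r + wsum w2) * sg (cdeg c0 (wsum w1 + p + 1 + (r + wsum w2))) *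
          agd_decomp c0 c1 ?w = inf_coeff c c0 (wsum w1 + p) e q (r + wsum w2) * agd_decomp c0 c1 ?w * ?s"
      proof (cases "agd_decomp c0 c1 ?w = 0")
        case False
        have "wsum ?w = wsum w1 + p + 1 + (r + wsum w2)" by simp
        moreover have "pos ?w" using conf by auto
        ultimately show ?thesis using agd_decomp_degree[OF False] by (simp add: add.assoc)
      qed simp
    qed
    also have "\<dots> = (\<Sum>c''\<in>UNIV. agd_decomp c c1 (w1 @ (c'', p + q + r) # w2) * inf_coeff c'' c' p e q r) *
        (sg (wdeg w2 * cdeg e q) * ?s)"
      unfolding inf_coeff_coassoc[OF conf] by (simp only: mult.assoc)
    also have "sg (wdeg w2 * cdeg e q) * ?s = sg (cdeg c1 (length w1 + 1 + length w2)) *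
        sg (cdeg c' (p + 1 + r)) * sg (wdeg w1 + wdeg w2 * (cdeg e q - 1))"
      by (simp add: sg_add sg_diff right_diff_distrib left_diff_distrib mult.commute mult.left_commute)
    also have "(\<Sum>c''\<in>UNIV. agd_decomp c c1 (w1 @ (c'', p + q + r) # w2) * inf_coeff c'' c' p e q r) * \<dots> =
        ?R c1 e w1 c' p q r w2"
      unfolding sum_distrib_right by (rule sum.cong) (auto simp: mult_ac)
    finally show "fscale (of_int (?L c1 e w1 c' p q r w2)) (?Z c1 e w1 c' p q r w2) =
        fscale (of_int (?R c1 e w1 c' p q r w2)) (?Z c1 e w1 c' p q r w2)" by (rule arg_cong)
  qed
  also have "\<dots> = (\<Sum>c1\<in>UNIV. \<Sum>e\<in>UNIV. \<Sum>w\<in>words ?n. \<Sum>i<length w. \<Sum>(p, q, r)\<in>splits (snd (w ! i)). \<Sum>c'\<in>UNIV.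
      fscale (of_int (agd_decomp c c1 w * sg (cdeg c1 (length w)) *
        (inf_coeff (fst (w ! i)) c' p e q r * sg (cdeg c' (p + 1 + r))) *
        sg (wdeg (take i w) + wdeg (drop (Suc i) w) * (cdeg e q - 1))))
       (?Z c1 e (take i w) c' p q r (drop (Suc i) w)))"
    unfolding sum_words_splits of_int_sum fs.scale_sum_left by simp
  also have "\<dots> = (\<Sum>c1\<in>UNIV. \<Sum>w\<in>words ?n. \<Sum>i<length w. \<Sum>e\<in>UNIV. \<Sum>(p, q, r)\<in>splits (snd (w ! i)). \<Sum>c'\<in>UNIV.
      fscale (of_int (agd_decomp c c1 w * sg (cdeg c1 (length w)) *
        (inf_coeff (fst (w ! i)) c' p e q r * sg (cdeg c' (p + 1 + r))) *
        sg (wdeg (take i w) + wdeg (drop (Suc i) w) * (cdeg e q - 1))))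
       (?Z c1 e (take i w) c' p q r (drop (Suc i) w)))"
    by (rule sum.cong[OF refl], subst sum.swap, rule sum.cong[OF refl], rule sum.swap)
  also have "\<dots> = (\<Sum>c1\<in>UNIV. \<Sum>w\<in>words ?n. fscale (of_int (agd_decomp c c1 w))
      (\<Sum>i<length w. ksgn (- 1 * cdeg c1 (length w)) (C.P c1 (slot (-1) d i (blocks s UNIV G w xs)))))"
    unfolding fs.scale_sum_right
  proof (intro sum.cong refl)
    fix c1 w i assume w: "w \<in> words ?n" and i: "i \<in> {..<length w}"
    have eq: "take i w @ (fst (w ! i), snd (w ! i)) # drop (Suc i) w = w" and len: "length (take i w) = i"
      using i id_take_nth_drop[of i w] by auto
    show "(\<Sum>e\<in>UNIV. \<Sum>(p, q, r)\<in>splits (snd (w ! i)). \<Sum>c'\<in>UNIV.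
        fscale (of_int (agd_decomp c c1 w * sg (cdeg c1 (length w)) *
          (inf_coeff (fst (w ! i)) c' p e q r * sg (cdeg c' (p + 1 + r))) *
          sg (wdeg (take i w) + wdeg (drop (Suc i) w) * (cdeg e q - 1))))
        (?Z c1 e (take i w) c' p q r (drop (Suc i) w))) =
      fscale (of_int (agd_decomp c c1 w)) (ksgn (- 1 * cdeg c1 (length w)) (C.P c1 (slot (-1) d i (blocks s UNIV G w xs))))"
      using slot_expand[of "take i w" "fst (w ! i)" "snd (w ! i)" "drop (Suc i) w" xs c1]
      unfolding eq len using w
      by (simp add: ksgn_fscale fs.scale_sum_right split_def mult_ac del: length_take)
  qed
  also have "\<dots> = deriv (-1) d (\<Delta> (P c xs))"
    by (simp add: cof_decomp_pure Dv.sum Dv.scale deriv_pure[OF linear_on_d d_in])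
  finally show ?thesis .
qed

lemma coder_d: "coder (-1) d"
proof -
  have "\<Delta> (d x) = deriv (-1) d (\<Delta> x)" if "x \<in> C" for x
  proof (rule cof_linear_eq[where f = "\<lambda>x. \<Delta> (d x)" and g = "\<lambda>x. deriv (-1) d (\<Delta> x)", OF _ _ vector_space_fscale _ that])
    show "linear_on fscale fscale C (\<lambda>x. \<Delta> (d x))"
      unfolding cof_decomp_eq by (rule linear_on_compose[OF linear_on_d linear_on_cof_lift UNIV_I])
    show "linear_on fscale fscale C (\<lambda>x. deriv (-1) d (\<Delta> x))"
      unfolding cof_decomp_eq by (rule linear_on_compose[OF linear_on_cof_lift linear_on_deriv UNIV_I])
  qed (rule d_coderivation_pure)
  then show ?thesis by (simp add: coder_def linear_on_d d_in)
qed

end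

section \<open>The corestriction of the square and the defining relations\<close>

context corestriction
begin

text \<open>Two choices of f are needed: the projection, which recovers D, and the projection after
  d, which yields the corestriction of the square.\<close>

lemma cof_proj_ext_sum:
  assumes "f = cof_proj s \<or> f = (\<lambda>x. cof_proj s (d x))"
  shows "f (ext c xs) = (\<Sum>(p, q, r)\<in>splits (length xs). \<Sum>e\<in>UNIV. \<Sum>c0\<in>UNIV.
     s (of_int (inf_coeff c c0 p e q r * sg (cdeg c0 (p + 1 + r)))) (f (P c0 (insert_D e p q xs))))"
proof -
  have "linear_on fscale s C f"
    using assms cof_proj_linear linear_on_compose[OF linear_on_d cof_proj_linear d_in] by auto
  then interpret F: linear_on_sp fscale s C f
    by (intro linear_on_sp.intro vector_space_fscale vector_space_axioms subC)
  have in_C: "P c0 (insert_D e p q xs) \<in> C" for c0 e p q by (rule pure_in) auto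
  have "f (ext c xs) = (\<Sum>e\<in>UNIV. \<Sum>t\<in>splits (length xs). \<Sum>c0\<in>UNIV.
      s (of_int (inf_coeff c c0 (fst t) e (fst (snd t)) (snd (snd t)) * sg (cdeg c0 (fst t + 1 + snd (snd t)))))
        (f (P c0 (insert_D e (fst t) (fst (snd t)) xs))))"
    unfolding ext_def split_def
    by (simp add: F.sum F.scale in_C fs.subspace_sum[OF subC] fs.subspace_scale[OF subC])
  then show ?thesis unfolding split_def by (subst sum.swap)
qed

text \<open>The projection sees only results of arity one with label \<open>Mu\<close>, hence the
  splitting (0, n, 0). There e must be c, the coefficient is 1, and \<mu>^c_1 has degree 0, so no
  sign appears.\<close>

lemma cof_proj_d_pure:
  assumes "xs \<noteq> []"
  shows "cof_proj s (d (P c xs)) = D c xs"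
proof -
  let ?n = "length xs"
  obtain k where k: "?n = Suc k" using assms by (cases ?n) auto
  have "cof_proj s (d (P c xs)) = (\<Sum>(p, q, r)\<in>splits ?n. \<Sum>e\<in>UNIV. \<Sum>c0\<in>UNIV.
     s (of_int (inf_coeff c c0 p e q r * sg (cdeg c0 (p + 1 + r)))) (cof_proj s (P c0 (insert_D e p q xs))))"
    unfolding d_pure by (rule cof_proj_ext_sum) simp
  also have "\<dots> = (\<Sum>t\<in>splits ?n. if t = (0, ?n, 0) then D c xs else 0)"
  proof (intro sum.cong refl, clarify)
    fix p q r assume t: "(p, q, r) \<in> splits ?n"
    then have len: "length (insert_D e p q xs) = p + 1 + r" for e by (auto simp: insert_D_def splits_def)
    show "(\<Sum>e\<in>UNIV. \<Sum>c0\<in>UNIV.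
       s (of_int (inf_coeff c c0 p e q r * sg (cdeg c0 (p + 1 + r)))) (cof_proj s (P c0 (insert_D e p q xs)))) =
       (if (p, q, r) = (0, ?n, 0) then D c xs else 0)"
    proof (cases "p = 0 \<and> r = 0")
      case True
      with t have "q = ?n" by (simp add: splits_def)
      with True show ?thesis
        by (cases c) (simp_all add: sum_agd cof_proj_pure inf_coeff_Suc k cdeg_def upper_label_def, simp_all add: insert_D_def k[symmetric])
    next
      case False
      then show ?thesis using t by (auto simp: cof_proj_pure len)
    qed
  qed
  also have "\<dots> = D c xs" using k by (simp add: finite_splits) (simp add: splits_def)
  finally show ?thesis .
qed

definition defect :: "agd \<Rightarrow> 'a list \<Rightarrow> 'a" where
  "defect c xs = cof_proj s (d (d (P c xs)))"

lemma D_insert_D: "D c0 (insert_D e p q xs) = pcomp G (D c0) p (D e) (int q - (if e = Mu then 2 else 1)) q xs"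
  by (simp add: pcomp_def insert_D_def cdeg_def)

lemma defect_eq: "defect c xs = (\<Sum>(p, q, r)\<in>splits (length xs). \<Sum>e\<in>UNIV. \<Sum>c0\<in>UNIV.
     s (of_int (inf_coeff c c0 p e q r * sg (cdeg c0 (p + 1 + r)))) (D c0 (insert_D e p q xs)))"
  unfolding defect_def d_pure[of c]
  by (subst cof_proj_ext_sum[where f = "\<lambda>x. cof_proj s (d x)"]) (simp_all add: cof_proj_d_pure)

lemma sum_splits_filter:
  fixes F :: "_ \<Rightarrow> 'a"
  shows "(\<Sum>t\<in>{(p, q, r) \<in> splits n. Q p}. F t) = (\<Sum>t\<in>splits n. if Q (fst t) then F t else 0)"
proof -
  have "{(p, q, r) \<in> splits n. Q p} = {t \<in> splits n. Q (fst t)}" by auto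
  then show ?thesis by (simp only: sum.inter_filter[OF finite_splits])
qed

text \<open>With q = k + 1 the exponents are r (q - 1) + (p + r) = p + q r and (r + 1) (q - 1) + (p
  + r + 1) = p + q (r + 1). The signs of the defining relations are thus those of \<Delta>_(1) times
  the sign for passing the lower label.\<close>

lemma sg_insert:
  "of_int (sg (int r * int k)) * of_int (sg (cdeg Mu (Suc (p + r)))) = (of_int (sg (int p + (1 + int k) * int r)) :: 'k)"
  "c \<noteq> Mu \<Longrightarrow> of_int (sg (int k + int r * int k)) * of_int (sg (cdeg c (Suc (p + r)))) =
    (of_int (sg (int p + (1 + int k) * (int r + 1))) :: 'k)"
  unfolding of_int_mult[symmetric] sg_add[symmetric]
  by (rule arg_cong[where f = of_int], rule sg_cong, simp add: cdeg_def algebra_simps)+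

lemma defect_Mu: "defect Mu xs =
    (\<Sum>(p, q, r) \<in> splits (length xs). ksgn (p + q * r) (pcomp G (D Mu) p (D Mu) (int q - 2) q xs))"
  unfolding defect_eq
proof (intro sum.cong refl, clarify)
  fix p q r assume "(p, q, r) \<in> splits (length xs)"
  then obtain k where k: "q = Suc k" by (cases q) (auto simp: splits_def)
  show "(\<Sum>e\<in>UNIV. \<Sum>c0\<in>UNIV. s (of_int (inf_coeff Mu c0 p e q r * sg (cdeg c0 (p + 1 + r)))) (D c0 (insert_D e p q xs))) =
      ksgn (int (p + q * r)) (pcomp G (D Mu) p (D Mu) (int q - 2) q xs)"
    unfolding D_insert_D ksgn_scale k inf_coeff_Suc by (simp add: sum_agd sg_insert) (simp add: algebra_simps)
qed

lemma defect_H: "defect H xs =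
    (\<Sum>(p, q, r) \<in> splits (length xs). ksgn (p + q * r) (pcomp G (D Mu) p (D H) (int q - 1) q xs)) +
    (\<Sum>(p, q, r) \<in> splits (length xs). ksgn (p + q * (r + 1)) (pcomp G (D H) p (D Mu) (int q - 2) q xs))"
  unfolding defect_eq sum.distrib[symmetric]
proof (intro sum.cong refl, clarify)
  fix p q r assume "(p, q, r) \<in> splits (length xs)"
  then obtain k where k: "q = Suc k" by (cases q) (auto simp: splits_def)
  show "(\<Sum>e\<in>UNIV. \<Sum>c0\<in>UNIV. s (of_int (inf_coeff H c0 p e q r * sg (cdeg c0 (p + 1 + r)))) (D c0 (insert_D e p q xs))) =
      ksgn (int (p + q * r)) (pcomp G (D Mu) p (D H) (int q - 1) q xs) +
      ksgn (int (p + q * (r + 1))) (pcomp G (D H) p (D Mu) (int q - 2) q xs)"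
    unfolding D_insert_D ksgn_scale k inf_coeff_Suc by (simp add: sum_agd upper_label_def sg_insert) (simp add: algebra_simps)
qed

text \<open>The upper label is \<open>Dl\<close> for p = 0 and \<open>H\<close> for p \<ge> 1, which
  separates the first two sums.\<close>

lemma defect_Dl: "defect Dl xs =
    (\<Sum>(p, q, r) \<in> {(p, q, r) \<in> splits (length xs). p \<ge> 1}.
        ksgn (p + q * r) (pcomp G (D Mu) p (D H) (int q - 1) q xs)) +
    (\<Sum>(p, q, r) \<in> {(p, q, r) \<in> splits (length xs). p = 0}.
        ksgn (q * r) (pcomp G (D Mu) 0 (D Dl) (int q - 1) q xs)) +
    (\<Sum>(p, q, r) \<in> splits (length xs). ksgn (p + q * (r + 1)) (pcomp G (D Dl) p (D Mu) (int q - 2) q xs))"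
proof -
  have *: "(\<Sum>e\<in>UNIV. \<Sum>c0\<in>UNIV. s (of_int (inf_coeff Dl c0 p e q r * sg (cdeg c0 (p + 1 + r)))) (D c0 (insert_D e p q xs))) =
      (if 1 \<le> p then ksgn (int p + int q * int r) (pcomp G (D Mu) p (D H) (int q - 1) q xs) else 0) +
      (if p = 0 then ksgn (int q * int r) (pcomp G (D Mu) 0 (D Dl) (int q - 1) q xs) else 0) +
      ksgn (int (p + q * (r + 1))) (pcomp G (D Dl) p (D Mu) (int q - 2) q xs)"
    if t: "(p, q, r) \<in> splits (length xs)" for p q r
  proof -
    obtain k where k: "q = Suc k" using t by (cases q) (auto simp: splits_def)
    show ?thesis
      unfolding D_insert_D ksgn_scale k inf_coeff_Suc
      using sg_insert(1)[of r k 0] sg_insert(2)[of Dl k r 0]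
      by (cases "p = 0") (simp_all add: sum_agd upper_label_def sg_insert, simp_all add: algebra_simps)
  qed
  show ?thesis
    unfolding defect_eq sum_splits_filter sum.distrib[symmetric]
    by (rule sum.cong[OF refl], clarify, simp only: prod.case fst_conv *)
qed

lemma agd_infinity_iff_defect:
  "agd_infinity s G (D Mu) (D H) (D Dl) \<longleftrightarrow> (\<forall>c xs. xs \<noteq> [] \<longrightarrow> defect c xs = 0)"
proof -
  have all: "(\<forall>c. defect c xs = 0) \<longleftrightarrow> defect Mu xs = 0 \<and> defect H xs = 0 \<and> defect Dl xs = 0" for xs
    using UNIV_agd by (metis UNIV_I empty_iff insert_iff)
  have "agd_infinity s G (D Mu) (D H) (D Dl) \<longleftrightarrow>
      (\<forall>n\<ge>1. \<forall>xs. length xs = n \<longrightarrow> defect Mu xs = 0 \<and> defect H xs = 0 \<and> defect Dl xs = 0)"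
    using ops[of Mu] ops[of H] ops[of Dl]
    unfolding agd_infinity_def defect_Mu defect_H defect_Dl by simp
  also have "\<dots> \<longleftrightarrow> (\<forall>xs. xs \<noteq> [] \<longrightarrow> (\<forall>c. defect c xs = 0))"
    unfolding all by (auto simp: Suc_le_eq)
  finally show ?thesis by blast
qed

lemma square_zero_d_iff: "(\<forall>x\<in>C. d (d x) = 0) \<longleftrightarrow> (\<forall>c xs. xs \<noteq> [] \<longrightarrow> defect c xs = 0)"
proof (intro iffI allI impI ballI)
  fix c and xs :: "'a list" assume z: "\<forall>x\<in>C. d (d x) = 0" and xs: "xs \<noteq> []"
  have "d (d (P c xs)) = 0" by (rule bspec[OF z pure_in[OF xs subset_UNIV]])
  then show "defect c xs = 0" unfolding defect_def by (simp only: proj.zero)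
next
  fix x assume z: "\<forall>c xs. xs \<noteq> [] \<longrightarrow> defect c xs = 0" and x: "x \<in> C"
  have "coder (2 * -1) (\<lambda>x. d (d x))"
    by (rule coder_square[OF coder_d _ d_homogeneous]) simp
  then show "d (d x) = 0"
  proof (rule coder_eqI[OF _ coder_0 _ x])
    show "cof_proj s (d (d (P c xs))) = cof_proj s 0" if "xs \<noteq> []" for c xs
      using z that unfolding defect_def proj.zero by blast
  qed
qed

end

section \<open>Components of a coderivation and the bijection\<close>

context cofree
begin

lemma deriv_cong:
  assumes "\<And>x. x \<in> C \<Longrightarrow> d x = d' x" "linear_on fscale fscale C d" "\<And>x. x \<in> C \<Longrightarrow> d x \<in> C" "z \<in> C.C"
  shows "deriv e d z = deriv e d' z"
proof (rule C.cof_linear_eq[OF linear_on_deriv linear_on_deriv vector_space_fscale _ assms(4)])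
  fix c ys assume ys: "set ys \<subseteq> C"
  have d': "linear_on fscale fscale C d'"
    using linear_on_cong[of C d d' fscale fscale] assms(1,2) subC fs.module_axioms by blast
  have "slot e d i ys = slot e d' i ys" if "i < length ys" for i
    using ys that assms(1) by (simp add: slot_def subset_iff)
  then show "deriv e d (C.P c ys) = deriv e d' (C.P c ys)"
    using assms by (simp add: deriv_pure[OF assms(2)] deriv_pure[OF d'])
qed

text \<open>The link between total maps, for which \<open>coder\<close> is stated, and maps that are
  \<open>undefined\<close> outside the carrier, as \<open>coderivation\<close> demands.\<close>

lemma coderivation_cong:
  assumes "\<And>x. x \<in> C \<Longrightarrow> d x = d' x" "d' \<in> extensional C"
  shows "coderivation fscale C GC \<Delta> e d' \<longleftrightarrow> coder e d \<and> (\<forall>k. \<forall>x\<in>GC k. d x \<in> GC (k + e))"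
proof -
  have "linear_on fscale fscale C d' \<longleftrightarrow> linear_on fscale fscale C d"
    using linear_on_cong[of C d d' fscale fscale] assms(1) subC fs.module_axioms by blast
  moreover have "(\<forall>k. \<forall>x\<in>GC k. d' x \<in> GC (k + e)) \<longleftrightarrow> (\<forall>k. \<forall>x\<in>GC k. d x \<in> GC (k + e))"
  proof -
    have "d x = d' x" if "x \<in> GC k" for x k using assms(1) GC_subset that by blast
    then show ?thesis by simp
  qed
  moreover have "d' \<in> C \<rightarrow>\<^sub>E C \<longleftrightarrow> (\<forall>x\<in>C. d x \<in> C)"
    using assms by (auto simp: PiE_def Pi_def)
  ultimately show ?thesis
    unfolding coderivation_def coder_def using deriv_cong[OF assms(1) _ _ cof_decomp_in] assms(1) by auto
qed

lemma component_operations: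
  assumes "coderivation fscale C GC \<Delta> (-1) d"
  shows "operations s G (if c = Mu then -2 else -1) (component s d c)"
proof -
  have d: "linear_on fscale fscale C d" "\<And>x. x \<in> C \<Longrightarrow> d x \<in> C" "\<And>k x. x \<in> GC k \<Longrightarrow> d x \<in> GC (k + (-1))"
    using assms by (auto simp: coderivation_def)
  have "mlin s s UNIV n (component s d c)" for n
  proof (cases n)
    case 0
    then show ?thesis by (simp add: mlin_def)
  next
    case (Suc k)
    have "mlin s s UNIV n (\<lambda>xs. cof_proj s (d (P c xs)))"
      by (rule mlin_compose[OF pure_mlin linear_on_compose[OF d(1) cof_proj_linear]])
        (use Suc in \<open>auto intro!: pure_in d(2)\<close>)
    then show ?thesis
      by (rule iffD1[OF mlin_cong[OF subV module_axioms], rotated]) (use Suc in \<open>auto simp: component_def\<close>)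
  qed
  moreover have "component s d c xs \<in> G (sum_list ds + int (length xs) + (if c = Mu then -2 else -1))"
    if "xs \<noteq> []" "list_all2 (\<lambda>x d. x \<in> G d) xs ds" for xs ds
  proof -
    have "homogeneous xs (sum_list ds)" using that by (auto simp: homogeneous_def)
    from cof_proj_homogeneous[OF d(3)[OF pure_homogeneous[OF that(1) this]], of c] show ?thesis
      using that(1) by (auto simp: component_def cdeg_def algebra_simps split: if_splits)
  qed
  ultimately show ?thesis by (simp add: operations_def multilinear_on_iff_mlin component_def)
qed

end

theorem theorem0p5:
  fixes s :: "'k::field_char_0 \<Rightarrow> 'a::ab_group_add \<Rightarrow> 'a"
    and G :: "int \<Rightarrow> 'a set"
  assumes "graded_space s UNIV G"
  shows "bij_betw (\<lambda>d. (component s d Mu, component s d H, component s d Dl))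
    {d. coderivation fscale (cof_space s UNIV) (cof_grading s UNIV G) (cof_decomp s UNIV G) (-1) d \<and>
        square_zero (cof_space s UNIV) d}
    {(m, h, \<delta>). agd_infinity s G m h \<delta>}"
proof -
  interpret cofree s G by unfold_locales (rule assms)
  let ?K = "\<lambda>d. coderivation fscale C GC \<Delta> (-1) d"
  have components: "corestriction s G (component s d)" if "?K d" for d
    using component_operations[OF that] by (simp add: corestriction_def corestriction_axioms_def cofree_axioms)
  have recover: "d x = corestriction.d s G (component s d) x" if d: "?K d" and x: "x \<in> C" for d x
  proof -
    interpret D: corestriction s G "component s d" by (rule components[OF d])
    have ext: "d \<in> extensional C" using d by (auto simp: coderivation_def PiE_def)
    have "coder (-1) d" using d coderivation_cong[OF refl ext] by blast
    then show ?thesis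
      by (rule coder_eqI[OF _ D.coder_d _ x]) (simp add: D.cof_proj_d_pure component_def)
  qed
  have square: "square_zero C d \<longleftrightarrow> agd_infinity s G (component s d Mu) (component s d H) (component s d Dl)"
    if d: "?K d" for d
  proof -
    interpret D: corestriction s G "component s d" by (rule components[OF d])
    have "square_zero C d \<longleftrightarrow> (\<forall>x\<in>C. D.d (D.d x) = 0)"
      using recover[OF d] D.d_in by (simp add: square_zero_def)
    then show ?thesis by (simp add: D.square_zero_d_iff D.agd_infinity_iff_defect)
  qed
  show ?thesis
    unfolding bij_betw_def
  proof
    show "inj_on (\<lambda>d. (component s d Mu, component s d H, component s d Dl)) {d. ?K d \<and> square_zero C d}"
    proof (rule inj_onI)
      fix d d' assume d: "d \<in> {d. ?K d \<and> square_zero C d}" "d' \<in> {d. ?K d \<and> square_zero C d}"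
        and eq: "(component s d Mu, component s d H, component s d Dl) = (component s d' Mu, component s d' H, component s d' Dl)"
      then have "component s d c = component s d' c" for c by (cases c) auto
      then have "component s d = component s d'" by blast
      then have "d x = d' x" if "x \<in> C" for x using recover d that by simp
      moreover have "d \<in> extensional C" "d' \<in> extensional C" using d by (auto simp: coderivation_def PiE_def)
      ultimately show "d = d'" using extensionalityI[of d C d'] by blast
    qed
    show "(\<lambda>d. (component s d Mu, component s d H, component s d Dl)) ` {d. ?K d \<and> square_zero C d} =
        {(m, h, \<delta>). agd_infinity s G m h \<delta>}"
    proof
      show "(\<lambda>d. (component s d Mu, component s d H, component s d Dl)) ` {d. ?K d \<and> square_zero C d} \<subseteq>
          {(m, h, \<delta>). agd_infinity s G m h \<delta>}"
        using square by auto
      show "{(m, h, \<delta>). agd_infinity s G m h \<delta>} \<subseteq>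
          (\<lambda>d. (component s d Mu, component s d H, component s d Dl)) ` {d. ?K d \<and> square_zero C d}"
      proof clarify
        fix m h \<delta> assume A: "agd_infinity s G m h \<delta>"
        define D where "D c = (case c of Mu \<Rightarrow> m | H \<Rightarrow> h | Dl \<Rightarrow> \<delta>)" for c
        interpret D: corestriction s G D
          by unfold_locales (use A in \<open>auto simp: D_def agd_infinity_def split: agd.split\<close>)
        define d where "d = restrict D.d C"
        have d: "?K d"
          using coderivation_cong[of D.d d "-1"] D.coder_d D.d_homogeneous by (simp add: d_def)
        have comp: "component s d = D"
        proof (intro ext)
          fix c xs
          show "component s d c xs = D c xs"
            \<comment> \<open>On the empty list both sides are 0 by convention, on the left by
              \<open>component\<close> and on the right by \<open>operations\<close>. Without this
              agreement the two functions could differ there.\<close>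
            using D.ops[of c] by (auto simp: component_def d_def pure_in D.cof_proj_d_pure operations_def)
        qed
        have "square_zero C d" unfolding square[OF d] comp using A by (simp add: D_def)
        then show "(m, h, \<delta>) \<in> (\<lambda>d. (component s d Mu, component s d H, component s d Dl)) ` {d. ?K d \<and> square_zero C d}"
          using d by (intro image_eqI[of _ _ d]) (auto simp: comp D_def)
      qed
    qed
  qed
qed

end
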